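(* Assume (F1)–(F4), (G1) and (G3) of the context, and assume moreover that $f_1(\varphi,\psi,w)=f_1(\varphi,\psi)$ and $f_2(\varphi,\psi,w)=f_2(\varphi,\psi)$ do not depend on $w$. For $\ell>0$ let $\mathbf{A}_\ell\subset\mathcal{H}$ be the global attractor of the Bresse system, and let $\mathbf{A}_0\subset\mathcal{H}_0$ be the global attractor of the Timoshenko system. Then $\mathbf{A}_\ell$ is upper-semicontinuous as $\ell\to0$ in the sense that $$\lim_{\ell\to0}d^{\mathcal{H}_0}(\mathcal{P}\mathbf{A}_\ell,\mathbf{A}_0)=0,$$ where $\mathcal{P}:\mathcal{H}\to\mathcal{H}_0$, $\mathcal{P}(\varphi,\psi,w,\tilde\varphi,\tilde\psi,\tilde w)=(\varphi,\psi,\tilde\varphi,\tilde\psi)$, and $d^{\mathcal{H}_0}(X,Y)=\sup_{x\in X}\inf_{y\in Y}\|x-y\|_{\mathcal{H}_0}$ is the Hausdorff semi-distance.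
   Context: Fix $L>0$, $\rho_1,\rho_2,b,k,k_0>0$; $\|\cdot\|$ is the $L^2(0,L)$ norm; $\mathcal{H}=H^1_0(0,L)^3\times L^2(0,L)^3$, $\mathcal{H}_0=H^1_0(0,L)^2\times L^2(0,L)^2$, with standard product norms. For $\ell>0$ the Bresse system is $\rho_1\varphi_{tt}-k(\varphi_x+\psi+\ell w)_x-k_0\ell(w_x-\ell\varphi)+g_1(\varphi_t)+f_1=0$, $\rho_2\psi_{tt}-b\psi_{xx}+k(\varphi_x+\psi+\ell w)+g_2(\psi_t)+f_2=0$, $\rho_1w_{tt}-k_0(w_x-\ell\varphi)_x+k\ell(\varphi_x+\psi+\ell w)+g_3(w_t)+f_3(\varphi,\psi,w)=0$ on $(0,L)\times\mathbb{R}^+$ with $\varphi=\psi=w=0$ at $x=0,L$; it generates a dynamical system $(\mathcal{H},S_\ell(t))$ possessing a global attractor $\mathbf{A}_\ell$. The Timoshenko system is $\rho_1\varphi_{tt}-k(\varphi_x+\psi)_x+g_1(\varphi_t)+f_1(\varphi,\psi)=0$, $\rho_2\psi_{tt}-b\psi_{xx}+k(\varphi_x+\psi)+g_2(\psi_t)+f_2(\varphi,\psi)=0$ on $(0,L)\times\mathbb{R}^+$ with $\varphi=\psi=0$ at $x=0,L$; it generates a dynamical system $(\mathcal{H}_0,S_0(t))$ with global attractor $\mathbf{A}_0$. A global attractor is a compact, fully invariant set attracting every bounded set in the Hausdorff semi-distance. Let $\gamma_3>0$ satisfy $\|\varphi_x\|^2+\|\psi_x\|^2+\|w_x\|^2\le\gamma_3(b\|\psi_x\|^2+k\|\varphi_x+\psi+\ell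 w\|^2+k_0\|w_x-\ell\varphi\|^2)$ for all $\varphi,\psi,w\in H^1_0(0,L)$ (for $\ell\in[0,\ell_0]$ with $\ell_0<\pi/(2L)$ such a $\gamma_3$ can be chosen independent of $\ell$). Hypotheses: (F1) $F\in C^2(\mathbb{R}^3)$, $\nabla F=(f_1,f_2,f_3)$; (F2) there are $\beta,m_F\ge0$, $0\le\beta<\pi^2/(2\gamma_3L^2)$, with $F(u,v,w)\ge-\beta(u^2+v^2+w^2)-m_F$; (F3) there are $p\ge1$, $C_f>0$ with $|\nabla f_i(u,v,w)|\le C_f(1+|u|^{p-1}+|v|^{p-1}+|w|^{p-1})$; (F4) $\nabla F(u,v,w)\cdot(u,v,w)-F(u,v,w)\ge-\beta(u^2+v^2+w^2)-m_F$; (G1) $g_i\in C^1(\mathbb{R})$ increasing, $g_i(0)=0$; (G3) there are $m_i,M_i>0$ with $m_i\le g_i'(s)\le M_i$ for all $s\in\mathbb{R}$. *)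

theory Defs
  imports "HOL-Analysis.Analysis"
begin

text \<open>Functions on (0,L) are represented by functions real to real; only their
values on [0,L] matter.  All norms are (semi)norms on representatives.\<close>

type_synonym rfun = "real \<Rightarrow> real"
type_synonym st6 = "rfun \<times> rfun \<times> rfun \<times> rfun \<times> rfun \<times> rfun"
type_synonym st4 = "rfun \<times> rfun \<times> rfun \<times> rfun"

definition l2 :: "real \<Rightarrow> rfun \<Rightarrow> bool" where
  "l2 L u \<longleftrightarrow> set_borel_measurable lborel {0..L} u \<and>
      set_integrable lborel {0..L} (\<lambda>x. (u x)\<^sup>2)"

definition ip :: "real \<Rightarrow> rfun \<Rightarrow> rfun \<Rightarrow> real" where
  "ip L u v = (LINT x:{0..L}|lborel. u x * v x)"

definition nrm :: "real \<Rightarrow> rfun \<Rightarrow> real" where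
  "nrm L u = sqrt (ip L u u)"

text \<open>H^1_0(0,L) in one dimension: absolutely continuous functions with
L^2 derivative vanishing at 0 and L.\<close>
definition h10 :: "real \<Rightarrow> rfun \<Rightarrow> bool" where
  "h10 L u \<longleftrightarrow> (\<exists>v. l2 L v \<and> (\<forall>x\<in>{0..L}. u x = (LINT t:{0..x}|lborel. v t)) \<and> u L = 0)"

definition dx :: "real \<Rightarrow> rfun \<Rightarrow> rfun" where
  "dx L u = (SOME v. l2 L v \<and> (\<forall>x\<in>{0..L}. u x = (LINT t:{0..x}|lborel. v t)))"

definition c1 :: "st6 \<Rightarrow> rfun" where "c1 U = fst U"
definition c2 :: "st6 \<Rightarrow> rfun" where "c2 U = fst (snd U)"
definition c3 :: "st6 \<Rightarrow> rfun" where "c3 U = fst (snd (snd U))"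
definition c4 :: "st6 \<Rightarrow> rfun" where "c4 U = fst (snd (snd (snd U)))"
definition c5 :: "st6 \<Rightarrow> rfun" where "c5 U = fst (snd (snd (snd (snd U))))"
definition c6 :: "st6 \<Rightarrow> rfun" where "c6 U = snd (snd (snd (snd (snd U))))"

definition d1 :: "st4 \<Rightarrow> rfun" where "d1 U = fst U"
definition d2 :: "st4 \<Rightarrow> rfun" where "d2 U = fst (snd U)"
definition d3 :: "st4 \<Rightarrow> rfun" where "d3 U = fst (snd (snd U))"
definition d4 :: "st4 \<Rightarrow> rfun" where "d4 U = snd (snd (snd U))"

definition inH6 :: "real \<Rightarrow> st6 \<Rightarrow> bool" where
  "inH6 L U \<longleftrightarrow> h10 L (c1 U) \<and> h10 L (c2 U) \<and> h10 L (c3 U) \<and>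
      l2 L (c4 U) \<and> l2 L (c5 U) \<and> l2 L (c6 U)"

definition nH6 :: "real \<Rightarrow> st6 \<Rightarrow> real" where
  "nH6 L U = sqrt ((nrm L (dx L (c1 U)))\<^sup>2 + (nrm L (dx L (c2 U)))\<^sup>2 + (nrm L (dx L (c3 U)))\<^sup>2
      + (nrm L (c4 U))\<^sup>2 + (nrm L (c5 U))\<^sup>2 + (nrm L (c6 U))\<^sup>2)"

definition sub6 :: "st6 \<Rightarrow> st6 \<Rightarrow> st6" where
  "sub6 U V = ((\<lambda>x. c1 U x - c1 V x), (\<lambda>x. c2 U x - c2 V x), (\<lambda>x. c3 U x - c3 V x),
              (\<lambda>x. c4 U x - c4 V x), (\<lambda>x. c5 U x - c5 V x), (\<lambda>x. c6 U x - c6 V x))"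

definition dist6 :: "real \<Rightarrow> st6 \<Rightarrow> st6 \<Rightarrow> real" where
  "dist6 L U V = nH6 L (sub6 U V)"

definition inH4 :: "real \<Rightarrow> st4 \<Rightarrow> bool" where
  "inH4 L U \<longleftrightarrow> h10 L (d1 U) \<and> h10 L (d2 U) \<and> l2 L (d3 U) \<and> l2 L (d4 U)"

definition nH4 :: "real \<Rightarrow> st4 \<Rightarrow> real" where
  "nH4 L U = sqrt ((nrm L (dx L (d1 U)))\<^sup>2 + (nrm L (dx L (d2 U)))\<^sup>2
      + (nrm L (d3 U))\<^sup>2 + (nrm L (d4 U))\<^sup>2)"

definition sub4 :: "st4 \<Rightarrow> st4 \<Rightarrow> st4" where
  "sub4 U V = ((\<lambda>x. d1 U x - d1 V x), (\<lambda>x. d2 U x - d2 V x),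
              (\<lambda>x. d3 U x - d3 V x), (\<lambda>x. d4 U x - d4 V x))"

definition dist4 :: "real \<Rightarrow> st4 \<Rightarrow> st4 \<Rightarrow> real" where
  "dist4 L U V = nH4 L (sub4 U V)"

definition proj :: "st6 \<Rightarrow> st4" where
  "proj U = (c1 U, c2 U, c4 U, c5 U)"

text \<open>Weak solutions of the Bresse system (state U t = (phi,psi,w,phi_t,psi_t,w_t)).
 g i: damping functions (i=1,2,3), f i: source terms as functions of (phi,psi,w).\<close>
definition bresse_sol :: "real \<Rightarrow> real \<Rightarrow> real \<Rightarrow> real \<Rightarrow> real \<Rightarrow> real \<Rightarrow> real \<Rightarrow>
    (nat \<Rightarrow> real \<Rightarrow> real) \<Rightarrow> (nat \<Rightarrow> real \<times> real \<times> real \<Rightarrow> real) \<Rightarrow> (real \<Rightarrow> st6) \<Rightarrow> bool" where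
  "bresse_sol L \<rho>1 \<rho>2 b k k0 l g f U \<longleftrightarrow>
    (\<forall>t\<ge>0. inH6 L (U t)) \<and>
    (\<forall>t\<ge>0. ((\<lambda>s. dist6 L (U s) (U t)) \<longlongrightarrow> 0) (at t within {0..})) \<and>
    (\<forall>t\<ge>0. \<forall>h. l2 L h \<longrightarrow>
        ip L (c1 (U t)) h - ip L (c1 (U 0)) h = integral {0..t} (\<lambda>s. ip L (c4 (U s)) h) \<and>
        ip L (c2 (U t)) h - ip L (c2 (U 0)) h = integral {0..t} (\<lambda>s. ip L (c5 (U s)) h) \<and>
        ip L (c3 (U t)) h - ip L (c3 (U 0)) h = integral {0..t} (\<lambda>s. ip L (c6 (U s)) h)) \<and>
    (\<forall>t\<ge>0. \<forall>h. h10 L h \<longrightarrow>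
        \<rho>1 * ip L (c4 (U t)) h - \<rho>1 * ip L (c4 (U 0)) h = integral {0..t} (\<lambda>s.
           - k * ip L (\<lambda>x. dx L (c1 (U s)) x + c2 (U s) x + l * c3 (U s) x) (dx L h)
           + k0 * l * ip L (\<lambda>x. dx L (c3 (U s)) x - l * c1 (U s) x) h
           - ip L (\<lambda>x. g 1 (c4 (U s) x)) h
           - ip L (\<lambda>x. f 1 (c1 (U s) x, c2 (U s) x, c3 (U s) x)) h) \<and>
        \<rho>2 * ip L (c5 (U t)) h - \<rho>2 * ip L (c5 (U 0)) h = integral {0..t} (\<lambda>s.
           - b * ip L (dx L (c2 (U s))) (dx L h)
           - k * ip L (\<lambda>x. dx L (c1 (U s)) x + c2 (U s) x + l * c3 (U s) x) h
           - ip L (\<lambda>x. g 2 (c5 (U s) x)) h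
           - ip L (\<lambda>x. f 2 (c1 (U s) x, c2 (U s) x, c3 (U s) x)) h) \<and>
        \<rho>1 * ip L (c6 (U t)) h - \<rho>1 * ip L (c6 (U 0)) h = integral {0..t} (\<lambda>s.
           - k0 * ip L (\<lambda>x. dx L (c3 (U s)) x - l * c1 (U s) x) (dx L h)
           - k * l * ip L (\<lambda>x. dx L (c1 (U s)) x + c2 (U s) x + l * c3 (U s) x) h
           - ip L (\<lambda>x. g 3 (c6 (U s) x)) h
           - ip L (\<lambda>x. f 3 (c1 (U s) x, c2 (U s) x, c3 (U s) x)) h))"

text \<open>Weak solutions of the Timoshenko system (state (phi,psi,phi_t,psi_t));
 the sources f 1, f 2 are evaluated at (phi,psi,0) (they do not depend on w).\<close>
definition timo_sol :: "real \<Rightarrow> real \<Rightarrow> real \<Rightarrow> real \<Rightarrow> real \<Rightarrow>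
    (nat \<Rightarrow> real \<Rightarrow> real) \<Rightarrow> (nat \<Rightarrow> real \<times> real \<times> real \<Rightarrow> real) \<Rightarrow> (real \<Rightarrow> st4) \<Rightarrow> bool" where
  "timo_sol L \<rho>1 \<rho>2 b k g f U \<longleftrightarrow>
    (\<forall>t\<ge>0. inH4 L (U t)) \<and>
    (\<forall>t\<ge>0. ((\<lambda>s. dist4 L (U s) (U t)) \<longlongrightarrow> 0) (at t within {0..})) \<and>
    (\<forall>t\<ge>0. \<forall>h. l2 L h \<longrightarrow>
        ip L (d1 (U t)) h - ip L (d1 (U 0)) h = integral {0..t} (\<lambda>s. ip L (d3 (U s)) h) \<and>
        ip L (d2 (U t)) h - ip L (d2 (U 0)) h = integral {0..t} (\<lambda>s. ip L (d4 (U s)) h)) \<and>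
    (\<forall>t\<ge>0. \<forall>h. h10 L h \<longrightarrow>
        \<rho>1 * ip L (d3 (U t)) h - \<rho>1 * ip L (d3 (U 0)) h = integral {0..t} (\<lambda>s.
           - k * ip L (\<lambda>x. dx L (d1 (U s)) x + d2 (U s) x) (dx L h)
           - ip L (\<lambda>x. g 1 (d3 (U s) x)) h
           - ip L (\<lambda>x. f 1 (d1 (U s) x, d2 (U s) x, 0)) h) \<and>
        \<rho>2 * ip L (d4 (U t)) h - \<rho>2 * ip L (d4 (U 0)) h = integral {0..t} (\<lambda>s.
           - b * ip L (dx L (d2 (U s))) (dx L h)
           - k * ip L (\<lambda>x. dx L (d1 (U s)) x + d2 (U s) x) h
           - ip L (\<lambda>x. g 2 (d4 (U s) x)) h
           - ip L (\<lambda>x. f 2 (d1 (U s) x, d2 (U s) x, 0)) h))"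

text \<open>Hausdorff semi-distance (extended-real valued, so it is defined for all sets)\<close>
definition hsemi :: "('a \<Rightarrow> 'a \<Rightarrow> real) \<Rightarrow> 'a set \<Rightarrow> 'a set \<Rightarrow> ereal" where
  "hsemi d X Y = (SUP x\<in>X. INF y\<in>Y. ereal (d x y))"

text \<open>Global attractor of a dynamical system (X, S) with X given by a predicate,
 a pseudo-distance d and a norm nr (for bounded sets).  Compactness is sequential
 compactness w.r.t. d (equivalent to compactness in a (pseudo)metric space).\<close>
definition global_attractor :: "('a \<Rightarrow> bool) \<Rightarrow> ('a \<Rightarrow> 'a \<Rightarrow> real) \<Rightarrow> ('a \<Rightarrow> real) \<Rightarrow>
    (real \<Rightarrow> 'a \<Rightarrow> 'a) \<Rightarrow> 'a set \<Rightarrow> bool" where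
  "global_attractor inX d nr S A \<longleftrightarrow>
    A \<subseteq> Collect inX \<and>
    (\<forall>s::nat \<Rightarrow> 'a. (\<forall>n. s n \<in> A) \<longrightarrow> (\<exists>r a. strict_mono r \<and> a \<in> A \<and> ((\<lambda>n. d (s (r n)) a) \<longlongrightarrow> 0) sequentially)) \<and>
    (\<forall>t\<ge>0. S t ` A = A) \<and>
    (\<forall>B. B \<subseteq> Collect inX \<and> (\<exists>R. \<forall>x\<in>B. nr x \<le> R) \<longrightarrow>
        (\<forall>e>0. eventually (\<lambda>t. hsemi d (S t ` B) A < ereal e) at_top))"

text \<open>Real power |u|^a with the convention 0^0 = 1 (powr has 0 powr 0 = 0).\<close>
definition rpw :: "real \<Rightarrow> real \<Rightarrow> real" where
  "rpw x a = (if x = 0 then (if a = 0 then 1 else 0) else x powr a)"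

end

theory Submission
  imports Defs
begin

text \<open>Two estimates give the result.  Along a Bresse trajectory the energy decreases, and (F4) together
  with the sharp Poincare inequality makes the energy plus a multiple of \<open>\<langle>\<rho> u', u\<rangle>\<close> decrease at rate at
  least \<open>energy - mF L\<close>; since every point of an attractor is the endpoint of arbitrarily long
  trajectories in that bounded attractor, its energy is at most \<open>mF L\<close>, a bound independent of \<open>l\<close>.
  On the other hand the first two components of a Bresse solution solve the Timoshenko system up to
  \<open>L\<^sup>2\<close> forces of size \<open>O(l)\<close>, so by Gronwall they stay within \<open>O(l)\<close> of the Timoshenko solution with the
  same data on each fixed time interval.  A time after which the Timoshenko flow has brought a bounded
  set close to its attractor then serves all small \<open>l\<close>.\<close>

section \<open>Square-integrable functions on the interval\<close>

text \<open>Velocities lie only in L^2 while the momentum equations admit H^1_0 test functions, so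
  the energy law and the law for the difference of two flows must be derived without testing with
  the velocity; \<open>two_time_energy\<close> serves both. The condition on \<beta> is strict, so a
  Poincare constant slightly below the sharp (pi/L)^2 lets the elastic energy absorb the
  \<beta>-terms of (F2) and (F4) with a positive fraction to spare, and that fraction absorbs the
  damping cross term. In the comparison no limit of w is taken: since the first two sources do not
  depend on w, it enters their equations only with a factor l, and a bound on w suffices. The
  sources are Lipschitz only on bounded sets and the Timoshenko trajectories are not bounded in
  advance; Gronwall is therefore run while the gap energy is at most 1, and small l keeps it there.
  Functions stand for their L^2 classes and \<open>dx\<close> is a choice of derivative, so
  identities between derivatives hold almost everywhere and pass through norms and inner
  products.\<close>

abbreviation mu :: "real \<Rightarrow> real measure" where
  "mu L \<equiv> restrict_space lborel {0..L}"

lemma space_mu [simp]: "space (mu L) = {0..L}"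
  by (simp add: space_restrict_space)

lemma finite_measure_mu: "finite_measure (mu L)"
  by (rule finite_measureI) (simp add: space_restrict_space emeasure_restrict_space emeasure_lborel_Icc_eq)

lemma measure_mu: "0 \<le> L \<Longrightarrow> measure (mu L) {0..L} = L"
  by (simp add: measure_restrict_space)

lemma set_integral_mu: "(LINT x:{0..L}|lborel. u x) = (LINT x|mu L. u x)" for u :: rfun
  by (simp add: integral_restrict_space set_lebesgue_integral_def)

lemma set_integrable_mu: "set_integrable lborel {0..L} u \<longleftrightarrow> integrable (mu L) u" for u :: rfun
  by (simp add: integrable_restrict_space set_integrable_def)

lemma l2_iff: "l2 L u \<longleftrightarrow> u \<in> borel_measurable (mu L) \<and> integrable (mu L) (\<lambda>x. (u x)\<^sup>2)"
  unfolding l2_def set_integrable_mu set_borel_measurable_def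
  by (subst borel_measurable_restrict_space_iff) auto

lemma l2_measurable: "l2 L u \<Longrightarrow> u \<in> borel_measurable (mu L)"
  by (simp add: l2_iff)

lemma ip_eq: "ip L u v = (LINT x|mu L. u x * v x)"
  by (simp add: ip_def set_integral_mu)

lemma l2_mult_integrable:
  assumes "l2 L u" "l2 L v"
  shows "integrable (mu L) (\<lambda>x. u x * v x)"
proof (rule Bochner_Integration.integrable_bound)
  show "integrable (mu L) (\<lambda>x. (u x)\<^sup>2 + (v x)\<^sup>2)"
    using assms by (auto simp: l2_iff)
  show "(\<lambda>x. u x * v x) \<in> borel_measurable (mu L)"
    using assms by (auto simp: l2_iff)
  have "\<bar>u x * v x\<bar> \<le> (u x)\<^sup>2 + (v x)\<^sup>2" for x
  proof -
    have "2 * \<bar>u x * v x\<bar> \<le> (u x)\<^sup>2 + (v x)\<^sup>2"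
      using sum_squares_bound[of "\<bar>u x\<bar>" "\<bar>v x\<bar>"] by (simp add: abs_mult mult.assoc)
    moreover have "0 \<le> \<bar>u x * v x\<bar>" by simp
    ultimately show ?thesis by linarith
  qed
  then show "AE x in mu L. norm (u x * v x) \<le> norm ((u x)\<^sup>2 + (v x)\<^sup>2)"
    by (auto intro!: AE_I2)
qed

lemma l2_bounded:
  assumes "u \<in> borel_measurable (mu L)" "\<And>x. x \<in> {0..L} \<Longrightarrow> \<bar>u x\<bar> \<le> B"
  shows "l2 L u"
proof -
  interpret finite_measure "mu L" by (rule finite_measure_mu)
  have "(u x)\<^sup>2 \<le> B\<^sup>2" if "x \<in> {0..L}" for x
    using assms(2)[OF that] by (metis abs_ge_zero power2_abs power_mono)
  then have "integrable (mu L) (\<lambda>x. (u x)\<^sup>2)"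
    using assms(1) by (intro integrable_const_bound[where B="B\<^sup>2"]) (auto intro!: AE_I2)
  with assms(1) show ?thesis by (simp add: l2_iff)
qed

lemma l2_const [intro!, simp]: "l2 L (\<lambda>x. c)"
  by (rule l2_bounded[where B="\<bar>c\<bar>"]) auto

lemma l2_integrable: "l2 L u \<Longrightarrow> integrable (mu L) u"
  using l2_mult_integrable[of L u "\<lambda>x. 1"] by simp

lemma l2_cmult [intro]: "l2 L u \<Longrightarrow> l2 L (\<lambda>x. c * u x)"
  by (auto simp: l2_iff power_mult_distrib)

lemma l2_add [intro]:
  assumes "l2 L u" "l2 L v" shows "l2 L (\<lambda>x. u x + v x)"
proof -
  have "(\<lambda>x. (u x + v x)\<^sup>2) = (\<lambda>x. (u x)\<^sup>2 + (v x)\<^sup>2 + 2 * (u x * v x))"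
    by (auto simp: power2_eq_square algebra_simps)
  then show ?thesis
    using assms l2_mult_integrable[OF assms] by (auto simp: l2_iff)
qed

lemma l2_minus [intro]: "l2 L u \<Longrightarrow> l2 L (\<lambda>x. - u x)"
  using l2_cmult[of L u "-1"] by simp

lemma l2_diff [intro]: "l2 L u \<Longrightarrow> l2 L v \<Longrightarrow> l2 L (\<lambda>x. u x - v x)"
  using l2_add[of L u "\<lambda>x. - v x"] by auto

lemma l2_le:
  assumes "l2 L u" "v \<in> borel_measurable (mu L)" "\<And>x. x \<in> {0..L} \<Longrightarrow> \<bar>v x\<bar> \<le> C * \<bar>u x\<bar>"
  shows "l2 L v"
  unfolding l2_iff
proof
  show "integrable (mu L) (\<lambda>x. (v x)\<^sup>2)"
  proof (rule Bochner_Integration.integrable_bound)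
    show "integrable (mu L) (\<lambda>x. C\<^sup>2 * (u x)\<^sup>2)" using assms(1) by (auto simp: l2_iff)
    show "(\<lambda>x. (v x)\<^sup>2) \<in> borel_measurable (mu L)" using assms by auto
    have "(v x)\<^sup>2 \<le> C\<^sup>2 * (u x)\<^sup>2" if "x \<in> {0..L}" for x
      using power_mono[OF assms(3)[OF that] abs_ge_zero, of 2] by (simp add: power_mult_distrib)
    then show "AE x in mu L. norm ((v x)\<^sup>2) \<le> norm (C\<^sup>2 * (u x)\<^sup>2)"
      by (auto intro!: AE_I2)
  qed
qed (fact assms)

lemma ip_commute: "ip L u v = ip L v u"
  by (simp add: ip_eq mult.commute)

lemma ip_add_left: "l2 L u \<Longrightarrow> l2 L v \<Longrightarrow> l2 L h \<Longrightarrow> ip L (\<lambda>x. u x + v x) h = ip L u h + ip L v h"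
  by (simp add: ip_eq distrib_right l2_mult_integrable)

lemma ip_diff_left: "l2 L u \<Longrightarrow> l2 L v \<Longrightarrow> l2 L h \<Longrightarrow> ip L (\<lambda>x. u x - v x) h = ip L u h - ip L v h"
  by (simp add: ip_eq left_diff_distrib l2_mult_integrable)

lemma ip_cmult_left: "ip L (\<lambda>x. c * u x) h = c * ip L u h"
  by (simp add: ip_eq mult.assoc)

lemma ip_minus_left: "ip L (\<lambda>x. - u x) h = - ip L u h"
  using ip_cmult_left[of L "-1"] by simp

lemma ip_add_right: "l2 L u \<Longrightarrow> l2 L v \<Longrightarrow> l2 L h \<Longrightarrow> ip L h (\<lambda>x. u x + v x) = ip L h u + ip L h v"
  by (simp add: ip_commute[of L h] ip_add_left)

lemma ip_diff_right: "l2 L u \<Longrightarrow> l2 L v \<Longrightarrow> l2 L h \<Longrightarrow> ip L h (\<lambda>x. u x - v x) = ip L h u - ip L h v"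
  by (simp add: ip_commute[of L h] ip_diff_left)

lemma ip_cmult_right: "ip L h (\<lambda>x. c * u x) = c * ip L h u"
  by (simp add: ip_commute[of L h] ip_cmult_left)

lemma ip_self_nonneg: "0 \<le> ip L u u"
  by (simp add: ip_eq)

lemma nrm_nonneg [simp]: "0 \<le> nrm L u"
  by (simp add: nrm_def ip_self_nonneg)

lemma nrm_square: "(nrm L u)\<^sup>2 = ip L u u"
  by (simp add: nrm_def ip_self_nonneg)

lemma ip_cong_AE:
  assumes "AE x in mu L. u x = u' x" "AE x in mu L. v x = v' x"
    "l2 L u" "l2 L u'" "l2 L v" "l2 L v'"
  shows "ip L u v = ip L u' v'"
  unfolding ip_eq using assms
  by (intro integral_cong_AE) (auto simp: l2_iff)

lemma ip_cong:
  "(\<And>x. x \<in> {0..L} \<Longrightarrow> u x = u' x) \<Longrightarrow> (\<And>x. x \<in> {0..L} \<Longrightarrow> v x = v' x) \<Longrightarrow> ip L u v = ip L u' v'"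
  unfolding ip_eq by (intro Bochner_Integration.integral_cong) auto

lemma nrm_cong:
  "(\<And>x. x \<in> {0..L} \<Longrightarrow> u x = u' x) \<Longrightarrow> nrm L u = nrm L u'"
  unfolding nrm_def by (metis ip_cong)

lemma nrm_cong_AE:
  "AE x in mu L. u x = u' x \<Longrightarrow> l2 L u \<Longrightarrow> l2 L u' \<Longrightarrow> nrm L u = nrm L u'"
  unfolding nrm_def by (simp add: ip_cong_AE[where u=u and u'=u' and v=u and v'=u'])

lemma ip_mono:
  "l2 L u \<Longrightarrow> l2 L v \<Longrightarrow> l2 L u' \<Longrightarrow> l2 L v' \<Longrightarrow> (\<And>x. x \<in> {0..L} \<Longrightarrow> u x * v x \<le> u' x * v' x)
    \<Longrightarrow> ip L u v \<le> ip L u' v'"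
  unfolding ip_eq by (rule Bochner_Integration.integral_mono) (simp_all add: l2_mult_integrable)

lemma nrm_mono:
  assumes "l2 L u" "l2 L v" "\<And>x. x \<in> {0..L} \<Longrightarrow> \<bar>u x\<bar> \<le> \<bar>v x\<bar>"
  shows "nrm L u \<le> nrm L v"
proof -
  have "u x * u x \<le> v x * v x" if "x \<in> {0..L}" for x
    using abs_le_square_iff[of "u x" "v x"] assms(3)[OF that] by (simp add: power2_eq_square)
  then show ?thesis unfolding nrm_def using assms by (auto intro!: ip_mono)
qed

lemma ip_lincomb_self:
  assumes "l2 L u" "l2 L v"
  shows "ip L (\<lambda>x. c * u x - d * v x) (\<lambda>x. c * u x - d * v x)
    = c\<^sup>2 * ip L u u - 2 * c * d * ip L u v + d\<^sup>2 * ip L v v"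
proof -
  have [simp]: "ip L v u = ip L u v" by (rule ip_commute)
  have "ip L (\<lambda>x. c * u x - d * v x) (\<lambda>x. c * u x - d * v x)
    = c * (c * ip L u u) - c * (d * ip L u v) - (d * (c * ip L u v) - d * (d * ip L v v))"
    using assms by (simp add: ip_diff_left ip_diff_right ip_cmult_left ip_cmult_right l2_cmult l2_diff
        right_diff_distrib)
  then show ?thesis by (simp add: power2_eq_square algebra_simps)
qed

lemma ip_young:
  assumes "l2 L u" "l2 L v" "\<eta> > 0"
  shows "\<bar>ip L u v\<bar> \<le> (nrm L u)\<^sup>2 / (4 * \<eta>) + \<eta> * (nrm L v)\<^sup>2"
proof -
  have *: "s * ip L u v \<le> (nrm L u)\<^sup>2 / (4 * \<eta>) + \<eta> * (nrm L v)\<^sup>2" if s: "s = 1 \<or> s = -1" for s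
  proof -
    have "0 \<le> 1\<^sup>2 * ip L u u - 2 * 1 * (2 * \<eta> * s) * ip L u v + (2 * \<eta> * s)\<^sup>2 * ip L v v"
      unfolding ip_lincomb_self[OF assms(1,2), symmetric] by (rule ip_self_nonneg)
    then have "0 \<le> (nrm L u)\<^sup>2 - 4 * \<eta> * (s * ip L u v) + 4 * \<eta>\<^sup>2 * (nrm L v)\<^sup>2"
      using s unfolding nrm_square[symmetric] by (auto simp: power_mult_distrib)
    then have "4 * \<eta> * (s * ip L u v) \<le> 4 * \<eta> * ((nrm L u)\<^sup>2 / (4 * \<eta>) + \<eta> * (nrm L v)\<^sup>2)"
      using assms(3) by (simp add: distrib_left power2_eq_square mult.assoc)
    then show ?thesis using assms(3) by (simp only: mult_le_cancel_left_pos)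
  qed
  from *[of 1] *[of "-1"] show ?thesis by auto
qed

lemma Cauchy_Schwarz_ip:
  assumes "l2 L u" "l2 L v"
  shows "\<bar>ip L u v\<bar> \<le> nrm L u * nrm L v"
proof -
  have "(ip L u v)\<^sup>2 \<le> (nrm L u)\<^sup>2 * (nrm L v)\<^sup>2"
  proof (cases "nrm L u = 0")
    case True
    have "\<bar>ip L u v\<bar> \<le> e" if "e > 0" for e
    proof -
      define \<eta> where "\<eta> = e / (1 + (nrm L v)\<^sup>2)"
      have pos: "1 + (nrm L v)\<^sup>2 > 0" by (smt (verit) zero_le_power2)
      have "\<eta> > 0" using that pos by (simp add: \<eta>_def)
      from ip_young[OF assms this] have "\<bar>ip L u v\<bar> \<le> \<eta> * (nrm L v)\<^sup>2" by (simp add: True)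
      also have "\<dots> \<le> \<eta> * (1 + (nrm L v)\<^sup>2)" using \<open>\<eta> > 0\<close> by simp
      also have "\<dots> = e" using pos by (simp add: \<eta>_def)
      finally show ?thesis .
    qed
    then have "ip L u v = 0" by (metis dense_ge abs_le_zero_iff)
    then show ?thesis by simp
  next
    case False
    let ?a = "ip L u v" and ?n = "(nrm L u)\<^sup>2"
    have n: "?n > 0" using False by simp
    have "0 \<le> ?a\<^sup>2 * ip L u u - 2 * ?a * ?n * ip L u v + ?n\<^sup>2 * ip L v v"
      unfolding ip_lincomb_self[OF assms(1,2), symmetric] by (rule ip_self_nonneg)
    also have "\<dots> = ?n * (?n * (nrm L v)\<^sup>2 - ?a\<^sup>2)"
      unfolding nrm_square[symmetric] by (simp add: power2_eq_square algebra_simps)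
    finally show ?thesis using n by (simp add: zero_le_mult_iff)
  qed
  then show ?thesis
    by (metis abs_le_square_iff abs_mult abs_of_nonneg nrm_nonneg power_mult_distrib)
qed

lemma nrm_triangle:
  assumes "l2 L u" "l2 L v"
  shows "nrm L (\<lambda>x. u x + v x) \<le> nrm L u + nrm L v"
proof (rule power2_le_imp_le)
  have "(nrm L (\<lambda>x. u x + v x))\<^sup>2 = (nrm L u)\<^sup>2 + 2 * ip L u v + (nrm L v)\<^sup>2"
    using assms by (simp add: nrm_square ip_add_left ip_add_right l2_add ip_commute[of L v u])
  also have "\<dots> \<le> (nrm L u + nrm L v)\<^sup>2"
    using Cauchy_Schwarz_ip[OF assms] by (simp add: power2_sum)
  finally show "(nrm L (\<lambda>x. u x + v x))\<^sup>2 \<le> (nrm L u + nrm L v)\<^sup>2" .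
qed simp

lemma nrm_cmult: "nrm L (\<lambda>x. c * u x) = \<bar>c\<bar> * nrm L u"
proof -
  have "ip L (\<lambda>x. c * u x) (\<lambda>x. c * u x) = c\<^sup>2 * ip L u u"
    by (simp add: ip_cmult_left ip_cmult_right power2_eq_square mult.assoc)
  then show ?thesis by (simp add: nrm_def real_sqrt_mult)
qed

lemma nrm_minus: "nrm L (\<lambda>x. - u x) = nrm L u"
  using nrm_cmult[of L "-1"] by simp

lemma nrm_minus_commute: "nrm L (\<lambda>x. u x - v x) = nrm L (\<lambda>x. v x - u x)"
  using nrm_minus[of L "\<lambda>x. u x - v x"] by simp

lemma nrm_triangle_diff:
  assumes "l2 L u" "l2 L v"
  shows "nrm L (\<lambda>x. u x - v x) \<le> nrm L u + nrm L v"
  using nrm_triangle[of L u "\<lambda>x. - v x"] assms by (auto simp: nrm_minus)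

lemma nrm_diff_triangle:
  assumes "l2 L u" "l2 L v" "l2 L w"
  shows "nrm L (\<lambda>x. u x - w x) \<le> nrm L (\<lambda>x. u x - v x) + nrm L (\<lambda>x. v x - w x)"
  using nrm_triangle[of L "\<lambda>x. u x - v x" "\<lambda>x. v x - w x"] assms by (auto simp: l2_diff)

lemma nrm_const: "L \<ge> 0 \<Longrightarrow> nrm L (\<lambda>x. c) = sqrt L * \<bar>c\<bar>"
  using measure_mu[of L] by (simp add: nrm_def ip_eq real_sqrt_mult)

lemma nrm_bounded:
  assumes "L \<ge> 0" "u \<in> borel_measurable (mu L)" "\<And>x. x \<in> {0..L} \<Longrightarrow> \<bar>u x\<bar> \<le> B"
  shows "nrm L u \<le> sqrt L * \<bar>B\<bar>"
  using nrm_mono[of L u "\<lambda>x. B"] l2_bounded[OF assms(2,3)] assms nrm_const[of L B]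
  by force

section \<open>The space of absolutely continuous functions with zero boundary values\<close>

lemma prim_mu:
  fixes v :: rfun
  assumes "x \<le> L"
  shows "(LINT t:{0..x}|lborel. v t) = (LINT t|mu L. (if t \<le> x then v t else 0))"
  unfolding set_lebesgue_integral_def using assms
  by (subst integral_restrict_space) (auto intro!: Bochner_Integration.integral_cong split: split_indicator)

lemma dx_l2: "h10 L u \<Longrightarrow> l2 L (dx L u)"
  and dx_prim: "h10 L u \<Longrightarrow> x \<in> {0..L} \<Longrightarrow> u x = (LINT t|mu L. (if t \<le> x then dx L u t else 0))"
  and h10_at_L: "h10 L u \<Longrightarrow> u L = 0"
proof -
  assume h: "h10 L u"
  then have "\<exists>v. l2 L v \<and> (\<forall>x\<in>{0..L}. u x = (LINT t:{0..x}|lborel. v t))"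
    unfolding h10_def by blast
  from someI_ex[OF this]
  have *: "l2 L (dx L u) \<and> (\<forall>x\<in>{0..L}. u x = (LINT t:{0..x}|lborel. dx L u t))"
    unfolding dx_def .
  then show "l2 L (dx L u)" by blast
  show "u L = 0" using h by (auto simp: h10_def)
  show "u x = (LINT t|mu L. (if t \<le> x then dx L u t else 0))" if "x \<in> {0..L}"
    using * that by (simp add: prim_mu)
qed

lemma h10I:
  assumes "l2 L v" "\<And>x. x \<in> {0..L} \<Longrightarrow> u x = (LINT t|mu L. (if t \<le> x then v t else 0))" "u L = 0"
  shows "h10 L u"
  unfolding h10_def using assms by (intro exI[of _ v]) (auto simp: prim_mu)

lemma l2_trunc:
  assumes "l2 L v" shows "l2 L (\<lambda>t. if t \<le> x then v t else 0)"
proof (rule l2_le[OF assms, where C=1])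
  show "(\<lambda>t. if t \<le> x then v t else 0) \<in> borel_measurable (mu L)"
  proof (rule measurable_If)
    have "{..x} \<in> sets borel" by simp
    then have "{..x} \<inter> {0..L} \<in> sets (mu L)" by (auto simp: sets_restrict_space)
    moreover have "{..x} \<inter> {0..L} = {t \<in> space (mu L). t \<le> x}" by auto
    ultimately show "{t \<in> space (mu L). t \<le> x} \<in> sets (mu L)" by simp
  qed (use assms in \<open>auto simp: l2_iff\<close>)
qed auto

text \<open>A vanishing primitive means zero integral over every half-line, and half-lines generate
  the Borel sets. The integrand is signed, so its positive and negative parts are compared as
  densities of two finite measures; these agree, hence every Borel integral of the integrand
  vanishes.\<close>

lemma AE_zero_of_prim_zero:
  fixes e :: rfun
  assumes e: "l2 L e" and zero: "\<And>x. x \<in> {0..L} \<Longrightarrow> (LINT t|mu L. (if t \<le> x then e t else 0)) = 0"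
  shows "AE x in mu L. e x = 0"
proof -
  define f where "f = (\<lambda>t. indicator {0..L} t * e t)"
  have f: "integrable lborel f"
    using l2_integrable[OF e] unfolding f_def by (simp add: integrable_restrict_space)
  then have fm[measurable]: "f \<in> borel_measurable borel" by (simp add: borel_measurable_integrable)
  have tail: "(LINT t|lborel. indicator {..x} t * f t) = 0" for x
  proof (cases "x < 0")
    case True
    then have "(\<lambda>t. indicator {..x} t * f t) = (\<lambda>t. 0)"
      by (auto simp: f_def fun_eq_iff split: split_indicator)
    then show ?thesis by simp
  next
    case False
    \<comment> \<open>Cutting at \<open>min x L\<close> brings a half-line ending beyond L back into
      the range of the hypothesis.\<close>
    define y where "y = min x L"
    have "(LINT t|lborel. indicator {..x} t * f t) = (LINT t|mu L. (if t \<le> y then e t else 0))"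
      by (subst integral_restrict_space)
         (auto intro!: Bochner_Integration.integral_cong simp: f_def y_def split: split_indicator)
    also have "\<dots> = 0"
    proof (cases "0 \<le> L")
      case True with False show ?thesis by (intro zero) (auto simp: y_def)
    next
      case False
      then have "space (mu L) = {}" by simp
      then show ?thesis by (simp add: integral_restrict_space)
    qed
    finally show ?thesis .
  qed
  \<comment> \<open>The total integral turns left half-lines into the right half-lines on which
    \<open>measure_eqI_lessThan\<close> compares measures.\<close>
  have whole: "(LINT t|lborel. f t) = 0"
  proof -
    have "(LINT t|lborel. f t) = (LINT t|lborel. indicator {..L} t * f t)"
      by (auto intro!: Bochner_Integration.integral_cong simp: f_def split: split_indicator)
    then show ?thesis using tail by simp
  qed
  define P where "P = (\<lambda>t. max 0 (f t))"
  define N where "N = (\<lambda>t. max 0 (- f t))"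
  have PN: "integrable lborel P" "integrable lborel N" using f by (auto simp: P_def N_def)
  have [measurable]: "P \<in> borel_measurable borel" "N \<in> borel_measurable borel"
    by (auto simp: P_def N_def)
  have dens: "emeasure (density lborel (\<lambda>t. ennreal (H t))) A = ennreal (LINT t|lborel. indicator A t * H t)"
    if "integrable lborel H" "\<And>t. 0 \<le> H t" "A \<in> sets borel" for H :: rfun and A
  proof -
    have [measurable]: "H \<in> borel_measurable borel" "A \<in> sets borel"
      using that borel_measurable_integrable by auto
    have "emeasure (density lborel (\<lambda>t. ennreal (H t))) A = (\<integral>\<^sup>+t. ennreal (indicator A t * H t) \<partial>lborel)"
      by (subst emeasure_density) (auto intro!: nn_integral_cong split: split_indicator)
    also have "\<dots> = ennreal (LINT t|lborel. indicator A t * H t)"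
      using that integrable_mult_indicator[of A lborel H]
      by (intro nn_integral_eq_integral) auto
    finally show ?thesis .
  qed
  have diff: "(LINT t|lborel. indicator A t * f t)
      = (LINT t|lborel. indicator A t * P t) - (LINT t|lborel. indicator A t * N t)"
    if "A \<in> sets borel" for A
  proof -
    have "(LINT t|lborel. indicator A t * f t) = (LINT t|lborel. indicator A t * P t - indicator A t * N t)"
      by (rule Bochner_Integration.integral_cong) (auto simp: P_def N_def split: split_indicator)
    also have "\<dots> = (LINT t|lborel. indicator A t * P t) - (LINT t|lborel. indicator A t * N t)"
      using that integrable_mult_indicator[of A lborel P] integrable_mult_indicator[of A lborel N] PN
      by (intro Bochner_Integration.integral_diff) auto
    finally show ?thesis .
  qed
  have "density lborel (\<lambda>t. ennreal (P t)) = density lborel (\<lambda>t. ennreal (N t))"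
  proof (rule measure_eqI_lessThan)
    fix x :: real
    have "(LINT t|lborel. indicator {x<..} t * f t) = (LINT t|lborel. f t - indicator {..x} t * f t)"
      by (rule Bochner_Integration.integral_cong) (auto split: split_indicator)
    also have "\<dots> = 0"
      using f integrable_mult_indicator[of "{..x}" lborel f] tail whole by simp
    finally have "(LINT t|lborel. indicator {x<..} t * P t) = (LINT t|lborel. indicator {x<..} t * N t)"
      using diff[of "{x<..}"] by simp
    then show "emeasure (density lborel (\<lambda>t. ennreal (P t))) {x<..}
        = emeasure (density lborel (\<lambda>t. ennreal (N t))) {x<..}"
      using PN by (subst (1 2) dens) (auto simp: P_def N_def)
    show "emeasure (density lborel (\<lambda>t. ennreal (P t))) {x<..} < \<infinity>"
      using PN by (subst dens) (auto simp: P_def)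
  qed auto
  then have eq: "(LINT t|lborel. indicator A t * f t) = 0" if "A \<in> sets borel" for A
  proof -
    have "ennreal (LINT t|lborel. indicator A t * P t) = ennreal (LINT t|lborel. indicator A t * N t)"
      using dens[OF PN(1) _ that] dens[OF PN(2) _ that]
        \<open>density lborel (\<lambda>t. ennreal (P t)) = density lborel (\<lambda>t. ennreal (N t))\<close>
      by (simp add: P_def N_def)
    moreover have "0 \<le> (LINT t|lborel. indicator A t * P t)" "0 \<le> (LINT t|lborel. indicator A t * N t)"
      by (auto intro!: integral_nonneg_AE simp: P_def N_def)
    ultimately show ?thesis using diff[OF that] by simp
  qed
  have "AE t in lborel. f t = 0"
    by (rule density_unique_real[OF f]) (auto simp: set_lebesgue_integral_def eq)
  then show ?thesis
    by (subst AE_restrict_space_iff) (auto simp: f_def elim!: eventually_mono split: split_indicator)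
qed

section \<open>Fubini's theorem on the square and integration by parts\<close>

lemma integrable_mu_product:
  fixes u v :: rfun
  assumes "integrable (mu L) u" "integrable (mu L) v"
  shows "integrable (mu L \<Otimes>\<^sub>M mu L) (\<lambda>p. u (fst p) * v (snd p))"
proof -
  interpret finite_measure "mu L" by (rule finite_measure_mu)
  interpret pair_sigma_finite "mu L" "mu L" ..
  have [measurable]: "u \<in> borel_measurable (mu L)" "v \<in> borel_measurable (mu L)"
    using assms by auto
  show ?thesis
    by (rule Fubini_integrable) (use assms in \<open>auto simp: abs_mult\<close>)
qed

lemma measurable_mu_le [measurable]:
  "{p \<in> space (mu L \<Otimes>\<^sub>M mu L). fst p \<le> snd p} \<in> sets (mu L \<Otimes>\<^sub>M mu L)"
  "{p \<in> space (mu L \<Otimes>\<^sub>M mu L). snd p \<le> fst p} \<in> sets (mu L \<Otimes>\<^sub>M mu L)"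
proof -
  have id: "(\<lambda>x. x) \<in> borel_measurable (mu L)"
    by (rule measurable_restrict_space1) simp
  have f: "fst \<in> borel_measurable (mu L \<Otimes>\<^sub>M mu L)" "snd \<in> borel_measurable (mu L \<Otimes>\<^sub>M mu L)"
    using measurable_compose[OF measurable_fst id, of "mu L"]
      measurable_compose[OF measurable_snd id, of "mu L"] by simp_all
  show "{p \<in> space (mu L \<Otimes>\<^sub>M mu L). fst p \<le> snd p} \<in> sets (mu L \<Otimes>\<^sub>M mu L)"
    "{p \<in> space (mu L \<Otimes>\<^sub>M mu L). snd p \<le> fst p} \<in> sets (mu L \<Otimes>\<^sub>M mu L)"
    using f by (auto intro!: borel_measurable_le)
qed

lemma prim_measurable:
  assumes "l2 L v"
  shows "(\<lambda>x. LINT t|mu L. (if t \<le> x then v t else 0)) \<in> borel_measurable (mu L)"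
proof -
  interpret finite_measure "mu L" by (rule finite_measure_mu)
  have [measurable]: "v \<in> borel_measurable (mu L)" using assms by (simp add: l2_iff)
  have "(\<lambda>p. if snd p \<le> fst p then v (snd p) else 0) \<in> borel_measurable (mu L \<Otimes>\<^sub>M mu L)"
    by measurable
  then show ?thesis
    by (intro borel_measurable_lebesgue_integral) (simp add: case_prod_beta)
qed

text \<open>Cauchy-Schwarz against the constant 1, whose norm is sqrt L. This is the embedding of
  H^1_0 into bounded functions.\<close>

lemma prim_bound:
  assumes "0 \<le> L" "l2 L v"
  shows "\<bar>LINT t|mu L. (if t \<le> x then v t else 0)\<bar> \<le> sqrt L * nrm L v"
proof -
  have "(LINT t|mu L. (if t \<le> x then v t else 0)) = ip L (\<lambda>t. 1) (\<lambda>t. if t \<le> x then v t else 0)"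
    by (simp add: ip_eq)
  also have "\<bar>\<dots>\<bar> \<le> nrm L (\<lambda>t. 1) * nrm L (\<lambda>t. if t \<le> x then v t else 0)"
    using assms by (intro Cauchy_Schwarz_ip l2_trunc) auto
  also have "\<dots> \<le> sqrt L * nrm L v"
    using assms by (intro mult_mono nrm_mono l2_trunc) (auto simp: nrm_const)
  finally show ?thesis .
qed

lemma AE_mu_neq: "AE s in mu L. s \<noteq> (t::real)"
  by (subst AE_restrict_space_iff)
     (auto intro!: eventually_mono[OF AE_lborel_singleton[of t]])

text \<open>Integration by parts for absolutely continuous functions is Fubini's theorem on the square,
  split along its diagonal.\<close>

lemma prim_product:
  assumes u: "l2 L u" and v: "l2 L v"
  shows "(LINT t|mu L. u t) * (LINT t|mu L. v t)
    = (LINT t|mu L. u t * (LINT s|mu L. (if s \<le> t then v s else 0)))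
    + (LINT t|mu L. (LINT s|mu L. (if s \<le> t then u s else 0)) * v t)"
proof -
  interpret finite_measure "mu L" by (rule finite_measure_mu)
  interpret pair_sigma_finite "mu L" "mu L" ..
  have iu: "integrable (mu L) u" and iv: "integrable (mu L) v" using assms l2_integrable by auto
  have [measurable]: "u \<in> borel_measurable (mu L)" "v \<in> borel_measurable (mu L)"
    using assms by (auto simp: l2_iff)
  have prod: "integrable (mu L \<Otimes>\<^sub>M mu L) (\<lambda>p. u (fst p) * v (snd p))"
    using iu iv by (rule integrable_mu_product)
  have i1: "integrable (mu L \<Otimes>\<^sub>M mu L) (\<lambda>(t, s). if s \<le> t then u t * v s else 0)"
    by (rule Bochner_Integration.integrable_bound[OF prod]) (auto simp: case_prod_beta)
  have i2: "integrable (mu L \<Otimes>\<^sub>M mu L) (\<lambda>(t, s). if t \<le> s then u t * v s else 0)"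
    by (rule Bochner_Integration.integrable_bound[OF prod]) (auto simp: case_prod_beta)
  have 1: "(LINT t|mu L. u t * (LINT s|mu L. (if s \<le> t then v s else 0)))
      = (LINT t|mu L. LINT s|mu L. (if s \<le> t then u t * v s else 0))"
    by (simp flip: integral_mult_right_zero add: if_distrib[of "\<lambda>z. _ * z"] cong: if_cong)
  have "(LINT t|mu L. (LINT s|mu L. (if s \<le> t then u s else 0)) * v t)
      = (LINT s|mu L. LINT t|mu L. (if t \<le> s then u t * v s else 0))"
    by (simp flip: integral_mult_left_zero add: if_distrib[of "\<lambda>z. z * _"] cong: if_cong)
  also have "\<dots> = (LINT t|mu L. LINT s|mu L. (if t \<le> s then u t * v s else 0))"
    using Fubini_integral[OF i2] by simp
  finally have 2: "(LINT t|mu L. (LINT s|mu L. (if s \<le> t then u s else 0)) * v t)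
      = (LINT t|mu L. LINT s|mu L. (if t \<le> s then u t * v s else 0))" .
  \<comment> \<open>The halves s \<le> t and t \<le> s overlap only in s = t, a null set, so both
    inequalities may be closed.\<close>
  have inner: "(LINT s|mu L. (if s \<le> t then u t * v s else 0)) + (LINT s|mu L. (if t \<le> s then u t * v s else 0))
      = u t * (LINT s|mu L. v s)" if "t \<in> {0..L}" for t
  proof -
    have a: "integrable (mu L) (\<lambda>s. if s \<le> t then u t * v s else 0)"
      using l2_integrable[OF l2_cmult[OF l2_trunc[OF v], of "u t" t]]
      by (simp add: if_distrib[of "\<lambda>z. _ * z"] cong: if_cong)
    have "(LINT s|mu L. (if t \<le> s then u t * v s else 0))
       = (LINT s|mu L. u t * v s - (if s \<le> t then u t * v s else 0))"
    proof (rule integral_cong_AE)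
      show "(\<lambda>s. if t \<le> s then u t * v s else 0) \<in> borel_measurable (mu L)"
      proof (rule measurable_If)
        have "{t..} \<in> sets borel" by simp
        then have "{t..} \<inter> {0..L} \<in> sets (mu L)" by (auto simp: sets_restrict_space)
        moreover have "{t..} \<inter> {0..L} = {s \<in> space (mu L). t \<le> s}" by auto
        ultimately show "{s \<in> space (mu L). t \<le> s} \<in> sets (mu L)" by simp
      qed auto
      show "(\<lambda>s. u t * v s - (if s \<le> t then u t * v s else 0)) \<in> borel_measurable (mu L)"
        using a by (intro borel_measurable_diff) auto
      show "AE s in mu L. (if t \<le> s then u t * v s else 0) = u t * v s - (if s \<le> t then u t * v s else 0)"
        using AE_mu_neq[where L=L and t=t] by eventually_elim auto
    qed
    then show ?thesis using a iv by simp
  qed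
  have "(LINT t|mu L. u t) * (LINT t|mu L. v t) = (LINT t|mu L. u t * (LINT s|mu L. v s))"
    by simp
  also have "\<dots> = (LINT t|mu L. (LINT s|mu L. (if s \<le> t then u t * v s else 0))
      + (LINT s|mu L. (if t \<le> s then u t * v s else 0)))"
    by (rule Bochner_Integration.integral_cong) (auto simp: inner)
  also have "\<dots> = (LINT t|mu L. LINT s|mu L. (if s \<le> t then u t * v s else 0))
      + (LINT t|mu L. LINT s|mu L. (if t \<le> s then u t * v s else 0))"
    using integrable_fst[OF i1] integrable_fst[OF i2] by (rule Bochner_Integration.integral_add)
  finally show ?thesis using 1 2 by simp
qed

lemma h10_measurable: "h10 L u \<Longrightarrow> u \<in> borel_measurable (mu L)"
  using prim_measurable[OF dx_l2, of L u] dx_prim[of L u]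
  by (subst measurable_cong[where g="\<lambda>x. LINT t|mu L. (if t \<le> x then dx L u t else 0)"]) auto

lemma h10_bound:
  assumes "0 \<le> L" "h10 L u" "x \<in> {0..L}"
  shows "\<bar>u x\<bar> \<le> sqrt L * nrm L (dx L u)"
  using prim_bound[OF assms(1) dx_l2[OF assms(2)]] dx_prim[OF assms(2,3)] by simp

lemma h10_l2: "h10 L u \<Longrightarrow> l2 L u"
proof (cases "0 \<le> L")
  case True
  assume "h10 L u"
  then show ?thesis
    using h10_bound[OF True] by (intro l2_bounded[where B="sqrt L * nrm L (dx L u)"] h10_measurable)
next
  case False
  assume "h10 L u"
  then show ?thesis
    using False by (intro l2_bounded[where B=0] h10_measurable) auto
qed

text \<open>In \<open>prim_product\<close> the boundary term contains the integral of the derivative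
  of u over [0,L] as a factor, which is u(L) = 0.\<close>

lemma ip_dx_parts:
  assumes u: "h10 L u" and v: "h10 L v" and L: "0 \<le> L"
  shows "ip L (dx L u) v = - ip L u (dx L v)"
proof -
  have "(LINT t|mu L. dx L u t) = (LINT t|mu L. (if t \<le> L then dx L u t else 0))"
    by (rule Bochner_Integration.integral_cong) auto
  also have "\<dots> = 0"
    using dx_prim[OF u, of L] h10_at_L[OF u] L by simp
  finally have 0: "(LINT t|mu L. dx L u t) = 0" .
  have "ip L (dx L u) v = (LINT t|mu L. dx L u t * (LINT s|mu L. (if s \<le> t then dx L v s else 0)))"
    unfolding ip_eq by (rule Bochner_Integration.integral_cong) (auto simp: dx_prim[OF v])
  moreover have "ip L u (dx L v) = (LINT t|mu L. (LINT s|mu L. (if s \<le> t then dx L u s else 0)) * dx L v t)"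
    unfolding ip_eq by (rule Bochner_Integration.integral_cong) (auto simp: dx_prim[OF u])
  ultimately show ?thesis
    using prim_product[OF dx_l2[OF u] dx_l2[OF v]] 0 by simp
qed

section \<open>Derivatives up to null sets\<close>

lemma prim_diff:
  assumes "l2 L u" "l2 L v"
  shows "(LINT t|mu L. (if t \<le> x then u t - v t else 0))
    = (LINT t|mu L. (if t \<le> x then u t else 0)) - (LINT t|mu L. (if t \<le> x then v t else 0))"
proof -
  have "(LINT t|mu L. (if t \<le> x then u t - v t else 0))
      = (LINT t|mu L. (if t \<le> x then u t else 0) - (if t \<le> x then v t else 0))"
    by (rule Bochner_Integration.integral_cong) auto
  then show ?thesis
    using assms by (simp add: l2_integrable l2_trunc)
qed

text \<open>\<open>dx\<close> selects one density by Hilbert choice, and densities with the same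
  primitive agree only almost everywhere. So \<open>dx\<close> need not commute pointwise with
  subtraction, nor vanish pointwise on the zero function; this lemma supplies the almost-everywhere
  versions.\<close>

lemma dx_AE_unique:
  assumes u: "h10 L u" and v: "l2 L v"
    and prim: "\<And>x. x \<in> {0..L} \<Longrightarrow> u x = (LINT t|mu L. (if t \<le> x then v t else 0))"
  shows "AE x in mu L. dx L u x = v x"
proof -
  have "AE x in mu L. dx L u x - v x = 0"
    using prim dx_prim[OF u] dx_l2[OF u] v
    by (intro AE_zero_of_prim_zero) (auto simp: prim_diff)
  then show ?thesis by simp
qed

lemma h10_diff:
  assumes "h10 L u" "h10 L v"
  shows "h10 L (\<lambda>x. u x - v x)" and "AE x in mu L. dx L (\<lambda>x. u x - v x) x = dx L u x - dx L v x"
proof -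
  have l: "l2 L (\<lambda>x. dx L u x - dx L v x)" using assms dx_l2 by auto
  have p: "u x - v x = (LINT t|mu L. (if t \<le> x then dx L u t - dx L v t else 0))" if "x \<in> {0..L}" for x
    using assms that by (simp add: prim_diff dx_l2 flip: dx_prim)
  show h: "h10 L (\<lambda>x. u x - v x)"
    using l p assms by (intro h10I) (auto simp: h10_at_L)
  show "AE x in mu L. dx L (\<lambda>x. u x - v x) x = dx L u x - dx L v x"
    by (rule dx_AE_unique[OF h l p])
qed

lemma nrm_dx_diff:
  assumes "h10 L u" "h10 L v"
  shows "nrm L (dx L (\<lambda>x. u x - v x)) = nrm L (\<lambda>x. dx L u x - dx L v x)"
  using h10_diff[OF assms] assms by (intro nrm_cong_AE) (auto intro: dx_l2)

lemma h10_zero: "h10 L (\<lambda>x. 0)" and dx_zero_AE: "AE x in mu L. dx L (\<lambda>x. 0) x = 0"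
proof -
  show h: "h10 L (\<lambda>x. 0)" by (rule h10I[where v="\<lambda>x. 0"]) auto
  show "AE x in mu L. dx L (\<lambda>x. 0) x = 0" by (rule dx_AE_unique[OF h]) auto
qed

text \<open>Expanding the square of \<open>u' + c T u\<close> with \<open>T x = tan (c (x - L/2))\<close>, which is smooth on
  \<open>[0,L]\<close> because \<open>c L < \<pi>\<close>, and integrating \<open>2 T u u'\<close> by parts leaves
  \<open>(u')\<^sup>2 - c\<^sup>2 u\<^sup>2\<close> since \<open>T' = c (1 + T\<^sup>2)\<close>.\<close>

lemma Poincare_sharp:
  assumes u: "h10 L u" and L: "0 < L" and c: "0 < c" "c * L < pi"
  shows "c\<^sup>2 * (nrm L u)\<^sup>2 \<le> (nrm L (dx L u))\<^sup>2"
proof -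
  define T where "T = (\<lambda>x. tan (c * (x - L/2)))"
  define T' where "T' = (\<lambda>x. c * (1 + (T x)\<^sup>2))"
  have ang: "\<bar>c * (x - L/2)\<bar> < pi/2" if "x \<in> {0..L}" for x
  proof -
    have "\<bar>c * (x - L/2)\<bar> \<le> c * (L/2)"
    proof -
      have "\<bar>x - L/2\<bar> \<le> L/2" using that by (auto simp: abs_le_iff field_simps)
      then show ?thesis using c(1) by (simp only: abs_mult abs_of_pos mult_left_mono less_imp_le)
    qed
    with c show ?thesis by simp
  qed
  have cosn0: "cos (c * (x - L/2)) > 0" if "x \<in> {0..L}" for x
    using ang[OF that] by (intro cos_gt_zero_pi) (auto simp: abs_less_iff)
  have dT: "(T has_real_derivative T' x) (at x)" if "x \<in> {0..L}" for x
  proof -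
    have n: "cos (c * (x - L/2)) \<noteq> 0" using cosn0[OF that] by simp
    have "((\<lambda>x. c * (x - L/2)) has_real_derivative c) (at x)"
      by (auto intro!: derivative_eq_intros)
    from DERIV_chain2[OF DERIV_tan[OF n] this]
    show ?thesis using tan_sec[OF n] by (simp add: T_def T'_def power_inverse mult.commute)
  qed
  have contT: "continuous_on {0..L} T"
    using dT by (meson DERIV_isCont continuous_at_imp_continuous_on)
  then have contT': "continuous_on {0..L} T'" unfolding T'_def by (intro continuous_intros)
  have bmeas: "f \<in> borel_measurable (mu L)" if "continuous_on {0..L} f" for f :: rfun
    using borel_measurable_continuous_on_restrict[OF that]
      measurable_cong_sets[OF sets_restrict_space_cong[OF sets_lborel] refl] by blast
  have bdd: "\<exists>B. \<forall>x\<in>{0..L}. \<bar>f x\<bar> \<le> B" if "continuous_on {0..L} f" for f :: rfun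
    using compact_imp_bounded[OF compact_continuous_image[OF that compact_Icc]]
    by (auto simp: bounded_iff)
  have l2T': "l2 L T'" using bdd[OF contT'] bmeas[OF contT'] by (auto intro: l2_bounded)
  have isT': "isCont T' t" if "t \<in> {0..L}" for t
    unfolding T'_def using DERIV_isCont[OF dT[OF that]] by (intro continuous_intros)
  have FTC: "T x - T 0 = (LINT t|mu L. (if t \<le> x then T' t else 0))" if "x \<in> {0..L}" for x
  proof -
    have "(LINT t|lborel. T' t * indicator {0..x} t) = T x - T 0"
      using that dT isT' by (intro integral_FTC_Icc_real) auto
    then show ?thesis
      using that by (simp flip: prim_mu add: set_lebesgue_integral_def mult.commute)
  qed
  \<comment> \<open>The derivative of u^2. Boundedness of u makes it square integrable, so the
    product formula applies to it and \<open>T'\<close>.\<close>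
  define w where "w = (\<lambda>t. 2 * (u t * dx L u t))"
  obtain B where B: "\<And>x. x \<in> {0..L} \<Longrightarrow> \<bar>u x\<bar> \<le> B"
    using h10_bound[OF _ u] L by force
  have um: "u \<in> borel_measurable (mu L)" "dx L u \<in> borel_measurable (mu L)"
    using h10_measurable[OF u] dx_l2[OF u] by (auto simp: l2_iff)
  have l2w: "l2 L w"
    unfolding w_def using um B
    by (intro l2_cmult l2_le[OF dx_l2[OF u], where C=B]) (auto simp: abs_mult mult_right_mono)
  have prim_w: "u x * u x = (LINT t|mu L. (if t \<le> x then w t else 0))" if "x \<in> {0..L}" for x
  proof -
    \<comment> \<open>Truncating the derivative at x makes the product formula over [0,L] compute
      u(x)^2.\<close>
    let ?v = "\<lambda>t. if t \<le> x then dx L u t else 0"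
    have inner: "(LINT s|mu L. (if s \<le> t then ?v s else 0)) = u t" if "t \<in> {0..L}" "t \<le> x" for t
      unfolding dx_prim[OF u that(1)] using that(2)
      by (intro Bochner_Integration.integral_cong) auto
    have "u x * u x = (LINT t|mu L. ?v t) * (LINT t|mu L. ?v t)"
      using dx_prim[OF u that] by simp
    also have "\<dots> = (LINT t|mu L. ?v t * (LINT s|mu L. (if s \<le> t then ?v s else 0)))
        + (LINT t|mu L. (LINT s|mu L. (if s \<le> t then ?v s else 0)) * ?v t)"
      by (intro prim_product l2_trunc dx_l2 u)
    also have "\<dots> = 2 * (LINT t|mu L. ?v t * (LINT s|mu L. (if s \<le> t then ?v s else 0)))"
      by (simp add: mult.commute)
    also have "\<dots> = (LINT t|mu L. 2 * (?v t * (LINT s|mu L. (if s \<le> t then ?v s else 0))))"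
      by simp
    also have "\<dots> = (LINT t|mu L. (if t \<le> x then w t else 0))"
    proof (rule Bochner_Integration.integral_cong)
      fix t assume "t \<in> space (mu L)"
      then show "2 * (?v t * (LINT s|mu L. (if s \<le> t then ?v s else 0))) = (if t \<le> x then w t else 0)"
        using inner[of t] by (cases "t \<le> x") (simp_all add: w_def mult.commute)
    qed simp
    finally show ?thesis .
  qed
  \<comment> \<open>u vanishes at L, so the derivative of u^2 has integral zero; this removes both
    the boundary term and the constant \<open>T 0\<close> from the integration by parts.\<close>
  have w0: "(LINT t|mu L. w t) = 0"
  proof -
    have "(LINT t|mu L. w t) = (LINT t|mu L. (if t \<le> L then w t else 0))"
      by (rule Bochner_Integration.integral_cong) auto
    also have "\<dots> = 0" using prim_w[of L] L h10_at_L[OF u] by simp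
    finally show ?thesis .
  qed
  have l2T: "l2 L T" using bdd[OF contT] bmeas[OF contT] by (auto intro: l2_bounded)
  have iwT: "integrable (mu L) (\<lambda>t. w t * T t)" "integrable (mu L) (\<lambda>t. w t * T 0)"
    using l2_mult_integrable[OF l2w l2T] l2_integrable[OF l2w] by auto
  have "(LINT t|mu L. w t * (LINT s|mu L. (if s \<le> t then T' s else 0)))
      = (LINT t|mu L. w t * T t - w t * T 0)"
    by (rule Bochner_Integration.integral_cong) (auto simp: right_diff_distrib simp flip: FTC)
  also have "\<dots> = (LINT t|mu L. w t * T t)"
    using iwT w0 by simp
  finally have 1: "(LINT t|mu L. w t * (LINT s|mu L. (if s \<le> t then T' s else 0))) = (LINT t|mu L. w t * T t)" .
  have 2: "(LINT t|mu L. (LINT s|mu L. (if s \<le> t then w s else 0)) * T' t) = (LINT t|mu L. (u t * u t) * T' t)"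
    by (rule Bochner_Integration.integral_cong) (auto simp: prim_w)
  have parts: "(LINT t|mu L. w t * T t) = - (LINT t|mu L. (u t * u t) * T' t)"
    using prim_product[OF l2w l2T'] w0 1 2 by simp
  have l2uu: "l2 L (\<lambda>t. u t * u t)"
  proof (rule l2_le[OF h10_l2[OF u], where C=B])
    show "\<bar>u x * u x\<bar> \<le> B * \<bar>u x\<bar>" if "x \<in> {0..L}" for x
      unfolding abs_mult using B[OF that] by (rule mult_right_mono) simp
  qed (use um in simp)
  have iuuT: "integrable (mu L) (\<lambda>t. (u t * u t) * T' t)" by (rule l2_mult_integrable[OF l2uu l2T'])
  have iu: "integrable (mu L) (\<lambda>t. u t * u t)" "integrable (mu L) (\<lambda>t. dx L u t * dx L u t)"
    using l2_mult_integrable h10_l2[OF u] dx_l2[OF u] by auto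
  \<comment> \<open>The square expands to the integrand u'^2 - c^2 u^2 plus c times the derivative
    of u^2 T, whose integral is zero by \<open>parts\<close>.\<close>
  have "0 \<le> (LINT t|mu L. (dx L u t + c * T t * u t)\<^sup>2)" by simp
  also have "\<dots> = (LINT t|mu L. dx L u t * dx L u t + c * (w t * T t) + (c * ((u t * u t) * T' t) - c\<^sup>2 * (u t * u t)))"
    by (rule Bochner_Integration.integral_cong) (auto simp: w_def T'_def power2_eq_square algebra_simps)
  also have "\<dots> = (LINT t|mu L. dx L u t * dx L u t) + c * (LINT t|mu L. w t * T t)
      + (c * (LINT t|mu L. (u t * u t) * T' t) - c\<^sup>2 * (LINT t|mu L. u t * u t))"
    using iwT iuuT iu by simp
  finally show ?thesis using parts by (simp add: nrm_square ip_eq)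
qed

section \<open>Differentiation on the time half-line and the energy identity\<close>

text \<open>Weak solutions are given by integral identities starting at time 0; continuity of the
  integrand turns them into derivatives. Differentiating within \<open>{0..}\<close> makes the
  derivative one-sided at 0 and ignores negative times.\<close>

lemma FTC_within_half_line:
  fixes \<phi> y :: "real \<Rightarrow> real"
  assumes c: "continuous_on {0..} \<phi>" and y: "\<And>t. 0 \<le> t \<Longrightarrow> y t - y 0 = integral {0..t} \<phi>" and t: "0 \<le> t"
  shows "(y has_real_derivative \<phi> t) (at t within {0..})"
proof -
  have "((\<lambda>x. integral {0..x} \<phi>) has_real_derivative \<phi> t) (at t within {0..t+1})"
    using t by (intro integral_has_real_derivative continuous_on_subset[OF c]) auto
  also have "at t within {0..t+1} = at t within {0..}"
    by (rule at_within_nhd[of t "{..<t+1}"]) (use t in auto)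
  finally have "((\<lambda>x. y 0 + integral {0..x} \<phi>) has_real_derivative \<phi> t) (at t within {0..})"
    by (auto intro!: derivative_eq_intros)
  then show ?thesis
    by (rule has_field_derivative_transform_within[where d=1]) (use t y in \<open>force+\<close>)
qed

lemma deriv_within_half_line_nonpos:
  fixes f f' :: "real \<Rightarrow> real"
  assumes d: "\<And>t. 0 \<le> t \<Longrightarrow> t \<le> T \<Longrightarrow> (f has_real_derivative f' t) (at t within {0..})"
    and n: "\<And>t. 0 \<le> t \<Longrightarrow> t \<le> T \<Longrightarrow> f' t \<le> 0" and st: "0 \<le> s" "s \<le> t" "t \<le> T"
  shows "f t \<le> f s"
proof (rule DERIV_nonpos_imp_decreasing_open[OF st(2)])
  fix x assume x: "s < x" "x < t"
  have "at x within {0..} = at x"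
    by (rule at_within_interior) (use x st in auto)
  then show "\<exists>y. (f has_real_derivative y) (at x) \<and> y \<le> 0"
    using d[of x] n[of x] x st by auto
next
  show "continuous_on {s..t} f"
    unfolding continuous_on_eq_continuous_within
  proof
    fix x assume "x \<in> {s..t}"
    then have "continuous (at x within {0..}) f"
      using st by (intro DERIV_continuous[OF d]) auto
    then show "continuous (at x within {s..t}) f"
      by (rule continuous_within_subset) (use st in auto)
  qed
qed

lemma deriv_within_half_line_bound:
  fixes f f' :: "real \<Rightarrow> real"
  assumes d: "\<And>t. 0 \<le> t \<Longrightarrow> t \<le> T \<Longrightarrow> (f has_real_derivative f' t) (at t within {0..})"
    and n: "\<And>t. 0 \<le> t \<Longrightarrow> t \<le> T \<Longrightarrow> \<bar>f' t\<bar> \<le> C" and st: "0 \<le> T"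
  shows "\<bar>f T - f 0\<bar> \<le> C * T"
proof -
  have n': "f' t \<le> C" "- f' t \<le> C" if "0 \<le> t" "t \<le> T" for t
    using n[OF that] by auto
  have "f T - C * T \<le> f 0 - C * 0"
    by (rule deriv_within_half_line_nonpos[where f="\<lambda>t. f t - C * t" and f'="\<lambda>t. f' t - C" and T=T])
       (use n' st in \<open>auto intro!: derivative_eq_intros d\<close>)
  moreover have "- f T - C * T \<le> - f 0 - C * 0"
    by (rule deriv_within_half_line_nonpos[where f="\<lambda>t. - f t - C * t" and f'="\<lambda>t. - f' t - C" and T=T])
       (use n' st in \<open>auto intro!: derivative_eq_intros d\<close>)
  ultimately show ?thesis by simp
qed

lemma deriv_half_line_shift:
  fixes f :: "real \<Rightarrow> real"
  assumes "(f has_real_derivative D) (at (x + c) within {0..})" "0 \<le> c"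
  shows "((\<lambda>x. f (x + c)) has_real_derivative D) (at x within {0..})"
proof -
  have "(f has_real_derivative D) (at (x + c) within (\<lambda>x. x + c) ` {0..})"
    by (rule DERIV_subset[OF assms(1)]) (use assms(2) in auto)
  moreover have "((\<lambda>x. x + c) has_real_derivative 1) (at x within {0..})"
    by (auto intro!: derivative_eq_intros)
  ultimately have "(f \<circ> (\<lambda>x. x + c) has_real_derivative D * 1) (at x within {0..})"
    by (rule DERIV_image_chain)
  then show ?thesis by (simp add: o_def)
qed

text \<open>Separate differentiability in the two times does not give a chain rule; joint continuity
  of the partial derivative in the second time makes N differentiable in both together. In the
  energy argument that derivative is the kinetic form, an inner product of L^2-continuous
  curves.\<close>

lemma chain_two_time:
  fixes N A B :: "real \<Rightarrow> real \<Rightarrow> real"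
  assumes Ns: "\<And>s r. 0 \<le> s \<Longrightarrow> 0 \<le> r \<Longrightarrow> ((\<lambda>s. N s r) has_real_derivative A s r) (at s within {0..})"
    and Nr: "\<And>s r. 0 \<le> s \<Longrightarrow> 0 \<le> r \<Longrightarrow> (N s has_real_derivative B s r) (at r within {0..})"
    and B: "continuous_on ({0..} \<times> {0..}) (\<lambda>(s, r). B s r)"
    and nn: "0 \<le> a" "0 \<le> b" "0 \<le> s"
  shows "((\<lambda>s. N (s + a) (s + b)) has_real_derivative A (s + a) (s + b) + B (s + a) (s + b)) (at s within {0..})"
proof -
  let ?x = "s + a" and ?y = "s + b"
  have "((\<lambda>(x, y). N x y) has_derivative
      (\<lambda>(tx, ty). A ?x ?y * tx + blinfun_apply (blinfun_mult_right (B ?x ?y)) ty))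
      (at (?x, ?y) within {0..} \<times> {0..})"
  proof (rule has_derivative_partialsI)
    show "((\<lambda>x. N x ?y) has_derivative (*) (A ?x ?y)) (at ?x within {0..})"
      using Ns[of ?x ?y] nn by (simp add: has_field_derivative_def)
    show "(N x has_derivative blinfun_apply (blinfun_mult_right (B x y))) (at y within {0..})"
      if "x \<in> {0..}" "y \<in> {0..}" for x y
      using Nr[of x y] that by (simp add: has_field_derivative_def)
    have "continuous (at (?x, ?y) within {0..} \<times> {0..}) (\<lambda>(s, r). B s r)"
      using B nn by (simp add: continuous_on_eq_continuous_within)
    then have "continuous (at (?x, ?y) within {0..} \<times> {0..}) (\<lambda>p. blinfun_mult_right (case p of (s, r) \<Rightarrow> B s r))"
      by (rule bounded_linear.continuous[OF bounded_linear_blinfun_mult_right])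
    then show "continuous (at (?x, ?y) within {0..} \<times> {0..}) (\<lambda>(x, y). blinfun_mult_right (B x y))"
      by (simp add: case_prod_beta')
  qed (use nn in auto)
  then have *: "((\<lambda>(x, y). N x y) has_derivative (\<lambda>(tx, ty). A ?x ?y * tx + B ?x ?y * ty))
      (at (?x, ?y) within (\<lambda>s. (s + a, s + b)) ` {0..})"
    by (rule has_derivative_subset[THEN has_derivative_eq_rhs]) (use nn in auto)
  have "((\<lambda>s. (s + a, s + b)) has_derivative (\<lambda>h. (h, h))) (at s within {0..})"
    by (auto intro!: derivative_eq_intros)
  from has_derivative_in_compose[OF this *]
  have "((\<lambda>s. N (s + a) (s + b)) has_derivative (\<lambda>h. A ?x ?y * h + B ?x ?y * h)) (at s within {0..})"
    by simp
  moreover have "(\<lambda>h. A ?x ?y * h + B ?x ?y * h) = (*) (A ?x ?y + B ?x ?y)"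
    by (simp add: fun_eq_iff distrib_right)
  ultimately show ?thesis by (simp add: has_field_derivative_def)
qed

text \<open>If \<open>N s r = \<langle>v s, u r\<rangle>\<close> for a solution of \<open>u' = v\<close>, \<open>v' = - \<A> u + q\<close>, then \<open>p\<close>, \<open>a\<close>, \<open>Q\<close>, \<open>\<kappa>\<close> below are
  \<open>\<langle>v, v\<rangle>\<close>, \<open>\<langle>\<A> u, u\<rangle>\<close>, \<open>\<langle>q, u\<rangle>\<close>, \<open>\<langle>q, v\<rangle>\<close> evaluated at two times, and the conclusion is the energy
  identity.  Weak solutions do not allow testing with \<open>v\<close>; instead the antisymmetric increment
  \<open>N s (s + \<delta>) - N (s + \<delta>) s\<close> is used, in whose \<open>s\<close>-derivative the symmetric terms \<open>p\<close> and \<open>a\<close> cancel.\<close>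

lemma two_time_energy:
  fixes N p a Q \<kappa> :: "real \<Rightarrow> real \<Rightarrow> real"
  assumes Ns: "\<And>s r. 0 \<le> s \<Longrightarrow> 0 \<le> r \<Longrightarrow> ((\<lambda>s. N s r) has_real_derivative - a s r + Q s r) (at s within {0..})"
    and Nr: "\<And>s r. 0 \<le> s \<Longrightarrow> 0 \<le> r \<Longrightarrow> (N s has_real_derivative p s r) (at r within {0..})"
    and Qr: "\<And>s r. 0 \<le> s \<Longrightarrow> 0 \<le> r \<Longrightarrow> (Q s has_real_derivative \<kappa> s r) (at r within {0..})"
    and sym: "\<And>s r. 0 \<le> s \<Longrightarrow> 0 \<le> r \<Longrightarrow> p s r = p r s" "\<And>s r. 0 \<le> s \<Longrightarrow> 0 \<le> r \<Longrightarrow> a s r = a r s"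
    and p: "continuous_on ({0..} \<times> {0..}) (\<lambda>(s, r). p s r)"
    and Q: "continuous_on ({0..} \<times> {0..}) (\<lambda>(s, r). Q s r)"
    and \<kappa>: "continuous_on ({0..} \<times> {0..}) (\<lambda>(s, r). \<kappa> s r)"
    and T: "0 \<le> T"
  shows "((\<lambda>t. p t t + a t t) has_real_derivative 2 * \<kappa> T T) (at T within {0..})"
proof (rule FTC_within_half_line[OF _ _ T])
  have diag: "continuous_on {0..} (\<lambda>s. f s s)" if "continuous_on ({0..} \<times> {0..}) (\<lambda>(s, r). f s r)"
    for f :: "real \<Rightarrow> real \<Rightarrow> real"
  proof -
    have "continuous_on {0..} (\<lambda>s. (\<lambda>(s, r). f s r) (s, s))"
      by (rule continuous_on_compose2[OF that]) (auto intro!: continuous_intros)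
    then show ?thesis by simp
  qed
  show "continuous_on {0..} (\<lambda>s. 2 * \<kappa> s s)"
    using diag[OF \<kappa>] by (intro continuous_intros)
  fix T :: real assume T: "0 \<le> T"
  \<comment> \<open>\<open>Q\<close> is known to be differentiable only in its second argument.
    Adding the increment of this primitive regroups the derivative of the antisymmetric increment
    into two increments of \<open>Q\<close> in the second argument, each close to
    \<open>\<delta> * \<kappa> s s\<close>.\<close>
  define K where "K = (\<lambda>s. integral {0..s} (\<lambda>\<sigma>. Q \<sigma> \<sigma>))"
  define I where "I = (\<lambda>s. integral {0..s} (\<lambda>\<sigma>. 2 * \<kappa> \<sigma> \<sigma>))"
  have dK: "(K has_real_derivative Q s s) (at s within {0..})" if "0 \<le> s" for s
    using diag[OF Q] that by (intro FTC_within_half_line) (auto simp: K_def)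
  have dI: "(I has_real_derivative 2 * \<kappa> s s) (at s within {0..})" if "0 \<le> s" for s
    using diag[OF \<kappa>] that by (intro FTC_within_half_line) (auto simp: I_def intro!: continuous_intros)
  \<comment> \<open>Subtracting \<open>\<delta> * I s\<close> removes the leading part of that
    derivative, so on bounded time intervals \<open>H \<delta>\<close> varies by
    o(\<delta>).\<close>
  define H where "H = (\<lambda>\<delta> s. N s (s + \<delta>) - N (s + \<delta>) s + (K (s + \<delta>) - K s) - \<delta> * I s)"
  have dH: "(H \<delta> has_real_derivative
      Q s (s + \<delta>) - Q (s + \<delta>) s + (Q (s + \<delta>) (s + \<delta>) - Q s s) - \<delta> * (2 * \<kappa> s s)) (at s within {0..})"
    if "0 \<le> \<delta>" "0 \<le> s" for \<delta> s
  proof -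
    have "((\<lambda>s. N s (s + \<delta>)) has_real_derivative (- a s (s + \<delta>) + Q s (s + \<delta>)) + p s (s + \<delta>)) (at s within {0..})"
      using chain_two_time[OF Ns Nr p, of 0 \<delta> s] that by simp
    moreover have "((\<lambda>s. N (s + \<delta>) s) has_real_derivative (- a (s + \<delta>) s + Q (s + \<delta>) s) + p (s + \<delta>) s) (at s within {0..})"
      using chain_two_time[OF Ns Nr p, of \<delta> 0 s] that by simp
    moreover have "((\<lambda>s. K (s + \<delta>)) has_real_derivative Q (s + \<delta>) (s + \<delta>)) (at s within {0..})"
      using that by (intro deriv_half_line_shift dK) auto
    ultimately have "(H \<delta> has_real_derivative
      ((- a s (s + \<delta>) + Q s (s + \<delta>)) + p s (s + \<delta>)) - ((- a (s + \<delta>) s + Q (s + \<delta>) s) + p (s + \<delta>) s)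
      + (Q (s + \<delta>) (s + \<delta>) - Q s s) - \<delta> * (2 * \<kappa> s s)) (at s within {0..})"
      unfolding H_def using dK[OF that(2)] dI[OF that(2)]
      by (intro DERIV_diff DERIV_add DERIV_cmult)
    then show ?thesis using sym[of s "s + \<delta>"] that by simp
  qed
  \<comment> \<open>Differentiating in \<delta> at 0 recovers the energy: the second argument of N
    contributes p, the first contributes a - Q, and K restores Q.\<close>
  have H0: "((\<lambda>\<delta>. H \<delta> s) has_real_derivative p s s + a s s - I s) (at 0 within {0..})" if s: "0 \<le> s" for s
  proof -
    have "((\<lambda>\<delta>. N s (\<delta> + s)) has_real_derivative p s s) (at 0 within {0..})"
      using s by (intro deriv_half_line_shift) (auto intro!: Nr)
    moreover have "((\<lambda>\<delta>. N (\<delta> + s) s) has_real_derivative - a s s + Q s s) (at 0 within {0..})"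
      using s by (intro deriv_half_line_shift[where f="\<lambda>x. N x s"]) (use Ns[of s s] in auto)
    moreover have "((\<lambda>\<delta>. K (\<delta> + s)) has_real_derivative Q s s) (at 0 within {0..})"
      using s by (intro deriv_half_line_shift) (auto intro!: dK)
    ultimately have "((\<lambda>\<delta>. N s (\<delta> + s) - N (\<delta> + s) s + (K (\<delta> + s) - K s) - \<delta> * I s) has_real_derivative
        p s s - (- a s s + Q s s) + (Q s s - 0) - 1 * I s) (at 0 within {0..})"
      by (intro DERIV_diff DERIV_add DERIV_cmult_right DERIV_ident DERIV_const)
    then show ?thesis by (simp add: H_def add.commute)
  qed
  define J where "J = (\<lambda>s. p s s + a s s - I s)"
  have lim: "((\<lambda>\<delta>. H \<delta> s / \<delta>) \<longlongrightarrow> J s) (at_right 0)" if "0 \<le> s" for s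
  proof -
    have "at (0::real) within {0..} = at_right 0"
    proof -
      have "at (0::real) within {0..} = at 0 within ({0..} - {0})" by (simp add: at_within_def)
      also have "{0..} - {0} = {0::real<..}" by auto
      finally show ?thesis .
    qed
    moreover have "H 0 s = 0" by (simp add: H_def)
    ultimately show ?thesis
      using H0[OF that] by (simp add: has_field_derivative_iff J_def)
  qed
  have small: "\<bar>J T - J 0\<bar> \<le> e" if "0 < e" for e
  proof -
    define \<epsilon> where "\<epsilon> = e / (2 * (T + 1))"
    have \<epsilon>: "0 < \<epsilon>" "2 * \<epsilon> * T \<le> e"
      using T that by (auto simp: \<epsilon>_def field_simps)
    have "uniformly_continuous_on ({0..T+1} \<times> {0..T+1}) (\<lambda>(s, r). \<kappa> s r)"
      by (intro compact_uniformly_continuous continuous_on_subset[OF \<kappa>] compact_Times) auto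
    from this[unfolded uniformly_continuous_on_def, rule_format, OF \<epsilon>(1)]
    obtain d where d: "0 < d" and dd: "\<And>x y. x \<in> {0..T+1} \<times> {0..T+1} \<Longrightarrow> y \<in> {0..T+1} \<times> {0..T+1} \<Longrightarrow>
        dist y x < d \<Longrightarrow> dist ((\<lambda>(s, r). \<kappa> s r) y) ((\<lambda>(s, r). \<kappa> s r) x) < \<epsilon>" by metis
    \<comment> \<open>The mean value theorem in the second argument evaluates \<kappa> within
      distance 2 \<delta> of (s, s); hence \<delta> < d/2.\<close>
    have incr: "\<bar>Q \<sigma> (s + \<delta>) - Q \<sigma> s - \<delta> * \<kappa> s s\<bar> \<le> \<delta> * \<epsilon>"
      if \<delta>: "0 < \<delta>" "\<delta> < min 1 (d/2)" and s: "0 \<le> s" "s \<le> T" and \<sigma>: "s \<le> \<sigma>" "\<sigma> \<le> s + \<delta>" for \<delta> s \<sigma>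
    proof -
      have "\<exists>x\<in>{s..s + \<delta>}. Q \<sigma> (s + \<delta>) - Q \<sigma> s = \<kappa> \<sigma> x * (s + \<delta> - s)"
      proof (rule mvt_very_simple)
        fix x assume "s \<le> x" "x \<le> s + \<delta>"
        with s \<sigma> have "(Q \<sigma> has_real_derivative \<kappa> \<sigma> x) (at x within {s..s + \<delta>})"
          by (intro DERIV_subset[OF Qr]) auto
        then show "(Q \<sigma> has_derivative (*) (\<kappa> \<sigma> x)) (at x within {s..s + \<delta>})"
          by (simp add: has_field_derivative_def)
      qed (use \<delta> in simp)
      then obtain x where x: "x \<in> {s..s + \<delta>}" "Q \<sigma> (s + \<delta>) - Q \<sigma> s = \<kappa> \<sigma> x * \<delta>" by auto
      have "dist (\<sigma>, x) (s, s) \<le> \<bar>\<sigma> - s\<bar> + \<bar>x - s\<bar>"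
        unfolding dist_Pair_Pair dist_real_def by (rule order_trans[OF sqrt_sum_squares_le_sum_abs]) simp
      also have "\<dots> < d" using x \<sigma> \<delta> by (auto simp: abs_if)
      finally have "dist (\<kappa> \<sigma> x) (\<kappa> s s) < \<epsilon>"
        using dd[of "(s, s)" "(\<sigma>, x)"] x \<sigma> \<delta> s by auto
      then have "\<bar>\<delta> * (\<kappa> \<sigma> x - \<kappa> s s)\<bar> \<le> \<delta> * \<epsilon>"
        using \<delta> by (simp add: abs_mult dist_real_def)
      then show ?thesis using x(2) by (simp add: algebra_simps)
    qed
    have bnd: "\<bar>H \<delta> T / \<delta> - H \<delta> 0 / \<delta>\<bar> \<le> 2 * \<epsilon> * T" if \<delta>: "0 < \<delta>" "\<delta> < min 1 (d/2)" for \<delta>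
    proof -
      have "\<bar>H \<delta> T - H \<delta> 0\<bar> \<le> (2 * \<delta> * \<epsilon>) * T"
      proof (rule deriv_within_half_line_bound[OF dH])
        fix t assume t: "0 \<le> t" "t \<le> T"
        have "\<bar>Q t (t + \<delta>) - Q t t - \<delta> * \<kappa> t t\<bar> \<le> \<delta> * \<epsilon>"
          "\<bar>Q (t + \<delta>) (t + \<delta>) - Q (t + \<delta>) t - \<delta> * \<kappa> t t\<bar> \<le> \<delta> * \<epsilon>"
          using incr[OF \<delta> t, of t] incr[OF \<delta> t, of "t + \<delta>"] \<delta>(1) by simp_all
        then show "\<bar>Q t (t + \<delta>) - Q (t + \<delta>) t + (Q (t + \<delta>) (t + \<delta>) - Q t t) - \<delta> * (2 * \<kappa> t t)\<bar> \<le> 2 * \<delta> * \<epsilon>"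
          by linarith
      qed (use \<delta> T in auto)
      then have "\<bar>(H \<delta> T - H \<delta> 0) / \<delta>\<bar> \<le> 2 * \<epsilon> * T"
        using \<delta>(1) by (simp add: abs_divide pos_divide_le_eq mult.commute mult.left_commute)
      then show ?thesis by (simp add: diff_divide_distrib)
    qed
    have "\<bar>J T - J 0\<bar> \<le> 2 * \<epsilon> * T"
    proof (rule tendsto_upperbound)
      show "((\<lambda>\<delta>. \<bar>H \<delta> T / \<delta> - H \<delta> 0 / \<delta>\<bar>) \<longlongrightarrow> \<bar>J T - J 0\<bar>) (at_right 0)"
        using lim[of T] lim[of 0] T by (intro tendsto_intros) auto
      show "\<forall>\<^sub>F \<delta> in at_right 0. \<bar>H \<delta> T / \<delta> - H \<delta> 0 / \<delta>\<bar> \<le> 2 * \<epsilon> * T"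
        using d bnd by (intro eventually_at_rightI[of 0 "min 1 (d/2)"]) auto
    qed simp
    with \<epsilon> show ?thesis by simp
  qed
  have "\<bar>J T - J 0\<bar> \<le> 0" by (rule dense_ge) (rule small)
  then show "p T T + a T T - (p 0 0 + a 0 0) = integral {0..T} (\<lambda>s. 2 * \<kappa> s s)"
    by (simp add: J_def I_def)
qed

section \<open>Curves of functions and nonlinear composition\<close>

text \<open>Continuity in time as a map into L^2, phrased with the seminorm because the values are
  representatives and not elements of a normed type.\<close>

definition l2_curve :: "real \<Rightarrow> (real \<Rightarrow> rfun) \<Rightarrow> bool" where
  "l2_curve L X \<longleftrightarrow> (\<forall>t\<ge>0. l2 L (X t)) \<and>
    (\<forall>t\<ge>0. ((\<lambda>s. nrm L (\<lambda>x. X s x - X t x)) \<longlongrightarrow> 0) (at t within {0..}))"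

lemma l2_curve_l2: "l2_curve L X \<Longrightarrow> 0 \<le> t \<Longrightarrow> l2 L (X t)"
  by (simp add: l2_curve_def)

lemma l2_curve_tendsto:
  "l2_curve L X \<Longrightarrow> 0 \<le> t \<Longrightarrow> ((\<lambda>s. nrm L (\<lambda>x. X s x - X t x)) \<longlongrightarrow> 0) (at t within {0..})"
  by (simp add: l2_curve_def)

lemma nrm_zero [simp]: "nrm L (\<lambda>x. 0) = 0"
  by (simp add: nrm_def ip_eq)

lemma eventually_nonneg_within: "\<forall>\<^sub>F s in at t within {0::real..}. 0 \<le> s"
  by (simp add: eventually_at_filter)

lemma l2_curve_dominated:
  assumes "\<And>t. 0 \<le> t \<Longrightarrow> l2 L (Z t)"
    and "\<And>t. 0 \<le> t \<Longrightarrow> (d t \<longlongrightarrow> 0) (at t within {0..})"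
    and "\<And>t. 0 \<le> t \<Longrightarrow> \<forall>\<^sub>F s in at t within {0..}. nrm L (\<lambda>x. Z s x - Z t x) \<le> d t s"
  shows "l2_curve L Z"
  unfolding l2_curve_def
proof (intro conjI allI impI)
  fix t :: real assume "0 \<le> t"
  then show "((\<lambda>s. nrm L (\<lambda>x. Z s x - Z t x)) \<longlongrightarrow> 0) (at t within {0..})"
    by (intro Lim_null_comparison[OF _ assms(2)]) (simp_all add: assms(3))
qed (use assms in auto)

lemma l2_curve_const: "l2 L h \<Longrightarrow> l2_curve L (\<lambda>t. h)"
  by (simp add: l2_curve_def)

lemma l2_curve_add:
  assumes X: "l2_curve L X" and Y: "l2_curve L Y"
  shows "l2_curve L (\<lambda>t x. X t x + Y t x)"
proof (rule l2_curve_dominated)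
  fix t :: real assume t: "0 \<le> t"
  show "l2 L (\<lambda>x. X t x + Y t x)" using assms t by (auto dest: l2_curve_l2)
  show "((\<lambda>s. nrm L (\<lambda>x. X s x - X t x) + nrm L (\<lambda>x. Y s x - Y t x)) \<longlongrightarrow> 0) (at t within {0..})"
    using tendsto_add[OF l2_curve_tendsto[OF X t] l2_curve_tendsto[OF Y t]] by simp
  show "\<forall>\<^sub>F s in at t within {0..}. nrm L (\<lambda>x. X s x + Y s x - (X t x + Y t x))
      \<le> nrm L (\<lambda>x. X s x - X t x) + nrm L (\<lambda>x. Y s x - Y t x)"
    using eventually_nonneg_within
  proof eventually_elim
    case (elim s)
    have "nrm L (\<lambda>x. X s x + Y s x - (X t x + Y t x)) = nrm L (\<lambda>x. (X s x - X t x) + (Y s x - Y t x))"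
      by (rule nrm_cong) simp
    also have "\<dots> \<le> nrm L (\<lambda>x. X s x - X t x) + nrm L (\<lambda>x. Y s x - Y t x)"
      using assms t elim by (intro nrm_triangle l2_diff) (auto dest: l2_curve_l2)
    finally show ?case .
  qed
qed

lemma l2_curve_cmult:
  assumes X: "l2_curve L X"
  shows "l2_curve L (\<lambda>t x. c * X t x)"
proof (rule l2_curve_dominated)
  fix t :: real assume t: "0 \<le> t"
  show "l2 L (\<lambda>x. c * X t x)" using assms t by (auto dest: l2_curve_l2)
  show "((\<lambda>s. \<bar>c\<bar> * nrm L (\<lambda>x. X s x - X t x)) \<longlongrightarrow> 0) (at t within {0..})"
    using tendsto_mult_right_zero[OF l2_curve_tendsto[OF X t]] by simp
  have "nrm L (\<lambda>x. c * X s x - c * X t x) = \<bar>c\<bar> * nrm L (\<lambda>x. X s x - X t x)" for s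
    using nrm_cmult[of L c "\<lambda>x. X s x - X t x"] by (simp add: right_diff_distrib)
  then show "\<forall>\<^sub>F s in at t within {0..}. nrm L (\<lambda>x. c * X s x - c * X t x) \<le> \<bar>c\<bar> * nrm L (\<lambda>x. X s x - X t x)"
    by simp
qed

lemma l2_curve_minus: "l2_curve L X \<Longrightarrow> l2_curve L (\<lambda>t x. - X t x)"
  using l2_curve_cmult[of L X "-1"] by simp

lemma l2_curve_diff: "l2_curve L X \<Longrightarrow> l2_curve L Y \<Longrightarrow> l2_curve L (\<lambda>t x. X t x - Y t x)"
  using l2_curve_add[OF _ l2_curve_minus, of L X Y] by simp

lemma l2_curve_sequentially:
  assumes X: "l2_curve L X" and s: "\<And>n. 0 \<le> s n" "s \<longlonglongrightarrow> t" "0 \<le> t"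
  shows "(\<lambda>n. nrm L (\<lambda>x. X (s n) x - X t x)) \<longlonglongrightarrow> 0"
proof -
  have "continuous (at t within {0..}) (\<lambda>s. nrm L (\<lambda>x. X s x - X t x))"
    using l2_curve_tendsto[OF X s(3)] by (simp add: continuous_within)
  then have "(\<lambda>n. nrm L (\<lambda>x. X (s n) x - X t x)) \<longlonglongrightarrow> nrm L (\<lambda>x. X t x - X t x)"
    unfolding continuous_within_sequentially o_def using s by auto
  then show ?thesis by simp
qed

text \<open>Writing each factor as limit plus error leaves three error terms, all controlled by
  Cauchy-Schwarz. Continuity in two independent times is what \<open>chain_two_time\<close> and
  \<open>two_time_energy\<close> ask for.\<close>

lemma ip_continuous_two_time:
  assumes X: "l2_curve L X" and Y: "l2_curve L Y"
  shows "continuous_on ({0..} \<times> {0..}) (\<lambda>(s, r). ip L (X s) (Y r))"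
  unfolding continuous_on_sequentially
proof (intro allI ballI impI)
  fix z :: "nat \<Rightarrow> real \<times> real" and a :: "real \<times> real"
  assume a: "a \<in> {0..} \<times> {0..}" and z: "(\<forall>n. z n \<in> {0..} \<times> {0..}) \<and> z \<longlonglongrightarrow> a"
  obtain s0 r0 where a0: "a = (s0, r0)" "0 \<le> s0" "0 \<le> r0" using a by auto
  define s where "s = (\<lambda>n. fst (z n))"
  define r where "r = (\<lambda>n. snd (z n))"
  have s: "\<And>n. 0 \<le> s n" "s \<longlonglongrightarrow> s0" and r: "\<And>n. 0 \<le> r n" "r \<longlonglongrightarrow> r0"
    using z a0 tendsto_fst[of z a sequentially] tendsto_snd[of z a sequentially]
    by (auto simp: s_def r_def mem_Times_iff)
  define x where "x = (\<lambda>n. nrm L (\<lambda>y. X (s n) y - X s0 y))"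
  define y where "y = (\<lambda>n. nrm L (\<lambda>x. Y (r n) x - Y r0 x))"
  have xy: "x \<longlonglongrightarrow> 0" "y \<longlonglongrightarrow> 0"
    unfolding x_def y_def using l2_curve_sequentially[OF X s a0(2)] l2_curve_sequentially[OF Y r a0(3)] by auto
  have bound: "\<bar>ip L (X (s n)) (Y (r n)) - ip L (X s0) (Y r0)\<bar> \<le> x n * y n + x n * nrm L (Y r0) + nrm L (X s0) * y n" for n
  proof -
    have l: "l2 L (X (s n))" "l2 L (X s0)" "l2 L (Y (r n))" "l2 L (Y r0)"
      using X Y s(1) r(1) a0 by (auto dest: l2_curve_l2)
    let ?x = "\<lambda>y. X (s n) y - X s0 y" and ?y = "\<lambda>x. Y (r n) x - Y r0 x"
    have d: "l2 L ?x" "l2 L ?y" using l by auto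
    have "ip L (X (s n)) (Y (r n)) - ip L (X s0) (Y r0) = ip L ?x ?y + ip L ?x (Y r0) + ip L (X s0) ?y"
      using l d by (simp add: ip_diff_left ip_diff_right)
    moreover have "\<bar>ip L ?x ?y\<bar> \<le> x n * y n" "\<bar>ip L ?x (Y r0)\<bar> \<le> x n * nrm L (Y r0)"
      "\<bar>ip L (X s0) ?y\<bar> \<le> nrm L (X s0) * y n"
      unfolding x_def y_def using l d by (auto intro: Cauchy_Schwarz_ip)
    ultimately show ?thesis by linarith
  qed
  have "(\<lambda>n. x n * y n + x n * nrm L (Y r0) + nrm L (X s0) * y n) \<longlonglongrightarrow> 0 * 0 + 0 * nrm L (Y r0) + nrm L (X s0) * 0"
    using xy by (intro tendsto_intros)
  then have lim: "(\<lambda>n. x n * y n + x n * nrm L (Y r0) + nrm L (X s0) * y n) \<longlonglongrightarrow> 0"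
    by simp
  have "(\<lambda>n. ip L (X (s n)) (Y (r n)) - ip L (X s0) (Y r0)) \<longlonglongrightarrow> 0"
    by (rule Lim_null_comparison[OF _ lim]) (simp add: bound)
  then have "(\<lambda>n. ip L (X (s n)) (Y (r n))) \<longlonglongrightarrow> ip L (X s0) (Y r0)"
    by (simp add: LIM_zero_iff)
  then show "((\<lambda>(s, r). ip L (X s) (Y r)) \<circ> z) \<longlonglongrightarrow> (\<lambda>(s, r). ip L (X s) (Y r)) a"
    by (simp add: o_def a0 s_def r_def case_prod_beta)
qed

lemma ip_continuous:
  assumes "l2_curve L X" "l2_curve L Y"
  shows "continuous_on {0..} (\<lambda>s. ip L (X s) (Y s))"
proof -
  have "continuous_on {0..} (\<lambda>s. (\<lambda>(s, r). ip L (X s) (Y r)) (s, s))"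
    by (rule continuous_on_compose2[OF ip_continuous_two_time[OF assms]]) (auto intro!: continuous_intros)
  then show ?thesis by simp
qed

lemma ip_continuous_const:
  "l2_curve L X \<Longrightarrow> l2 L h \<Longrightarrow> continuous_on {0..} (\<lambda>s. ip L (X s) h)"
  using ip_continuous[of L X "\<lambda>t. h"] l2_curve_const by auto

lemma l2_curve_bounded:
  assumes "l2_curve L X"
  shows "\<exists>B. \<forall>t\<in>{0..T}. nrm L (X t) \<le> B"
proof -
  have "continuous_on {0..T} (\<lambda>t. nrm L (X t))"
    unfolding nrm_def
    by (intro continuous_on_real_sqrt continuous_on_subset[OF ip_continuous[OF assms assms]]) auto
  from compact_imp_bounded[OF compact_continuous_image[OF this compact_Icc]]
  show ?thesis by (auto simp: bounded_iff)
qed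

lemma l2_curve_lipschitz_image:
  assumes X: "l2_curve L X" and g: "continuous_on UNIV g" "g 0 = (0::real)"
    and lip: "\<And>a b. \<bar>g a - g b\<bar> \<le> M * \<bar>a - b\<bar>"
  shows "l2_curve L (\<lambda>t x. g (X t x))"
proof (rule l2_curve_dominated)
  fix t :: real assume t: "0 \<le> t"
  have meas: "(\<lambda>x. g (X s x)) \<in> borel_measurable (mu L)" if "0 \<le> s" for s
    using measurable_compose[OF l2_measurable[OF l2_curve_l2[OF X that]] borel_measurable_continuous_onI[OF g(1)]] .
  have M: "0 \<le> M" using lip[of 1 0] by auto
  have gl2: "l2 L (\<lambda>x. g (X s x))" if "0 \<le> s" for s
    using l2_curve_l2[OF X that] meas[OF that] by (rule l2_le) (use lip[of _ 0] g in auto)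
  then show "l2 L (\<lambda>x. g (X t x))" using t by simp
  show "((\<lambda>s. M * nrm L (\<lambda>x. X s x - X t x)) \<longlongrightarrow> 0) (at t within {0..})"
    using tendsto_mult_right_zero[OF l2_curve_tendsto[OF X t]] by simp
  show "\<forall>\<^sub>F s in at t within {0..}. nrm L (\<lambda>x. g (X s x) - g (X t x)) \<le> M * nrm L (\<lambda>x. X s x - X t x)"
    using eventually_nonneg_within
  proof eventually_elim
    case (elim s)
    have "nrm L (\<lambda>x. g (X s x) - g (X t x)) \<le> nrm L (\<lambda>x. M * (X s x - X t x))"
      using lip M elim t gl2 X by (intro nrm_mono l2_cmult l2_diff) (auto simp: abs_mult dest: l2_curve_l2)
    then show ?case using M by (simp add: nrm_cmult)
  qed
qed

text \<open>Continuity is imposed on the derivative alone; L^2 continuity of u itself follows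
  through \<open>nrm_h10_bound\<close>.\<close>

definition h1_curve :: "real \<Rightarrow> (real \<Rightarrow> rfun) \<Rightarrow> bool" where
  "h1_curve L u \<longleftrightarrow> (\<forall>t\<ge>0. h10 L (u t)) \<and> l2_curve L (\<lambda>t. dx L (u t))"

lemma h1_curve_h10: "h1_curve L u \<Longrightarrow> 0 \<le> t \<Longrightarrow> h10 L (u t)"
  by (simp add: h1_curve_def)

lemma h1_curve_dx: "h1_curve L u \<Longrightarrow> l2_curve L (\<lambda>t. dx L (u t))"
  by (simp add: h1_curve_def)

lemma h10_diff_bound:
  assumes "0 \<le> L" "h10 L u" "h10 L v" "x \<in> {0..L}"
  shows "\<bar>u x - v x\<bar> \<le> sqrt L * nrm L (\<lambda>x. dx L u x - dx L v x)"
  using h10_bound[OF assms(1) h10_diff(1)[OF assms(2,3)] assms(4)] by (simp add: nrm_dx_diff assms)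

text \<open>A crude Poincare inequality obtained from the sup bound. It serves continuity and
  comparison; the sharp constant enters only where the bound on \<beta> matters.\<close>

lemma nrm_h10_bound:
  assumes "0 \<le> L" "h10 L u"
  shows "nrm L u \<le> L * nrm L (dx L u)"
proof -
  have "nrm L u \<le> sqrt L * \<bar>sqrt L * nrm L (dx L u)\<bar>"
    by (intro nrm_bounded h10_measurable h10_bound assms)
  also have "\<dots> = L * nrm L (dx L u)"
    using assms(1) by (simp add: abs_mult)
  finally show ?thesis .
qed

lemma h1_curve_l2_curve:
  assumes L: "0 \<le> L" and u: "h1_curve L u"
  shows "l2_curve L u"
proof (rule l2_curve_dominated)
  fix t :: real assume t: "0 \<le> t"
  show "l2 L (u t)" using h10_l2 h1_curve_h10[OF u t] by auto
  show "((\<lambda>s. L * nrm L (\<lambda>x. dx L (u s) x - dx L (u t) x)) \<longlongrightarrow> 0) (at t within {0..})"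
    using tendsto_mult_right_zero[OF l2_curve_tendsto[OF h1_curve_dx[OF u] t]] by simp
  show "\<forall>\<^sub>F s in at t within {0..}. nrm L (\<lambda>x. u s x - u t x) \<le> L * nrm L (\<lambda>x. dx L (u s) x - dx L (u t) x)"
    using eventually_nonneg_within
  proof eventually_elim
    case (elim s)
    then show ?case
      using nrm_h10_bound[OF L h10_diff(1)[OF h1_curve_h10[OF u elim] h1_curve_h10[OF u t]]]
      by (simp add: nrm_dx_diff h1_curve_h10[OF u] t)
  qed
qed

section \<open>Weak time derivatives and Lipschitz continuity in time\<close>

lemma weak_derivative:
  assumes v: "l2_curve L v"
    and w: "\<And>t. 0 \<le> t \<Longrightarrow> ip L (u t) h - ip L (u 0) h = integral {0..t} (\<lambda>s. ip L (v s) h)"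
    and h: "l2 L h" and t: "0 \<le> t"
  shows "((\<lambda>t. ip L (u t) h) has_real_derivative ip L (v t) h) (at t within {0..})"
  by (rule FTC_within_half_line[OF ip_continuous_const[OF v h] w t])

text \<open>The increment \<open>u t - u s\<close>, held fixed, serves as its own test function: its
  squared norm is the change of an inner product whose derivative is at most B times its norm, and
  one factor cancels.\<close>

lemma weak_derivative_lipschitz:
  assumes v: "l2_curve L v" and u: "l2_curve L u"
    and d: "\<And>h t. l2 L h \<Longrightarrow> 0 \<le> t \<Longrightarrow> ((\<lambda>t. ip L (u t) h) has_real_derivative ip L (v t) h) (at t within {0..})"
    and B: "\<And>t. t \<in> {0..T} \<Longrightarrow> nrm L (v t) \<le> B" and st: "0 \<le> s" "s \<le> t" "t \<le> T"
  shows "nrm L (\<lambda>x. u t x - u s x) \<le> B * (t - s)"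
proof -
  let ?w = "\<lambda>x. u t x - u s x"
  have w: "l2 L ?w" using st by (intro l2_diff l2_curve_l2[OF u]) auto
  have "\<bar>ip L (u (t - s + s)) ?w - ip L (u (0 + s)) ?w\<bar> \<le> (B * nrm L ?w) * (t - s)"
  proof (rule deriv_within_half_line_bound[where f="\<lambda>r. ip L (u (r + s)) ?w"])
    fix r assume r: "0 \<le> r" "r \<le> t - s"
    then show "((\<lambda>r. ip L (u (r + s)) ?w) has_real_derivative ip L (v (r + s)) ?w) (at r within {0..})"
      using st by (intro deriv_half_line_shift d w) auto
    have "\<bar>ip L (v (r + s)) ?w\<bar> \<le> nrm L (v (r + s)) * nrm L ?w"
      using r st by (intro Cauchy_Schwarz_ip w l2_curve_l2[OF v]) auto
    also have "\<dots> \<le> B * nrm L ?w"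
      using r st by (intro mult_right_mono B) auto
    finally show "\<bar>ip L (v (r + s)) ?w\<bar> \<le> B * nrm L ?w" .
  qed (use st in auto)
  moreover have "ip L (u t) ?w - ip L (u s) ?w = (nrm L ?w)\<^sup>2"
    using u st w by (simp add: nrm_square ip_diff_left l2_curve_l2)
  ultimately have "(nrm L ?w)\<^sup>2 \<le> (B * (t - s)) * nrm L ?w"
    by (simp add: mult.commute mult.left_commute)
  moreover have "0 \<le> B" using B[of s] st nrm_nonneg[of L "v s"] by (meson atLeastAtMost_iff order_trans)
  ultimately show ?thesis
  proof (cases "nrm L ?w = 0")
    case False
    then have "0 < nrm L ?w" using nrm_nonneg[of L ?w] by linarith
    then show ?thesis
      using \<open>(nrm L ?w)\<^sup>2 \<le> (B * (t - s)) * nrm L ?w\<close> unfolding power2_eq_square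
      by (simp only: mult_le_cancel_right_pos)
  qed (use st in simp)
qed

text \<open>H^1_0 functions of bounded norm take values in a fixed cube, so Lipschitz bounds on
  cubes are the form of regularity that compositions with the sources use.\<close>

definition box_lipschitz :: "(real \<times> real \<times> real \<Rightarrow> real) \<Rightarrow> real \<Rightarrow> real \<Rightarrow> bool" where
  "box_lipschitz f R K \<longleftrightarrow> 0 \<le> K \<and> (\<forall>a1 a2 a3 b1 b2 b3.
     \<bar>a1\<bar> \<le> R \<and> \<bar>a2\<bar> \<le> R \<and> \<bar>a3\<bar> \<le> R \<and> \<bar>b1\<bar> \<le> R \<and> \<bar>b2\<bar> \<le> R \<and> \<bar>b3\<bar> \<le> R \<longrightarrow>
     \<bar>f (a1, a2, a3) - f (b1, b2, b3)\<bar> \<le> K * (\<bar>a1 - b1\<bar> + \<bar>a2 - b2\<bar> + \<bar>a3 - b3\<bar>))"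

lemma box_lipschitzD:
  assumes "box_lipschitz f R K" "\<bar>a1\<bar> \<le> R" "\<bar>a2\<bar> \<le> R" "\<bar>a3\<bar> \<le> R" "\<bar>b1\<bar> \<le> R" "\<bar>b2\<bar> \<le> R" "\<bar>b3\<bar> \<le> R"
  shows "\<bar>f (a1, a2, a3) - f (b1, b2, b3)\<bar> \<le> K * (\<bar>a1 - b1\<bar> + \<bar>a2 - b2\<bar> + \<bar>a3 - b3\<bar>)"
  using assms by (simp add: box_lipschitz_def)

lemma abs_sum3_le: "\<bar>x\<bar> \<le> X \<Longrightarrow> \<bar>y\<bar> \<le> Y \<Longrightarrow> \<bar>z\<bar> \<le> Z \<Longrightarrow> \<bar>x + y + z\<bar> \<le> X + Y + Z" for x y z :: real
  by linarith

text \<open>Two properties of the intermediate point are recorded for two uses: it stays in the box,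
  where the derivatives are bounded, and each coordinate is no farther from b than that of a, which
  controls the Taylor remainder of the potential.\<close>

lemma mvt_segment:
  fixes f D1 D2 D3 :: "real \<times> real \<times> real \<Rightarrow> real"
  assumes d: "\<And>z. (f has_derivative (\<lambda>h. D1 z * fst h + D2 z * fst (snd h) + D3 z * snd (snd h))) (at z)"
    and a: "\<bar>a1\<bar> \<le> R" "\<bar>a2\<bar> \<le> R" "\<bar>a3\<bar> \<le> R" and b: "\<bar>b1\<bar> \<le> R" "\<bar>b2\<bar> \<le> R" "\<bar>b3\<bar> \<le> R"
  shows "\<exists>c1 c2 c3. \<bar>c1\<bar> \<le> R \<and> \<bar>c2\<bar> \<le> R \<and> \<bar>c3\<bar> \<le> R
    \<and> \<bar>c1 - b1\<bar> \<le> \<bar>a1 - b1\<bar> \<and> \<bar>c2 - b2\<bar> \<le> \<bar>a2 - b2\<bar> \<and> \<bar>c3 - b3\<bar> \<le> \<bar>a3 - b3\<bar>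
    \<and> f (a1, a2, a3) - f (b1, b2, b3)
      = D1 (c1, c2, c3) * (a1 - b1) + D2 (c1, c2, c3) * (a2 - b2) + D3 (c1, c2, c3) * (a3 - b3)"
proof -
  define c where "c = (\<lambda>t. (b1 + t * (a1 - b1), b2 + t * (a2 - b2), b3 + t * (a3 - b3)))"
  have dc: "(c has_derivative (\<lambda>h. (h * (a1 - b1), h * (a2 - b2), h * (a3 - b3)))) (at t within {0..1})" for t
    unfolding c_def by (auto intro!: derivative_eq_intros)
  have "\<exists>t\<in>{0..1}. f (c 1) - f (c 0)
      = (\<lambda>h. D1 (c t) * (h * (a1 - b1)) + D2 (c t) * (h * (a2 - b2)) + D3 (c t) * (h * (a3 - b3))) (1 - 0)"
  proof (rule mvt_very_simple[where f="\<lambda>t. f (c t)"])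
    fix t :: real
    show "((\<lambda>t. f (c t)) has_derivative (\<lambda>h. D1 (c t) * (h * (a1 - b1)) + D2 (c t) * (h * (a2 - b2))
        + D3 (c t) * (h * (a3 - b3)))) (at t within {0..1})"
      using has_derivative_compose[OF dc d] by simp
  qed simp
  then obtain t where t: "0 \<le> t" "t \<le> 1"
    "f (c 1) - f (c 0) = D1 (c t) * (a1 - b1) + D2 (c t) * (a2 - b2) + D3 (c t) * (a3 - b3)" by auto
  have conv: "\<bar>y + t * (x - y)\<bar> \<le> R" if "\<bar>x\<bar> \<le> R" "\<bar>y\<bar> \<le> R" for x y
  proof -
    have "\<bar>y + t * (x - y)\<bar> = \<bar>(1 - t) * y + t * x\<bar>" by (simp add: algebra_simps)
    also have "\<dots> \<le> (1 - t) * \<bar>y\<bar> + t * \<bar>x\<bar>"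
      using t abs_triangle_ineq[of "(1 - t) * y" "t * x"] by (simp add: abs_mult)
    also have "\<dots> \<le> (1 - t) * R + t * R"
      using t that by (intro add_mono mult_left_mono) auto
    finally show ?thesis by (simp add: algebra_simps)
  qed
  have near: "\<bar>(y + t * (x - y)) - y\<bar> \<le> \<bar>x - y\<bar>" for x y :: real
    using t mult_right_mono[of t 1 "\<bar>x - y\<bar>"] by (simp add: abs_mult)
  have eq: "f (a1, a2, a3) - f (b1, b2, b3) = D1 (b1 + t * (a1 - b1), b2 + t * (a2 - b2), b3 + t * (a3 - b3)) * (a1 - b1)
      + D2 (b1 + t * (a1 - b1), b2 + t * (a2 - b2), b3 + t * (a3 - b3)) * (a2 - b2)
      + D3 (b1 + t * (a1 - b1), b2 + t * (a2 - b2), b3 + t * (a3 - b3)) * (a3 - b3)"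
    using t(3) by (simp add: c_def)
  show ?thesis
    by (intro exI conjI)
       (rule conv[OF a(1) b(1)] conv[OF a(2) b(2)] conv[OF a(3) b(3)] near eq)+
qed

lemma bounded_on_box:
  fixes f :: "real \<times> real \<times> real \<Rightarrow> real"
  assumes "continuous_on UNIV f"
  shows "\<exists>B\<ge>0. \<forall>a1 a2 a3. \<bar>a1\<bar> \<le> R \<and> \<bar>a2\<bar> \<le> R \<and> \<bar>a3\<bar> \<le> R \<longrightarrow> \<bar>f (a1, a2, a3)\<bar> \<le> B"
proof -
  have "compact ({-R..R} \<times> {-R..R} \<times> {-R..R})" by (intro compact_Times compact_Icc)
  from compact_imp_bounded[OF compact_continuous_image[OF continuous_on_subset[OF assms subset_UNIV] this]]
  obtain B where B: "\<forall>y\<in>{-R..R} \<times> {-R..R} \<times> {-R..R}. \<bar>f y\<bar> \<le> B"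
    by (auto simp: bounded_iff)
  have "\<bar>f (a1, a2, a3)\<bar> \<le> max 0 B" if "\<bar>a1\<bar> \<le> R" "\<bar>a2\<bar> \<le> R" "\<bar>a3\<bar> \<le> R" for a1 a2 a3
  proof -
    have "(a1, a2, a3) \<in> {-R..R} \<times> {-R..R} \<times> {-R..R}" using that by (auto simp: abs_le_iff)
    then have "\<bar>f (a1, a2, a3)\<bar> \<le> B" using B by blast
    then show ?thesis by simp
  qed
  then show ?thesis by (intro exI[of _ "max 0 B"]) auto
qed

lemma C1_imp_box_lipschitz:
  fixes f D1 D2 D3 :: "real \<times> real \<times> real \<Rightarrow> real"
  assumes d: "\<And>z. (f has_derivative (\<lambda>h. D1 z * fst h + D2 z * fst (snd h) + D3 z * snd (snd h))) (at z)"
    and c: "continuous_on UNIV D1" "continuous_on UNIV D2" "continuous_on UNIV D3"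
  shows "\<exists>K. box_lipschitz f R K"
proof -
  obtain B1 where B1: "0 \<le> B1" "\<And>a1 a2 a3. \<bar>a1\<bar> \<le> R \<Longrightarrow> \<bar>a2\<bar> \<le> R \<Longrightarrow> \<bar>a3\<bar> \<le> R \<Longrightarrow> \<bar>D1 (a1, a2, a3)\<bar> \<le> B1"
    using bounded_on_box[OF c(1), of R] by blast
  obtain B2 where B2: "0 \<le> B2" "\<And>a1 a2 a3. \<bar>a1\<bar> \<le> R \<Longrightarrow> \<bar>a2\<bar> \<le> R \<Longrightarrow> \<bar>a3\<bar> \<le> R \<Longrightarrow> \<bar>D2 (a1, a2, a3)\<bar> \<le> B2"
    using bounded_on_box[OF c(2), of R] by blast
  obtain B3 where B3: "0 \<le> B3" "\<And>a1 a2 a3. \<bar>a1\<bar> \<le> R \<Longrightarrow> \<bar>a2\<bar> \<le> R \<Longrightarrow> \<bar>a3\<bar> \<le> R \<Longrightarrow> \<bar>D3 (a1, a2, a3)\<bar> \<le> B3"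
    using bounded_on_box[OF c(3), of R] by blast
  have "box_lipschitz f R (B1 + B2 + B3)"
    unfolding box_lipschitz_def
  proof (intro conjI allI impI)
    show "0 \<le> B1 + B2 + B3" using B1 B2 B3 by simp
    fix a1 a2 a3 b1 b2 b3
    assume h: "\<bar>a1\<bar> \<le> R \<and> \<bar>a2\<bar> \<le> R \<and> \<bar>a3\<bar> \<le> R \<and> \<bar>b1\<bar> \<le> R \<and> \<bar>b2\<bar> \<le> R \<and> \<bar>b3\<bar> \<le> R"
    from mvt_segment[OF d, of a1 R a2 a3 b1 b2 b3] h
    obtain c1 c2 c3 where cc: "\<bar>c1\<bar> \<le> R" "\<bar>c2\<bar> \<le> R" "\<bar>c3\<bar> \<le> R"
      and eq: "f (a1, a2, a3) - f (b1, b2, b3)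
        = D1 (c1, c2, c3) * (a1 - b1) + D2 (c1, c2, c3) * (a2 - b2) + D3 (c1, c2, c3) * (a3 - b3)" by blast
    have "\<bar>D1 (c1, c2, c3) * (a1 - b1)\<bar> \<le> (B1 + B2 + B3) * \<bar>a1 - b1\<bar>"
      "\<bar>D2 (c1, c2, c3) * (a2 - b2)\<bar> \<le> (B1 + B2 + B3) * \<bar>a2 - b2\<bar>"
      "\<bar>D3 (c1, c2, c3) * (a3 - b3)\<bar> \<le> (B1 + B2 + B3) * \<bar>a3 - b3\<bar>"
      unfolding abs_mult using B1(2)[OF cc] B2(2)[OF cc] B3(2)[OF cc] B1(1) B2(1) B3(1)
      by (auto intro!: mult_right_mono)
    then show "\<bar>f (a1, a2, a3) - f (b1, b2, b3)\<bar> \<le> (B1 + B2 + B3) * (\<bar>a1 - b1\<bar> + \<bar>a2 - b2\<bar> + \<bar>a3 - b3\<bar>)"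
      unfolding eq distrib_left by (intro abs_sum3_le)
  qed
  then show ?thesis ..
qed

section \<open>Composition of nonlinearities with functions in H^1_0\<close>

lemma has_derivative_imp_continuous_UNIV:
  assumes "\<And>z. (f has_derivative f' z) (at z)"
  shows "continuous_on UNIV f"
  by (intro continuous_at_imp_continuous_on ballI has_derivative_continuous[OF assms])

lemma compose3_measurable:
  fixes f :: "real \<times> real \<times> real \<Rightarrow> real"
  assumes f: "continuous_on UNIV f"
    and u: "u1 \<in> borel_measurable M" "u2 \<in> borel_measurable M" "u3 \<in> borel_measurable M"
  shows "(\<lambda>x. f (u1 x, u2 x, u3 x)) \<in> borel_measurable M"
proof -
  have "(\<lambda>x. (u1 x, u2 x, u3 x)) \<in> borel_measurable M"
    using u by (intro borel_measurable_Pair)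
  from measurable_compose[OF this borel_measurable_continuous_onI[OF f]] show ?thesis .
qed

lemma compose3_bounded:
  fixes f :: "real \<times> real \<times> real \<Rightarrow> real"
  assumes f: "continuous_on UNIV f"
    and u: "u1 \<in> borel_measurable (mu L)" "u2 \<in> borel_measurable (mu L)" "u3 \<in> borel_measurable (mu L)"
    and b: "\<And>x. x \<in> {0..L} \<Longrightarrow> \<bar>u1 x\<bar> \<le> R" "\<And>x. x \<in> {0..L} \<Longrightarrow> \<bar>u2 x\<bar> \<le> R" "\<And>x. x \<in> {0..L} \<Longrightarrow> \<bar>u3 x\<bar> \<le> R"
  shows "l2 L (\<lambda>x. f (u1 x, u2 x, u3 x))"
proof -
  obtain B where "0 \<le> B" and B: "\<And>a1 a2 a3. \<bar>a1\<bar> \<le> R \<Longrightarrow> \<bar>a2\<bar> \<le> R \<Longrightarrow> \<bar>a3\<bar> \<le> R \<Longrightarrow> \<bar>f (a1, a2, a3)\<bar> \<le> B"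
    using bounded_on_box[OF f, of R] by blast
  show ?thesis
    using compose3_measurable[OF f u] by (rule l2_bounded) (use B b in blast)
qed

lemma compose3_h10:
  fixes f :: "real \<times> real \<times> real \<Rightarrow> real"
  assumes f: "continuous_on UNIV f" and L: "0 \<le> L" and u: "h10 L u1" "h10 L u2" "h10 L u3"
  shows "l2 L (\<lambda>x. f (u1 x, u2 x, u3 x))"
proof (rule compose3_bounded[OF f])
  let ?R = "sqrt L * nrm L (dx L u1) + sqrt L * nrm L (dx L u2) + sqrt L * nrm L (dx L u3)"
  have n: "0 \<le> sqrt L * nrm L v" for v using L by simp
  fix x assume x: "x \<in> {0..L}"
  show "\<bar>u1 x\<bar> \<le> ?R" "\<bar>u2 x\<bar> \<le> ?R" "\<bar>u3 x\<bar> \<le> ?R"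
    using h10_bound[OF L u(1) x] h10_bound[OF L u(2) x] h10_bound[OF L u(3) x]
      n[of "dx L u1"] n[of "dx L u2"] n[of "dx L u3"] by linarith+
qed (use u h10_measurable in auto)

lemma nrm_compose3_diff:
  fixes f :: "real \<times> real \<times> real \<Rightarrow> real"
  assumes f: "continuous_on UNIV f" and K: "box_lipschitz f R K" and L: "0 \<le> L"
    and u: "h10 L u1" "h10 L u2" "h10 L u3" and v: "h10 L v1" "h10 L v2" "h10 L v3"
    and bu: "\<And>x. x \<in> {0..L} \<Longrightarrow> \<bar>u1 x\<bar> \<le> R \<and> \<bar>u2 x\<bar> \<le> R \<and> \<bar>u3 x\<bar> \<le> R"
    and bv: "\<And>x. x \<in> {0..L} \<Longrightarrow> \<bar>v1 x\<bar> \<le> R \<and> \<bar>v2 x\<bar> \<le> R \<and> \<bar>v3 x\<bar> \<le> R"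
  shows "nrm L (\<lambda>x. f (u1 x, u2 x, u3 x) - f (v1 x, v2 x, v3 x))
    \<le> K * (nrm L (\<lambda>x. u1 x - v1 x) + nrm L (\<lambda>x. u2 x - v2 x) + nrm L (\<lambda>x. u3 x - v3 x))"
proof -
  have K0: "0 \<le> K" using K by (simp add: box_lipschitz_def)
  have l: "l2 L (\<lambda>x. u1 x - v1 x)" "l2 L (\<lambda>x. u2 x - v2 x)" "l2 L (\<lambda>x. u3 x - v3 x)"
    using u v h10_l2 by (auto intro!: l2_diff)
  have abs: "l2 L (\<lambda>x. \<bar>w x\<bar>)" "nrm L (\<lambda>x. \<bar>w x\<bar>) = nrm L w" if "l2 L w" for w
  proof -
    show "l2 L (\<lambda>x. \<bar>w x\<bar>)" using that by (auto simp: l2_iff)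
    show "nrm L (\<lambda>x. \<bar>w x\<bar>) = nrm L w" by (simp add: nrm_def ip_eq flip: abs_mult)
  qed
  let ?s = "\<lambda>x. \<bar>u1 x - v1 x\<bar> + \<bar>u2 x - v2 x\<bar> + \<bar>u3 x - v3 x\<bar>"
  have s: "l2 L ?s" by (intro l2_add abs l)
  have "nrm L (\<lambda>x. f (u1 x, u2 x, u3 x) - f (v1 x, v2 x, v3 x)) \<le> nrm L (\<lambda>x. K * ?s x)"
  proof (rule nrm_mono)
    show "l2 L (\<lambda>x. f (u1 x, u2 x, u3 x) - f (v1 x, v2 x, v3 x))"
      by (intro l2_diff compose3_h10 f L u v)
    show "l2 L (\<lambda>x. K * ?s x)" by (intro l2_cmult s)
    fix x assume x: "x \<in> {0..L}"
    have "\<bar>f (u1 x, u2 x, u3 x) - f (v1 x, v2 x, v3 x)\<bar> \<le> K * ?s x"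
      using bu[OF x] bv[OF x] by (intro box_lipschitzD[OF K]) auto
    then show "\<bar>f (u1 x, u2 x, u3 x) - f (v1 x, v2 x, v3 x)\<bar> \<le> \<bar>K * ?s x\<bar>" by linarith
  qed
  also have "\<dots> = K * nrm L ?s" using K0 nrm_cmult[of L K ?s] by simp
  also have "nrm L ?s \<le> nrm L (\<lambda>x. \<bar>u1 x - v1 x\<bar> + \<bar>u2 x - v2 x\<bar>) + nrm L (\<lambda>x. \<bar>u3 x - v3 x\<bar>)"
    by (intro nrm_triangle l2_add abs l)
  also have "nrm L (\<lambda>x. \<bar>u1 x - v1 x\<bar> + \<bar>u2 x - v2 x\<bar>) \<le> nrm L (\<lambda>x. \<bar>u1 x - v1 x\<bar>) + nrm L (\<lambda>x. \<bar>u2 x - v2 x\<bar>)"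
    by (intro nrm_triangle abs l)
  finally show ?thesis using K0 by (simp add: abs l mult_left_mono)
qed

lemma h1_curve_bounded:
  assumes L: "0 \<le> L" and u: "h1_curve L u"
  shows "\<exists>R. \<forall>t\<in>{0..T}. \<forall>x\<in>{0..L}. \<bar>u t x\<bar> \<le> R"
proof -
  obtain B where B: "\<And>t. t \<in> {0..T} \<Longrightarrow> nrm L (dx L (u t)) \<le> B"
    using l2_curve_bounded[OF h1_curve_dx[OF u]] by blast
  have "\<bar>u t x\<bar> \<le> sqrt L * B" if "t \<in> {0..T}" "x \<in> {0..L}" for t x
    using h10_bound[OF L h1_curve_h10[OF u], of t x] that mult_left_mono[OF B[OF that(1)], of "sqrt L"] L
    by auto
  then show ?thesis by blast
qed

lemma h1_curves_bounded:
  assumes L: "0 \<le> L" and u: "h1_curve L u1" "h1_curve L u2" "h1_curve L u3"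
  shows "\<exists>R. \<forall>t\<in>{0..T}. \<forall>x\<in>{0..L}. \<bar>u1 t x\<bar> \<le> R \<and> \<bar>u2 t x\<bar> \<le> R \<and> \<bar>u3 t x\<bar> \<le> R"
proof -
  obtain R1 where R1: "\<forall>t\<in>{0..T}. \<forall>x\<in>{0..L}. \<bar>u1 t x\<bar> \<le> R1"
    using h1_curve_bounded[OF L u(1)] by blast
  obtain R2 where R2: "\<forall>t\<in>{0..T}. \<forall>x\<in>{0..L}. \<bar>u2 t x\<bar> \<le> R2"
    using h1_curve_bounded[OF L u(2)] by blast
  obtain R3 where R3: "\<forall>t\<in>{0..T}. \<forall>x\<in>{0..L}. \<bar>u3 t x\<bar> \<le> R3"
    using h1_curve_bounded[OF L u(3)] by blast
  have "\<bar>u1 t x\<bar> \<le> max R1 (max R2 R3) \<and> \<bar>u2 t x\<bar> \<le> max R1 (max R2 R3) \<and> \<bar>u3 t x\<bar> \<le> max R1 (max R2 R3)"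
    if "t \<in> {0..T}" "x \<in> {0..L}" for t x
    using R1[rule_format, OF that] R2[rule_format, OF that] R3[rule_format, OF that]
    by (simp add: le_max_iff_disj)
  then show ?thesis by blast
qed

text \<open>Continuity at t concerns only times within distance 1, and on [0, t+1] all values lie in
  one box, so a single Lipschitz constant applies.\<close>

lemma compose3_curve:
  fixes f :: "real \<times> real \<times> real \<Rightarrow> real"
  assumes f: "continuous_on UNIV f" and K: "\<And>R. \<exists>K. box_lipschitz f R K" and L: "0 \<le> L"
    and u: "h1_curve L u1" "h1_curve L u2" "h1_curve L u3"
  shows "l2_curve L (\<lambda>t x. f (u1 t x, u2 t x, u3 t x))"
  unfolding l2_curve_def
proof (intro conjI allI impI)
  fix t :: real assume t: "0 \<le> t"
  show "l2 L (\<lambda>x. f (u1 t x, u2 t x, u3 t x))"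
    using t by (intro compose3_h10 f L h1_curve_h10 u)
  obtain R where R: "\<And>s x. s \<in> {0..t+1} \<Longrightarrow> x \<in> {0..L} \<Longrightarrow> \<bar>u1 s x\<bar> \<le> R \<and> \<bar>u2 s x\<bar> \<le> R \<and> \<bar>u3 s x\<bar> \<le> R"
    using h1_curves_bounded[OF L u, of "t+1"] by blast
  obtain K where K: "box_lipschitz f R K" using K by blast
  define d where "d = (\<lambda>s. K * (nrm L (\<lambda>x. u1 s x - u1 t x) + nrm L (\<lambda>x. u2 s x - u2 t x) + nrm L (\<lambda>x. u3 s x - u3 t x)))"
  have "(d \<longlongrightarrow> K * (0 + 0 + 0)) (at t within {0..})"
    unfolding d_def using u by (intro tendsto_intros l2_curve_tendsto h1_curve_l2_curve L t)
  then have d: "(d \<longlongrightarrow> 0) (at t within {0..})" by simp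
  have "\<forall>\<^sub>F s in at t within {0..}. norm (nrm L (\<lambda>x. f (u1 s x, u2 s x, u3 s x) - f (u1 t x, u2 t x, u3 t x))) \<le> d s"
    unfolding eventually_at
  proof (intro exI[of _ 1] conjI ballI impI)
    fix s :: real assume s: "s \<in> {0..}" "s \<noteq> t \<and> dist s t < 1"
    then have "s \<in> {0..t+1}" "t \<in> {0..t+1}" using t by (auto simp: dist_real_def)
    then show "norm (nrm L (\<lambda>x. f (u1 s x, u2 s x, u3 s x) - f (u1 t x, u2 t x, u3 t x))) \<le> d s"
      unfolding d_def using R t s
      by (simp, intro nrm_compose3_diff[OF f K L]) (auto intro: h1_curve_h10 u)
  qed simp
  then show "((\<lambda>s. nrm L (\<lambda>x. f (u1 s x, u2 s x, u3 s x) - f (u1 t x, u2 t x, u3 t x))) \<longlongrightarrow> 0) (at t within {0..})"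
    by (rule Lim_null_comparison) (rule d)
qed

text \<open>An error of order (s - t)^2 vanishes in the difference quotient. The window of length 1
  matches the interval [0, t+1] on which uniform bounds are available.\<close>

lemma deriv_quadratic_perturbation:
  fixes f g :: "real \<Rightarrow> real"
  assumes g: "(g has_real_derivative D) (at t within {0..})"
    and b: "\<And>s. 0 \<le> s \<Longrightarrow> \<bar>s - t\<bar> < 1 \<Longrightarrow> \<bar>(f s - f t) - (g s - g t)\<bar> \<le> C * (s - t)\<^sup>2"
  shows "(f has_real_derivative D) (at t within {0..})"
proof -
  have "((\<lambda>s. (f s - f t) / (s - t) - (g s - g t) / (s - t)) \<longlongrightarrow> 0) (at t within {0..})"
  proof (rule Lim_null_comparison)
    show "\<forall>\<^sub>F s in at t within {0..}. norm ((f s - f t) / (s - t) - (g s - g t) / (s - t)) \<le> C * \<bar>s - t\<bar>"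
      unfolding eventually_at
    proof (intro exI[of _ 1] conjI ballI impI)
      fix s :: real assume s: "s \<in> {0..}" "s \<noteq> t \<and> dist s t < 1"
      have "norm ((f s - f t) / (s - t) - (g s - g t) / (s - t)) = \<bar>(f s - f t) - (g s - g t)\<bar> / \<bar>s - t\<bar>"
        by (simp add: abs_divide flip: diff_divide_distrib)
      also have "\<dots> \<le> C * (s - t)\<^sup>2 / \<bar>s - t\<bar>"
        using s by (intro divide_right_mono b) (auto simp: dist_real_def)
      also have "\<dots> = C * \<bar>s - t\<bar>"
      proof -
        have "(s - t)\<^sup>2 = \<bar>s - t\<bar> * \<bar>s - t\<bar>" by (simp add: power2_eq_square)
        moreover have "\<bar>s - t\<bar> \<noteq> 0" using s by simp
        ultimately show ?thesis
          by (simp only: mult.assoc[symmetric] nonzero_mult_div_cancel_right not_False_eq_True)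
      qed
      finally show "norm ((f s - f t) / (s - t) - (g s - g t) / (s - t)) \<le> C * \<bar>s - t\<bar>" .
    qed simp
    have "((\<lambda>s. C * \<bar>s - t\<bar>) \<longlongrightarrow> C * \<bar>t - t\<bar>) (at t within {0..})"
      by (intro tendsto_intros)
    then show "((\<lambda>s. C * \<bar>s - t\<bar>) \<longlongrightarrow> 0) (at t within {0..})" by simp
  qed
  from tendsto_add[OF this g[unfolded has_field_derivative_iff]]
  show ?thesis by (simp add: has_field_derivative_iff)
qed

lemma sum_three_square_le: "(a + b + c)\<^sup>2 \<le> 3 * (a\<^sup>2 + b\<^sup>2 + c\<^sup>2)" for a b c :: real
proof -
  have "0 \<le> (a - b)\<^sup>2 + (b - c)\<^sup>2 + (a - c)\<^sup>2" by simp
  then show ?thesis by (simp add: power2_eq_square algebra_simps)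
qed

text \<open>The potential is differentiable although \<open>u\<close> is differentiable in time only in \<open>L\<^sup>2\<close>: the
  second-order Taylor remainder is controlled by \<open>\<parallel>u s - u t\<parallel>\<^sup>2 \<le> B\<^sup>2 (s - t)\<^sup>2\<close>.\<close>

lemma potential_derivative:
  fixes F f1 f2 f3 :: "real \<times> real \<times> real \<Rightarrow> real"
  assumes L: "0 \<le> L"
    and F: "\<And>z. (F has_derivative (\<lambda>h. f1 z * fst h + f2 z * fst (snd h) + f3 z * snd (snd h))) (at z)"
    and cont: "continuous_on UNIV f1" "continuous_on UNIV f2" "continuous_on UNIV f3"
    and lip: "\<And>R. \<exists>K. box_lipschitz f1 R K" "\<And>R. \<exists>K. box_lipschitz f2 R K" "\<And>R. \<exists>K. box_lipschitz f3 R K"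
    and u: "h1_curve L u1" "h1_curve L u2" "h1_curve L u3"
    and v: "l2_curve L v1" "l2_curve L v2" "l2_curve L v3"
    and d: "\<And>h t. l2 L h \<Longrightarrow> 0 \<le> t \<Longrightarrow> ((\<lambda>t. ip L (u1 t) h) has_real_derivative ip L (v1 t) h) (at t within {0..})"
      "\<And>h t. l2 L h \<Longrightarrow> 0 \<le> t \<Longrightarrow> ((\<lambda>t. ip L (u2 t) h) has_real_derivative ip L (v2 t) h) (at t within {0..})"
      "\<And>h t. l2 L h \<Longrightarrow> 0 \<le> t \<Longrightarrow> ((\<lambda>t. ip L (u3 t) h) has_real_derivative ip L (v3 t) h) (at t within {0..})"
    and t: "0 \<le> t"
  shows "((\<lambda>t. LINT x|mu L. F (u1 t x, u2 t x, u3 t x)) has_real_derivative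
      ip L (v1 t) (\<lambda>x. f1 (u1 t x, u2 t x, u3 t x)) + ip L (v2 t) (\<lambda>x. f2 (u1 t x, u2 t x, u3 t x))
      + ip L (v3 t) (\<lambda>x. f3 (u1 t x, u2 t x, u3 t x))) (at t within {0..})"
proof -
  note Fc = has_derivative_imp_continuous_UNIV[OF F]
  obtain R where R: "\<And>s x. s \<in> {0..t+1} \<Longrightarrow> x \<in> {0..L} \<Longrightarrow> \<bar>u1 s x\<bar> \<le> R \<and> \<bar>u2 s x\<bar> \<le> R \<and> \<bar>u3 s x\<bar> \<le> R"
    using h1_curves_bounded[OF L u, of "t+1"] by blast
  obtain K1 K2 K3 where K: "box_lipschitz f1 R K1" "box_lipschitz f2 R K2" "box_lipschitz f3 R K3"
    using lip by meson
  define K where "K = K1 + K2 + K3"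
  have K0: "0 \<le> K1" "0 \<le> K2" "0 \<le> K3" using K by (auto simp: box_lipschitz_def)
  have kK: "K1 \<le> K" "K2 \<le> K" "K3 \<le> K" using K0 by (auto simp: K_def)
  have K3: "0 \<le> 3 * K" using K0 by (simp add: K_def)
  \<comment> \<open>The mean value theorem moves the source values to a point no farther from b than
    a, so the remainder is at most \<open>K * S\<^sup>2\<close> with S the sum of the coordinate
    distances; the 3 comes from \<open>sum_three_square_le\<close>.\<close>
  have taylor: "\<bar>F (a1, a2, a3) - F (b1, b2, b3) - (f1 (b1, b2, b3) * (a1 - b1) + f2 (b1, b2, b3) * (a2 - b2) + f3 (b1, b2, b3) * (a3 - b3))\<bar>
      \<le> 3 * K * ((a1 - b1)\<^sup>2 + (a2 - b2)\<^sup>2 + (a3 - b3)\<^sup>2)"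
    if a: "\<bar>a1\<bar> \<le> R" "\<bar>a2\<bar> \<le> R" "\<bar>a3\<bar> \<le> R" and b: "\<bar>b1\<bar> \<le> R" "\<bar>b2\<bar> \<le> R" "\<bar>b3\<bar> \<le> R" for a1 a2 a3 b1 b2 b3
  proof -
    define S where "S = \<bar>a1 - b1\<bar> + \<bar>a2 - b2\<bar> + \<bar>a3 - b3\<bar>"
    from mvt_segment[OF F a b] obtain c1 c2 c3 where c: "\<bar>c1\<bar> \<le> R" "\<bar>c2\<bar> \<le> R" "\<bar>c3\<bar> \<le> R"
      and n: "\<bar>c1 - b1\<bar> \<le> \<bar>a1 - b1\<bar>" "\<bar>c2 - b2\<bar> \<le> \<bar>a2 - b2\<bar>" "\<bar>c3 - b3\<bar> \<le> \<bar>a3 - b3\<bar>"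
      and eq: "F (a1, a2, a3) - F (b1, b2, b3)
        = f1 (c1, c2, c3) * (a1 - b1) + f2 (c1, c2, c3) * (a2 - b2) + f3 (c1, c2, c3) * (a3 - b3)" by blast
    have one: "\<bar>(f (c1, c2, c3) - f (b1, b2, b3)) * y\<bar> \<le> K * S * \<bar>y\<bar>"
      if k: "box_lipschitz f R k" "k \<le> K" "0 \<le> k" for f k y
    proof -
      have "\<bar>f (c1, c2, c3) - f (b1, b2, b3)\<bar> \<le> k * (\<bar>c1 - b1\<bar> + \<bar>c2 - b2\<bar> + \<bar>c3 - b3\<bar>)"
        by (rule box_lipschitzD[OF k(1) c b])
      also have "\<dots> \<le> K * S" unfolding S_def using n k by (intro mult_mono) auto
      finally show ?thesis unfolding abs_mult by (rule mult_right_mono) simp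
    qed
    have "F (a1, a2, a3) - F (b1, b2, b3) - (f1 (b1, b2, b3) * (a1 - b1) + f2 (b1, b2, b3) * (a2 - b2) + f3 (b1, b2, b3) * (a3 - b3))
      = (f1 (c1, c2, c3) - f1 (b1, b2, b3)) * (a1 - b1) + (f2 (c1, c2, c3) - f2 (b1, b2, b3)) * (a2 - b2)
        + (f3 (c1, c2, c3) - f3 (b1, b2, b3)) * (a3 - b3)"
      unfolding eq by (simp add: algebra_simps)
    also have "\<bar>\<dots>\<bar> \<le> K * S * \<bar>a1 - b1\<bar> + K * S * \<bar>a2 - b2\<bar> + K * S * \<bar>a3 - b3\<bar>"
      by (intro abs_sum3_le one[OF K(1) kK(1) K0(1)] one[OF K(2) kK(2) K0(2)] one[OF K(3) kK(3) K0(3)])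
    also have "\<dots> = K * S * S" unfolding S_def by (simp only: distrib_left)
    also have "\<dots> = K * S\<^sup>2" by (simp only: power2_eq_square mult.assoc)
    also have "\<dots> \<le> K * (3 * ((a1 - b1)\<^sup>2 + (a2 - b2)\<^sup>2 + (a3 - b3)\<^sup>2))"
    proof (rule mult_left_mono)
      have "S\<^sup>2 \<le> 3 * (\<bar>a1 - b1\<bar>\<^sup>2 + \<bar>a2 - b2\<bar>\<^sup>2 + \<bar>a3 - b3\<bar>\<^sup>2)"
        unfolding S_def by (rule sum_three_square_le)
      then show "S\<^sup>2 \<le> 3 * ((a1 - b1)\<^sup>2 + (a2 - b2)\<^sup>2 + (a3 - b3)\<^sup>2)" by simp
    qed (use K0 K_def in simp)
    finally show ?thesis by (simp only: mult.assoc mult.left_commute)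
  qed
  obtain B1 where B1: "\<And>s. s \<in> {0..t+1} \<Longrightarrow> nrm L (v1 s) \<le> B1" using l2_curve_bounded[OF v(1)] by blast
  obtain B2 where B2: "\<And>s. s \<in> {0..t+1} \<Longrightarrow> nrm L (v2 s) \<le> B2" using l2_curve_bounded[OF v(2)] by blast
  obtain B3 where B3: "\<And>s. s \<in> {0..t+1} \<Longrightarrow> nrm L (v3 s) \<le> B3" using l2_curve_bounded[OF v(3)] by blast
  have lipt: "(nrm L (\<lambda>x. u s x - u t x))\<^sup>2 \<le> B\<^sup>2 * (s - t)\<^sup>2"
    if v: "l2_curve L v" and u: "h1_curve L u" and B: "\<And>s. s \<in> {0..t+1} \<Longrightarrow> nrm L (v s) \<le> B"
      and d: "\<And>h t. l2 L h \<Longrightarrow> 0 \<le> t \<Longrightarrow> ((\<lambda>t. ip L (u t) h) has_real_derivative ip L (v t) h) (at t within {0..})"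
      and s: "0 \<le> s" "\<bar>s - t\<bar> < 1" for u v B s
  proof -
    note lip = weak_derivative_lipschitz[where T="t + 1", OF v h1_curve_l2_curve[OF L u] d B]
    have "nrm L (\<lambda>x. u s x - u t x) \<le> B * \<bar>s - t\<bar>"
    proof (cases "s \<le> t")
      case True
      then show ?thesis using lip[where s=s and t=t] s nrm_minus_commute[of L "u s" "u t"] by simp
    next
      case False
      then show ?thesis using lip[where s=t and t=s] s t by simp
    qed
    from power_mono[OF this nrm_nonneg, of 2] show ?thesis by (simp add: power_mult_distrib)
  qed
  let ?f = "\<lambda>f x. f (u1 t x, u2 t x, u3 t x)"
  have fl: "l2 L (?f f1)" "l2 L (?f f2)" "l2 L (?f f3)"
    using t by (auto intro!: compose3_h10 cont L h1_curve_h10 u)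
  \<comment> \<open>Linearisation of the potential with the sources frozen at time t. Since they are
    then fixed test functions, the weak derivative of u differentiates it.\<close>
  define g where "g = (\<lambda>s. ip L (u1 s) (?f f1) + ip L (u2 s) (?f f2) + ip L (u3 s) (?f f3))"
  show ?thesis
  proof (rule deriv_quadratic_perturbation[where g=g and C="3 * K * (B1\<^sup>2 + B2\<^sup>2 + B3\<^sup>2)"])
    show "(g has_real_derivative ip L (v1 t) (?f f1) + ip L (v2 t) (?f f2) + ip L (v3 t) (?f f3)) (at t within {0..})"
      unfolding g_def by (intro DERIV_add d fl t)
    fix s :: real assume s: "0 \<le> s" "\<bar>s - t\<bar> < 1"
    have l: "l2 L (u1 r)" "l2 L (u2 r)" "l2 L (u3 r)" if "0 \<le> r" for r
      using that u by (auto intro!: h10_l2 h1_curve_h10)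
    have Fi: "integrable (mu L) (\<lambda>x. F (u1 r x, u2 r x, u3 r x))" if "0 \<le> r" for r
      using that by (intro l2_integrable compose3_h10 Fc L h1_curve_h10 u)
    have dl: "l2 L (\<lambda>x. u1 s x - u1 t x)" "l2 L (\<lambda>x. u2 s x - u2 t x)" "l2 L (\<lambda>x. u3 s x - u3 t x)"
      using l[OF s(1)] l[OF t] by (auto intro!: l2_diff)
    note ii = l2_mult_integrable[OF dl(1) fl(1)] l2_mult_integrable[OF dl(2) fl(2)] l2_mult_integrable[OF dl(3) fl(3)]
    note jj = l2_mult_integrable[OF dl(1) dl(1)] l2_mult_integrable[OF dl(2) dl(2)] l2_mult_integrable[OF dl(3) dl(3)]
    let ?D = "\<lambda>x. F (u1 s x, u2 s x, u3 s x) - F (u1 t x, u2 t x, u3 t x)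
        - ((u1 s x - u1 t x) * ?f f1 x + (u2 s x - u2 t x) * ?f f2 x + (u3 s x - u3 t x) * ?f f3 x)"
    let ?E = "\<lambda>x. 3 * K * ((u1 s x - u1 t x) * (u1 s x - u1 t x) + (u2 s x - u2 t x) * (u2 s x - u2 t x)
        + (u3 s x - u3 t x) * (u3 s x - u3 t x))"
    have gd: "g s - g t = ip L (\<lambda>x. u1 s x - u1 t x) (?f f1) + ip L (\<lambda>x. u2 s x - u2 t x) (?f f2) + ip L (\<lambda>x. u3 s x - u3 t x) (?f f3)"
      unfolding g_def using l[OF s(1)] l[OF t] fl by (simp add: ip_diff_left)
    have eq: "(LINT x|mu L. F (u1 s x, u2 s x, u3 s x)) - (LINT x|mu L. F (u1 t x, u2 t x, u3 t x)) - (g s - g t) = (LINT x|mu L. ?D x)"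
      unfolding gd ip_eq using Fi[OF s(1)] Fi[OF t] ii by simp
    have "\<bar>LINT x|mu L. ?D x\<bar> \<le> (LINT x|mu L. ?E x)"
      unfolding real_norm_def[symmetric]
    proof (rule Bochner_Integration.integral_norm_bound_integral)
      show "integrable (mu L) ?D" using Fi[OF s(1)] Fi[OF t] ii by simp
      show "integrable (mu L) ?E" using jj by simp
      fix x assume "x \<in> space (mu L)"
      then have x: "x \<in> {0..L}" by simp
      have st: "s \<in> {0..t+1}" "t \<in> {0..t+1}" using s t by auto
      have "\<bar>?D x\<bar> \<le> 3 * K * ((u1 s x - u1 t x)\<^sup>2 + (u2 s x - u2 t x)\<^sup>2 + (u3 s x - u3 t x)\<^sup>2)"
        using taylor[of "u1 s x" "u2 s x" "u3 s x" "u1 t x" "u2 t x" "u3 t x"] R[OF st(1) x] R[OF st(2) x]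
        by (simp only: mult.commute)
      then show "norm (?D x) \<le> ?E x" by (simp only: power2_eq_square real_norm_def)
    qed
    also have "\<dots> = 3 * K * ((nrm L (\<lambda>x. u1 s x - u1 t x))\<^sup>2 + (nrm L (\<lambda>x. u2 s x - u2 t x))\<^sup>2 + (nrm L (\<lambda>x. u3 s x - u3 t x))\<^sup>2)"
      unfolding nrm_square ip_eq using jj
      by (simp only: integral_mult_right_zero Bochner_Integration.integral_add Bochner_Integration.integrable_add)
    also have "\<dots> \<le> 3 * K * (B1\<^sup>2 * (s - t)\<^sup>2 + B2\<^sup>2 * (s - t)\<^sup>2 + B3\<^sup>2 * (s - t)\<^sup>2)"
      by (intro mult_left_mono add_mono lipt[OF v(1) u(1) B1 d(1) s] lipt[OF v(2) u(2) B2 d(2) s]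
          lipt[OF v(3) u(3) B3 d(3) s] K3)
    also have "\<dots> = 3 * K * (B1\<^sup>2 + B2\<^sup>2 + B3\<^sup>2) * (s - t)\<^sup>2"
      by (simp only: mult.assoc distrib_right)
    finally show "\<bar>(LINT x|mu L. F (u1 s x, u2 s x, u3 s x)) - (LINT x|mu L. F (u1 t x, u2 t x, u3 t x)) - (g s - g t)\<bar>
        \<le> 3 * K * (B1\<^sup>2 + B2\<^sup>2 + B3\<^sup>2) * (s - t)\<^sup>2" unfolding eq .
  qed
qed

section \<open>Energy identities for the Bresse system\<close>

text \<open>The elastic form a is an arbitrary symmetric two-time form, so the same result covers
  the Bresse system and, with a vanishing third component, the difference between Bresse and
  Timoshenko solutions. The r's are the inertia weights.\<close>

lemma wave_energy:
  assumes u: "l2_curve L u1" "l2_curve L u2" "l2_curve L u3"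
    and v: "l2_curve L v1" "l2_curve L v2" "l2_curve L v3"
    and q: "l2_curve L q1" "l2_curve L q2" "l2_curve L q3"
    and du: "\<And>h t. l2 L h \<Longrightarrow> 0 \<le> t \<Longrightarrow> ((\<lambda>t. ip L (u1 t) h) has_real_derivative ip L (v1 t) h) (at t within {0..})"
      "\<And>h t. l2 L h \<Longrightarrow> 0 \<le> t \<Longrightarrow> ((\<lambda>t. ip L (u2 t) h) has_real_derivative ip L (v2 t) h) (at t within {0..})"
      "\<And>h t. l2 L h \<Longrightarrow> 0 \<le> t \<Longrightarrow> ((\<lambda>t. ip L (u3 t) h) has_real_derivative ip L (v3 t) h) (at t within {0..})"
    and Ns: "\<And>s r. 0 \<le> s \<Longrightarrow> 0 \<le> r \<Longrightarrow>
      ((\<lambda>s. r1 * ip L (v1 s) (u1 r) + r2 * ip L (v2 s) (u2 r) + r3 * ip L (v3 s) (u3 r)) has_real_derivative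
        - a s r + (ip L (q1 s) (u1 r) + ip L (q2 s) (u2 r) + ip L (q3 s) (u3 r))) (at s within {0..})"
    and sym: "\<And>s r. 0 \<le> s \<Longrightarrow> 0 \<le> r \<Longrightarrow> a s r = a r s"
    and T: "0 \<le> T"
  shows wave_energy_identity: "((\<lambda>t. r1 * (nrm L (v1 t))\<^sup>2 + r2 * (nrm L (v2 t))\<^sup>2 + r3 * (nrm L (v3 t))\<^sup>2 + a t t)
      has_real_derivative 2 * (ip L (q1 T) (v1 T) + ip L (q2 T) (v2 T) + ip L (q3 T) (v3 T))) (at T within {0..})"
    and wave_cross_derivative: "((\<lambda>t. r1 * ip L (v1 t) (u1 t) + r2 * ip L (v2 t) (u2 t) + r3 * ip L (v3 t) (u3 t))
      has_real_derivative r1 * (nrm L (v1 T))\<^sup>2 + r2 * (nrm L (v2 T))\<^sup>2 + r3 * (nrm L (v3 T))\<^sup>2 - a T T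
        + (ip L (q1 T) (u1 T) + ip L (q2 T) (u2 T) + ip L (q3 T) (u3 T))) (at T within {0..})"
proof -
  have du': "((\<lambda>t. ip L h (u1 t)) has_real_derivative ip L h (v1 t)) (at t within {0..})"
    "((\<lambda>t. ip L h (u2 t)) has_real_derivative ip L h (v2 t)) (at t within {0..})"
    "((\<lambda>t. ip L h (u3 t)) has_real_derivative ip L h (v3 t)) (at t within {0..})"
    if "l2 L h" "0 \<le> t" for h t
    using du[OF that] by (simp_all only: ip_commute[of L h])
  define N where "N = (\<lambda>s r. r1 * ip L (v1 s) (u1 r) + r2 * ip L (v2 s) (u2 r) + r3 * ip L (v3 s) (u3 r))"
  define p where "p = (\<lambda>s r. r1 * ip L (v1 s) (v1 r) + r2 * ip L (v2 s) (v2 r) + r3 * ip L (v3 s) (v3 r))"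
  define Q where "Q = (\<lambda>s r. ip L (q1 s) (u1 r) + ip L (q2 s) (u2 r) + ip L (q3 s) (u3 r))"
  define \<kappa> where "\<kappa> = (\<lambda>s r. ip L (q1 s) (v1 r) + ip L (q2 s) (v2 r) + ip L (q3 s) (v3 r))"
  have Ns': "((\<lambda>s. N s r) has_real_derivative - a s r + Q s r) (at s within {0..})" if "0 \<le> s" "0 \<le> r" for s r
    using Ns[OF that] by (simp add: N_def Q_def)
  have Nr: "(N s has_real_derivative p s r) (at r within {0..})" if "0 \<le> s" "0 \<le> r" for s r
    unfolding N_def p_def using that
    by (intro DERIV_add DERIV_cmult du' l2_curve_l2[OF v(1)] l2_curve_l2[OF v(2)] l2_curve_l2[OF v(3)])
  have Qr: "(Q s has_real_derivative \<kappa> s r) (at r within {0..})" if "0 \<le> s" "0 \<le> r" for s r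
    unfolding Q_def \<kappa>_def using that
    by (intro DERIV_add du' l2_curve_l2[OF q(1)] l2_curve_l2[OF q(2)] l2_curve_l2[OF q(3)])
  note c = ip_continuous_two_time[unfolded case_prod_beta]
  have cp: "continuous_on ({0..} \<times> {0..}) (\<lambda>(s, r). p s r)"
    unfolding p_def case_prod_beta by (intro continuous_on_add continuous_on_mult continuous_on_const c v)
  have cQ: "continuous_on ({0..} \<times> {0..}) (\<lambda>(s, r). Q s r)"
    unfolding Q_def case_prod_beta by (intro continuous_on_add c q u)
  have c\<kappa>: "continuous_on ({0..} \<times> {0..}) (\<lambda>(s, r). \<kappa> s r)"
    unfolding \<kappa>_def case_prod_beta by (intro continuous_on_add c q v)
  have psym: "p s r = p r s" for s r
    unfolding p_def by (simp add: ip_commute[of L "v1 s"] ip_commute[of L "v2 s"] ip_commute[of L "v3 s"])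
  have "((\<lambda>t. p t t + a t t) has_real_derivative 2 * \<kappa> T T) (at T within {0..})"
    by (rule two_time_energy[OF Ns' Nr Qr psym sym cp cQ c\<kappa> T])
  then show "((\<lambda>t. r1 * (nrm L (v1 t))\<^sup>2 + r2 * (nrm L (v2 t))\<^sup>2 + r3 * (nrm L (v3 t))\<^sup>2 + a t t)
      has_real_derivative 2 * (ip L (q1 T) (v1 T) + ip L (q2 T) (v2 T) + ip L (q3 T) (v3 T))) (at T within {0..})"
    by (simp only: p_def \<kappa>_def nrm_square)
  \<comment> \<open>Both shifts are zero here: this is the derivative of N along the
    diagonal.\<close>
  have "((\<lambda>s. N (s + 0) (s + 0)) has_real_derivative (- a (T + 0) (T + 0) + Q (T + 0) (T + 0)) + p (T + 0) (T + 0)) (at T within {0..})"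
    by (rule chain_two_time[OF Ns' Nr cp]) (use T in auto)
  then show "((\<lambda>t. r1 * ip L (v1 t) (u1 t) + r2 * ip L (v2 t) (u2 t) + r3 * ip L (v3 t) (u3 t))
      has_real_derivative r1 * (nrm L (v1 T))\<^sup>2 + r2 * (nrm L (v2 T))\<^sup>2 + r3 * (nrm L (v3 T))\<^sup>2 - a T T
        + (ip L (q1 T) (u1 T) + ip L (q2 T) (u2 T) + ip L (q3 T) (u3 T))) (at T within {0..})"
    by (simp add: N_def p_def Q_def nrm_square algebra_simps)
qed

section \<open>From the product-space distance to curves of components\<close>

lemma nH6_ge:
  "nrm L (dx L (c1 U)) \<le> nH6 L U" "nrm L (dx L (c2 U)) \<le> nH6 L U" "nrm L (dx L (c3 U)) \<le> nH6 L U"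
  "nrm L (c4 U) \<le> nH6 L U" "nrm L (c5 U) \<le> nH6 L U" "nrm L (c6 U) \<le> nH6 L U"
  unfolding nH6_def by (rule real_le_rsqrt, simp)+

lemma nH4_ge:
  "nrm L (dx L (d1 U)) \<le> nH4 L U" "nrm L (dx L (d2 U)) \<le> nH4 L U"
  "nrm L (d3 U) \<le> nH4 L U" "nrm L (d4 U) \<le> nH4 L U"
  unfolding nH4_def by (rule real_le_rsqrt, simp)+

lemma sub6_components:
  "c1 (sub6 U V) = (\<lambda>x. c1 U x - c1 V x)" "c2 (sub6 U V) = (\<lambda>x. c2 U x - c2 V x)"
  "c3 (sub6 U V) = (\<lambda>x. c3 U x - c3 V x)" "c4 (sub6 U V) = (\<lambda>x. c4 U x - c4 V x)"
  "c5 (sub6 U V) = (\<lambda>x. c5 U x - c5 V x)" "c6 (sub6 U V) = (\<lambda>x. c6 U x - c6 V x)"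
  by (simp_all add: sub6_def c1_def c2_def c3_def c4_def c5_def c6_def)

lemma sub4_components:
  "d1 (sub4 U V) = (\<lambda>x. d1 U x - d1 V x)" "d2 (sub4 U V) = (\<lambda>x. d2 U x - d2 V x)"
  "d3 (sub4 U V) = (\<lambda>x. d3 U x - d3 V x)" "d4 (sub4 U V) = (\<lambda>x. d4 U x - d4 V x)"
  by (simp_all add: sub4_def d1_def d2_def d3_def d4_def)

lemma l2_curveI_dist:
  assumes "\<And>t. 0 \<le> t \<Longrightarrow> l2 L (X t)"
    and "\<And>t. 0 \<le> t \<Longrightarrow> (d t \<longlongrightarrow> 0) (at t within {0..})"
    and "\<And>s t. 0 \<le> s \<Longrightarrow> 0 \<le> t \<Longrightarrow> nrm L (\<lambda>x. X s x - X t x) \<le> d t s"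
  shows "l2_curve L X"
  using assms(1,2) by (rule l2_curve_dominated) (auto intro!: eventually_mono[OF eventually_nonneg_within] assms(3))

lemma h1_curveI_dist:
  assumes "\<And>t. 0 \<le> t \<Longrightarrow> h10 L (X t)"
    and "\<And>t. 0 \<le> t \<Longrightarrow> (d t \<longlongrightarrow> 0) (at t within {0..})"
    and "\<And>s t. 0 \<le> s \<Longrightarrow> 0 \<le> t \<Longrightarrow> nrm L (dx L (\<lambda>x. X s x - X t x)) \<le> d t s"
  shows "h1_curve L X"
  unfolding h1_curve_def
proof (intro conjI allI impI assms(1))
  show "l2_curve L (\<lambda>t. dx L (X t))"
    using assms by (intro l2_curveI_dist[where d=d]) (auto intro: dx_l2 simp flip: nrm_dx_diff)
qed

lemma bresse_curves:
  assumes "bresse_sol L \<rho>1 \<rho>2 b k k0 l g f U"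
  shows "h1_curve L (\<lambda>t. c1 (U t))" "h1_curve L (\<lambda>t. c2 (U t))" "h1_curve L (\<lambda>t. c3 (U t))"
    "l2_curve L (\<lambda>t. c4 (U t))" "l2_curve L (\<lambda>t. c5 (U t))" "l2_curve L (\<lambda>t. c6 (U t))"
proof -
  have i: "inH6 L (U t)" if "0 \<le> t" for t
    using assms that unfolding bresse_sol_def by blast
  have d: "((\<lambda>s. dist6 L (U s) (U t)) \<longlongrightarrow> 0) (at t within {0..})" if "0 \<le> t" for t
    using assms that unfolding bresse_sol_def by blast
  note n = nH6_ge[of L "sub6 (U s) (U t)" for s t, unfolded sub6_components, folded dist6_def]
  show "h1_curve L (\<lambda>t. c1 (U t))" "h1_curve L (\<lambda>t. c2 (U t))" "h1_curve L (\<lambda>t. c3 (U t))"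
    using i by (auto simp: inH6_def intro!: n h1_curveI_dist[where d="\<lambda>t s. dist6 L (U s) (U t)", OF _ d])
  show "l2_curve L (\<lambda>t. c4 (U t))" "l2_curve L (\<lambda>t. c5 (U t))" "l2_curve L (\<lambda>t. c6 (U t))"
    using i by (auto simp: inH6_def intro!: n l2_curveI_dist[where d="\<lambda>t s. dist6 L (U s) (U t)", OF _ d])
qed

lemma timo_curves:
  assumes "timo_sol L \<rho>1 \<rho>2 b k g f U"
  shows "h1_curve L (\<lambda>t. d1 (U t))" "h1_curve L (\<lambda>t. d2 (U t))"
    "l2_curve L (\<lambda>t. d3 (U t))" "l2_curve L (\<lambda>t. d4 (U t))"
proof -
  have i: "inH4 L (U t)" if "0 \<le> t" for t
    using assms that unfolding timo_sol_def by blast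
  have d: "((\<lambda>s. dist4 L (U s) (U t)) \<longlongrightarrow> 0) (at t within {0..})" if "0 \<le> t" for t
    using assms that unfolding timo_sol_def by blast
  note n = nH4_ge[of L "sub4 (U s) (U t)" for s t, unfolded sub4_components, folded dist4_def]
  show "h1_curve L (\<lambda>t. d1 (U t))" "h1_curve L (\<lambda>t. d2 (U t))"
    using i by (auto simp: inH4_def intro!: n h1_curveI_dist[where d="\<lambda>t s. dist4 L (U s) (U t)", OF _ d])
  show "l2_curve L (\<lambda>t. d3 (U t))" "l2_curve L (\<lambda>t. d4 (U t))"
    using i by (auto simp: inH4_def intro!: n l2_curveI_dist[where d="\<lambda>t s. dist4 L (U s) (U t)", OF _ d])
qed

lemma bresse_velocity:
  assumes U: "bresse_sol L \<rho>1 \<rho>2 b k k0 l g f U" and h: "l2 L h" and t: "0 \<le> t"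
  shows "((\<lambda>t. ip L (c1 (U t)) h) has_real_derivative ip L (c4 (U t)) h) (at t within {0..})"
    "((\<lambda>t. ip L (c2 (U t)) h) has_real_derivative ip L (c5 (U t)) h) (at t within {0..})"
    "((\<lambda>t. ip L (c3 (U t)) h) has_real_derivative ip L (c6 (U t)) h) (at t within {0..})"
proof -
  have *: "ip L (c1 (U t)) h - ip L (c1 (U 0)) h = integral {0..t} (\<lambda>s. ip L (c4 (U s)) h) \<and>
        ip L (c2 (U t)) h - ip L (c2 (U 0)) h = integral {0..t} (\<lambda>s. ip L (c5 (U s)) h) \<and>
        ip L (c3 (U t)) h - ip L (c3 (U 0)) h = integral {0..t} (\<lambda>s. ip L (c6 (U s)) h)" if "0 \<le> t" for t
    using U h that unfolding bresse_sol_def by blast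
  note c = bresse_curves[OF U]
  show "((\<lambda>t. ip L (c1 (U t)) h) has_real_derivative ip L (c4 (U t)) h) (at t within {0..})"
    "((\<lambda>t. ip L (c2 (U t)) h) has_real_derivative ip L (c5 (U t)) h) (at t within {0..})"
    "((\<lambda>t. ip L (c3 (U t)) h) has_real_derivative ip L (c6 (U t)) h) (at t within {0..})"
    using * by (auto intro!: weak_derivative[OF c(4) _ h t] weak_derivative[OF c(5) _ h t] weak_derivative[OF c(6) _ h t])
qed

lemma timo_velocity:
  assumes U: "timo_sol L \<rho>1 \<rho>2 b k g f U" and h: "l2 L h" and t: "0 \<le> t"
  shows "((\<lambda>t. ip L (d1 (U t)) h) has_real_derivative ip L (d3 (U t)) h) (at t within {0..})"
    "((\<lambda>t. ip L (d2 (U t)) h) has_real_derivative ip L (d4 (U t)) h) (at t within {0..})"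
proof -
  have *: "ip L (d1 (U t)) h - ip L (d1 (U 0)) h = integral {0..t} (\<lambda>s. ip L (d3 (U s)) h) \<and>
        ip L (d2 (U t)) h - ip L (d2 (U 0)) h = integral {0..t} (\<lambda>s. ip L (d4 (U s)) h)" if "0 \<le> t" for t
    using U h that unfolding timo_sol_def by blast
  note c = timo_curves[OF U]
  show "((\<lambda>t. ip L (d1 (U t)) h) has_real_derivative ip L (d3 (U t)) h) (at t within {0..})"
    "((\<lambda>t. ip L (d2 (U t)) h) has_real_derivative ip L (d4 (U t)) h) (at t within {0..})"
    using * by (auto intro!: weak_derivative[OF c(3) _ h t] weak_derivative[OF c(4) _ h t])
qed

definition shear :: "real \<Rightarrow> real \<Rightarrow> st6 \<Rightarrow> rfun" where
  "shear L l U = (\<lambda>x. dx L (c1 U) x + c2 U x + l * c3 U x)"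

definition axial :: "real \<Rightarrow> real \<Rightarrow> st6 \<Rightarrow> rfun" where
  "axial L l U = (\<lambda>x. dx L (c3 U) x - l * c1 U x)"

definition src :: "(real \<times> real \<times> real \<Rightarrow> real) \<Rightarrow> st6 \<Rightarrow> rfun" where
  "src f U = (\<lambda>x. f (c1 U x, c2 U x, c3 U x))"

text \<open>None of the fixed data depends on l, which enters only as an argument; constants built
  from the data alone are therefore uniform over 0 < l \<le> l0.\<close>

locale bresse_data =
  fixes L \<rho>1 \<rho>2 b k k0 \<beta> mF \<gamma>3 l0 :: real
    and F :: "real \<times> real \<times> real \<Rightarrow> real"
    and f :: "nat \<Rightarrow> real \<times> real \<times> real \<Rightarrow> real"
    and Df :: "nat \<Rightarrow> nat \<Rightarrow> real \<times> real \<times> real \<Rightarrow> real"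
    and g dg :: "nat \<Rightarrow> real \<Rightarrow> real"
    and m M :: "nat \<Rightarrow> real"
  assumes pos: "L > 0" "\<rho>1 > 0" "\<rho>2 > 0" "b > 0" "k > 0" "k0 > 0"
    and gamma3: "0 < l0" "\<gamma>3 > 0"
      "\<forall>l\<in>{0..l0}. \<forall>\<phi> \<psi> w. h10 L \<phi> \<and> h10 L \<psi> \<and> h10 L w \<longrightarrow>
         (nrm L (dx L \<phi>))\<^sup>2 + (nrm L (dx L \<psi>))\<^sup>2 + (nrm L (dx L w))\<^sup>2
         \<le> \<gamma>3 * (b * (nrm L (dx L \<psi>))\<^sup>2
                  + k * (nrm L (\<lambda>x. dx L \<phi> x + \<psi> x + l * w x))\<^sup>2
                  + k0 * (nrm L (\<lambda>x. dx L w x - l * \<phi> x))\<^sup>2)"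
    and F1: "\<forall>z. (F has_derivative (\<lambda>h. f 1 z * fst h + f 2 z * fst (snd h) + f 3 z * snd (snd h))) (at z)"
      "\<forall>i\<in>{1,2,3}. \<forall>z. (f i has_derivative
          (\<lambda>h. Df i 1 z * fst h + Df i 2 z * fst (snd h) + Df i 3 z * snd (snd h))) (at z)"
      "\<forall>i\<in>{1,2,3}. \<forall>j\<in>{1,2,3}. continuous_on UNIV (Df i j)"
    and F2: "\<beta> \<ge> 0" "mF \<ge> 0" "\<beta> < pi\<^sup>2 / (2 * \<gamma>3 * L\<^sup>2)"
      "\<forall>u v w. F (u, v, w) \<ge> - \<beta> * (u\<^sup>2 + v\<^sup>2 + w\<^sup>2) - mF"
    and F4: "\<forall>u v w. f 1 (u, v, w) * u + f 2 (u, v, w) * v + f 3 (u, v, w) * w - F (u, v, w)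
               \<ge> - \<beta> * (u\<^sup>2 + v\<^sup>2 + w\<^sup>2) - mF"
    and G1: "\<forall>i\<in>{1,2,3}. mono (g i) \<and> g i 0 = 0 \<and>
               (\<forall>s. (g i has_real_derivative dg i s) (at s)) \<and> continuous_on UNIV (dg i)"
    and G3: "\<forall>i\<in>{1,2,3}. m i > 0 \<and> M i > 0 \<and> (\<forall>s. m i \<le> dg i s \<and> dg i s \<le> M i)"
begin

lemma L0: "0 \<le> L" using pos by simp

lemma f_derivative:
  assumes "i \<in> {1,2,3::nat}"
  shows "(f i has_derivative (\<lambda>h. Df i 1 z * fst h + Df i 2 z * fst (snd h) + Df i 3 z * snd (snd h))) (at z)"
  using F1(2) assms by blast

lemma f_continuous: "i \<in> {1,2,3::nat} \<Longrightarrow> continuous_on UNIV (f i)"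
  by (rule has_derivative_imp_continuous_UNIV[OF f_derivative])

lemma f_lipschitz: "i \<in> {1,2,3::nat} \<Longrightarrow> \<exists>K. box_lipschitz (f i) R K"
  by (rule C1_imp_box_lipschitz[OF f_derivative]) (use F1(3) in blast)+

lemma F_derivative: "(F has_derivative (\<lambda>h. f 1 z * fst h + f 2 z * fst (snd h) + f 3 z * snd (snd h))) (at z)"
  using F1(1) by blast

lemma F_continuous: "continuous_on UNIV F"
  by (rule has_derivative_imp_continuous_UNIV[OF F_derivative])

text \<open>The Lipschitz, coercivity and monotonicity bounds all come from writing an increment of
  \<open>g i\<close> as the increment of its argument times a value of \<open>dg i\<close>, which
  lies between \<open>m i\<close> and \<open>M i\<close>.\<close>

lemma damping:
  assumes i: "i \<in> {1,2,3::nat}"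
  shows "continuous_on UNIV (g i)" "g i 0 = 0" "\<bar>g i a - g i c\<bar> \<le> M i * \<bar>a - c\<bar>" "m i * s\<^sup>2 \<le> g i s * s"
    "0 \<le> (g i a - g i c) * (a - c)"
proof -
  have d: "(g i has_real_derivative dg i s) (at s)" for s using G1 i by blast
  have mM: "0 < m i" using G3 i by blast
  have md: "m i \<le> dg i s" and dM: "dg i s \<le> M i" for s using G3 i by blast+
  show "continuous_on UNIV (g i)"
    using d by (intro continuous_at_imp_continuous_on ballI DERIV_isCont)
  show g0: "g i 0 = 0" using G1 i by blast
  have mvt: "\<exists>z. g i y - g i x = (y - x) * dg i z" if "x < y" for x y
    using MVT2[OF that d] by blast
  have rel: "\<exists>z. g i a - g i c = (a - c) * dg i z" for a c
  proof (cases a c rule: linorder_cases)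
    case less
    from mvt[OF this] obtain z where "g i c - g i a = (c - a) * dg i z" by blast
    then have "g i a - g i c = (a - c) * dg i z" by (simp add: algebra_simps)
    then show ?thesis ..
  next
    case equal then show ?thesis by simp
  next
    case greater then show ?thesis using mvt by blast
  qed
  obtain z where z: "g i a - g i c = (a - c) * dg i z" using rel by blast
  have dz: "0 < dg i z" using mM md[of z] by simp
  show "\<bar>g i a - g i c\<bar> \<le> M i * \<bar>a - c\<bar>"
    unfolding z abs_mult using dz dM[of z] by (simp add: mult.commute[of "\<bar>a - c\<bar>"] mult_right_mono)
  show "0 \<le> (g i a - g i c) * (a - c)"
  proof -
    have "(g i a - g i c) * (a - c) = dg i z * (a - c)\<^sup>2"
      unfolding z by (simp add: power2_eq_square mult.commute mult.left_commute)
    then show ?thesis using dz by simp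
  qed
  obtain y where y: "g i s - g i 0 = (s - 0) * dg i y" using rel by blast
  have "m i * s\<^sup>2 \<le> dg i y * s\<^sup>2" using md[of y] by (intro mult_right_mono) auto
  then show "m i * s\<^sup>2 \<le> g i s * s"
    using y g0 by (simp add: power2_eq_square mult.commute mult.left_commute)
qed

text \<open>Twice the physical kinetic energy, as \<open>stiffness\<close> is twice the elastic
  energy; the factor 1/2 is applied in \<open>energy\<close>.\<close>

definition kinetic :: "st6 \<Rightarrow> real" where
  "kinetic V = \<rho>1 * (nrm L (c4 V))\<^sup>2 + \<rho>2 * (nrm L (c5 V))\<^sup>2 + \<rho>1 * (nrm L (c6 V))\<^sup>2"

definition stiffness :: "real \<Rightarrow> st6 \<Rightarrow> real" where
  "stiffness l V = k * (nrm L (shear L l V))\<^sup>2 + b * (nrm L (dx L (c2 V)))\<^sup>2 + k0 * (nrm L (axial L l V))\<^sup>2"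

definition potential :: "st6 \<Rightarrow> real" where
  "potential V = (LINT x|mu L. F (c1 V x, c2 V x, c3 V x))"

definition energy :: "real \<Rightarrow> st6 \<Rightarrow> real" where
  "energy l V = (kinetic V + stiffness l V) / 2 + potential V"

definition cross :: "st6 \<Rightarrow> real" where
  "cross V = \<rho>1 * ip L (c4 V) (c1 V) + \<rho>2 * ip L (c5 V) (c2 V) + \<rho>1 * ip L (c6 V) (c3 V)"

definition dissipation :: "st6 \<Rightarrow> real" where
  "dissipation V = ip L (\<lambda>x. g 1 (c4 V x)) (c4 V) + ip L (\<lambda>x. g 2 (c5 V x)) (c5 V) + ip L (\<lambda>x. g 3 (c6 V x)) (c6 V)"

definition damping_work :: "st6 \<Rightarrow> real" where
  "damping_work V = ip L (\<lambda>x. g 1 (c4 V x)) (c1 V) + ip L (\<lambda>x. g 2 (c5 V x)) (c2 V) + ip L (\<lambda>x. g 3 (c6 V x)) (c3 V)"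

definition source_work :: "st6 \<Rightarrow> real" where
  "source_work V = ip L (src (f 1) V) (c1 V) + ip L (src (f 2) V) (c2 V) + ip L (src (f 3) V) (c3 V)"

lemma damping_curve:
  "i \<in> {1,2,3::nat} \<Longrightarrow> l2_curve L X \<Longrightarrow> l2_curve L (\<lambda>t x. g i (X t x))"
  by (rule l2_curve_lipschitz_image[OF _ damping(1,2,3)])

lemma source_curve:
  assumes "i \<in> {1,2,3::nat}" "h1_curve L u1" "h1_curve L u2" "h1_curve L u3"
  shows "l2_curve L (\<lambda>t x. f i (u1 t x, u2 t x, u3 t x))"
  using assms(1) by (intro compose3_curve f_continuous f_lipschitz L0 assms)

lemma bresse_momentum:
  assumes U: "bresse_sol L \<rho>1 \<rho>2 b k k0 l g f U" and h: "h10 L h" and t: "0 \<le> t"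
  shows "((\<lambda>t. \<rho>1 * ip L (c4 (U t)) h) has_real_derivative
      - k * ip L (shear L l (U t)) (dx L h) + k0 * l * ip L (axial L l (U t)) h
      - ip L (\<lambda>x. g 1 (c4 (U t) x)) h - ip L (src (f 1) (U t)) h) (at t within {0..})"
    "((\<lambda>t. \<rho>2 * ip L (c5 (U t)) h) has_real_derivative
      - b * ip L (dx L (c2 (U t))) (dx L h) - k * ip L (shear L l (U t)) h
      - ip L (\<lambda>x. g 2 (c5 (U t) x)) h - ip L (src (f 2) (U t)) h) (at t within {0..})"
    "((\<lambda>t. \<rho>1 * ip L (c6 (U t)) h) has_real_derivative
      - k0 * ip L (axial L l (U t)) (dx L h) - k * l * ip L (shear L l (U t)) h
      - ip L (\<lambda>x. g 3 (c6 (U t) x)) h - ip L (src (f 3) (U t)) h) (at t within {0..})"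
    and "l2_curve L (\<lambda>t. shear L l (U t))" "l2_curve L (\<lambda>t. axial L l (U t))"
    "l2_curve L (\<lambda>t. src (f 1) (U t))" "l2_curve L (\<lambda>t. src (f 2) (U t))" "l2_curve L (\<lambda>t. src (f 3) (U t))"
proof -
  note c = bresse_curves[OF U]
  note d = h1_curve_dx[OF c(1)] h1_curve_dx[OF c(2)] h1_curve_dx[OF c(3)]
  note u = h1_curve_l2_curve[OF L0 c(1)] h1_curve_l2_curve[OF L0 c(2)] h1_curve_l2_curve[OF L0 c(3)]
  show X: "l2_curve L (\<lambda>t. shear L l (U t))"
    unfolding shear_def by (intro l2_curve_add l2_curve_cmult d u)
  show Y: "l2_curve L (\<lambda>t. axial L l (U t))"
    unfolding axial_def by (intro l2_curve_diff l2_curve_cmult d u)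
  show f: "l2_curve L (\<lambda>t. src (f 1) (U t))" "l2_curve L (\<lambda>t. src (f 2) (U t))" "l2_curve L (\<lambda>t. src (f 3) (U t))"
    unfolding src_def by (intro source_curve c; simp)+
  have gc: "l2_curve L (\<lambda>t x. g 1 (c4 (U t) x))" "l2_curve L (\<lambda>t x. g 2 (c5 (U t) x))" "l2_curve L (\<lambda>t x. g 3 (c6 (U t) x))"
    by (intro damping_curve c; simp)+
  have h': "l2 L h" "l2 L (dx L h)" using h h10_l2 dx_l2 by auto
  note ci = ip_continuous_const
  have eq: "\<rho>1 * ip L (c4 (U t)) h - \<rho>1 * ip L (c4 (U 0)) h = integral {0..t} (\<lambda>s.
      - k * ip L (shear L l (U s)) (dx L h) + k0 * l * ip L (axial L l (U s)) h
      - ip L (\<lambda>x. g 1 (c4 (U s) x)) h - ip L (src (f 1) (U s)) h) \<and>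
    \<rho>2 * ip L (c5 (U t)) h - \<rho>2 * ip L (c5 (U 0)) h = integral {0..t} (\<lambda>s.
      - b * ip L (dx L (c2 (U s))) (dx L h) - k * ip L (shear L l (U s)) h
      - ip L (\<lambda>x. g 2 (c5 (U s) x)) h - ip L (src (f 2) (U s)) h) \<and>
    \<rho>1 * ip L (c6 (U t)) h - \<rho>1 * ip L (c6 (U 0)) h = integral {0..t} (\<lambda>s.
      - k0 * ip L (axial L l (U s)) (dx L h) - k * l * ip L (shear L l (U s)) h
      - ip L (\<lambda>x. g 3 (c6 (U s) x)) h - ip L (src (f 3) (U s)) h)" if "0 \<le> t" for t
    using U h that unfolding bresse_sol_def shear_def axial_def src_def by blast
  show "((\<lambda>t. \<rho>1 * ip L (c4 (U t)) h) has_real_derivative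
      - k * ip L (shear L l (U t)) (dx L h) + k0 * l * ip L (axial L l (U t)) h
      - ip L (\<lambda>x. g 1 (c4 (U t) x)) h - ip L (src (f 1) (U t)) h) (at t within {0..})"
    by (rule FTC_within_half_line[OF _ conjunct1[OF eq] t])
       (intro continuous_on_add continuous_on_diff continuous_on_mult continuous_on_const ci X Y f gc d h')
  show "((\<lambda>t. \<rho>2 * ip L (c5 (U t)) h) has_real_derivative
      - b * ip L (dx L (c2 (U t))) (dx L h) - k * ip L (shear L l (U t)) h
      - ip L (\<lambda>x. g 2 (c5 (U t) x)) h - ip L (src (f 2) (U t)) h) (at t within {0..})"
    by (rule FTC_within_half_line[OF _ conjunct1[OF conjunct2[OF eq]] t])
       (intro continuous_on_add continuous_on_diff continuous_on_mult continuous_on_const ci X Y f gc d h')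
  show "((\<lambda>t. \<rho>1 * ip L (c6 (U t)) h) has_real_derivative
      - k0 * ip L (axial L l (U t)) (dx L h) - k * l * ip L (shear L l (U t)) h
      - ip L (\<lambda>x. g 3 (c6 (U t) x)) h - ip L (src (f 3) (U t)) h) (at t within {0..})"
    by (rule FTC_within_half_line[OF _ conjunct2[OF conjunct2[OF eq]] t])
       (intro continuous_on_add continuous_on_diff continuous_on_mult continuous_on_const ci X Y f gc d h')
qed

lemma bresse_energy_identities:
  assumes U: "bresse_sol L \<rho>1 \<rho>2 b k k0 l g f U" and T: "0 \<le> T"
  shows "((\<lambda>t. energy l (U t)) has_real_derivative - dissipation (U T)) (at T within {0..})"
    and "((\<lambda>t. cross (U t)) has_real_derivative
      kinetic (U T) - stiffness l (U T) - damping_work (U T) - source_work (U T)) (at T within {0..})"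
proof -
  note c = bresse_curves[OF U]
  note d = h1_curve_dx[OF c(1)] h1_curve_dx[OF c(2)] h1_curve_dx[OF c(3)]
  note u = h1_curve_l2_curve[OF L0 c(1)] h1_curve_l2_curve[OF L0 c(2)] h1_curve_l2_curve[OF L0 c(3)]
  note mom = bresse_momentum[OF U]
  \<comment> \<open>The zero test function merely instantiates h: the continuity conclusions of
    \<open>bresse_momentum\<close> extracted next do not mention it.\<close>
  have h0: "h10 L (\<lambda>x. 0)" by (rule h10_zero)
  note X = mom(4)[OF h0 order_refl] and Y = mom(5)[OF h0 order_refl]
  note f = mom(6)[OF h0 order_refl] mom(7)[OF h0 order_refl] mom(8)[OF h0 order_refl]
  have gc: "l2_curve L (\<lambda>t x. g 1 (c4 (U t) x))" "l2_curve L (\<lambda>t x. g 2 (c5 (U t) x))" "l2_curve L (\<lambda>t x. g 3 (c6 (U t) x))"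
    by (intro damping_curve c; simp)+
  define q1 where "q1 = (\<lambda>t x. - g 1 (c4 (U t) x) - src (f 1) (U t) x)"
  define q2 where "q2 = (\<lambda>t x. - g 2 (c5 (U t) x) - src (f 2) (U t) x)"
  define q3 where "q3 = (\<lambda>t x. - g 3 (c6 (U t) x) - src (f 3) (U t) x)"
  have q: "l2_curve L q1" "l2_curve L q2" "l2_curve L q3"
    unfolding q1_def q2_def q3_def by (intro l2_curve_diff l2_curve_minus gc f)+
  have ipq: "ip L (q1 t) h = - ip L (\<lambda>x. g 1 (c4 (U t) x)) h - ip L (src (f 1) (U t)) h"
    "ip L (q2 t) h = - ip L (\<lambda>x. g 2 (c5 (U t) x)) h - ip L (src (f 2) (U t)) h"
    "ip L (q3 t) h = - ip L (\<lambda>x. g 3 (c6 (U t) x)) h - ip L (src (f 3) (U t)) h"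
    if "0 \<le> t" "l2 L h" for t h
    unfolding q1_def q2_def q3_def using that
    by (simp_all del: One_nat_def add: ip_diff_left ip_minus_left l2_minus l2_curve_l2[OF gc(1)] l2_curve_l2[OF gc(2)] l2_curve_l2[OF gc(3)]
        l2_curve_l2[OF f(1)] l2_curve_l2[OF f(2)] l2_curve_l2[OF f(3)])
  \<comment> \<open>The polarised elastic energy. Expanding its second argument, as in
    \<open>e1\<close> and \<open>e2\<close>, reproduces all elastic terms of the three momentum
    equations, including those with factor l, so only damping and sources remain in q1, q2,
    q3.\<close>
  define a where "a = (\<lambda>s r. k * ip L (shear L l (U s)) (shear L l (U r)) + b * ip L (dx L (c2 (U s))) (dx L (c2 (U r)))
    + k0 * ip L (axial L l (U s)) (axial L l (U r)))"
  have sym: "a s r = a r s" for s r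
    unfolding a_def by (simp only: ip_commute[of L "shear L l (U s)"] ip_commute[of L "dx L (c2 (U s))"] ip_commute[of L "axial L l (U s)"])
  have Ns: "((\<lambda>s. \<rho>1 * ip L (c4 (U s)) (c1 (U r)) + \<rho>2 * ip L (c5 (U s)) (c2 (U r)) + \<rho>1 * ip L (c6 (U s)) (c3 (U r)))
      has_real_derivative - a s r + (ip L (q1 s) (c1 (U r)) + ip L (q2 s) (c2 (U r)) + ip L (q3 s) (c3 (U r)))) (at s within {0..})"
    if s: "0 \<le> s" and r: "0 \<le> r" for s r
  proof -
    note h = h1_curve_h10[OF c(1) r] h1_curve_h10[OF c(2) r] h1_curve_h10[OF c(3) r]
    note hl = h10_l2[OF h(1)] h10_l2[OF h(2)] h10_l2[OF h(3)]
    note hd = dx_l2[OF h(1)] dx_l2[OF h(2)] dx_l2[OF h(3)]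
    note Xs = l2_curve_l2[OF X s] and Ys = l2_curve_l2[OF Y s]
    have e1: "ip L (shear L l (U s)) (shear L l (U r)) = ip L (shear L l (U s)) (dx L (c1 (U r)))
        + ip L (shear L l (U s)) (c2 (U r)) + l * ip L (shear L l (U s)) (c3 (U r))"
      unfolding shear_def[of L l "U r"] using Xs hl hd by (simp add: ip_add_right ip_cmult_right l2_add l2_cmult)
    have e2: "ip L (axial L l (U s)) (axial L l (U r)) = ip L (axial L l (U s)) (dx L (c3 (U r)))
        - l * ip L (axial L l (U s)) (c1 (U r))"
      unfolding axial_def[of L l "U r"] using Ys hl hd by (simp add: ip_diff_right ip_cmult_right l2_cmult)
    show ?thesis
      by (rule DERIV_cong[OF DERIV_add[OF DERIV_add[OF mom(1)[OF h(1) s] mom(2)[OF h(2) s]] mom(3)[OF h(3) s]]])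
         (simp del: One_nat_def add: a_def e1 e2 ipq[OF s] hl algebra_simps)
  qed
  note vel = bresse_velocity[OF U]
  have E: "((\<lambda>t. \<rho>1 * (nrm L (c4 (U t)))\<^sup>2 + \<rho>2 * (nrm L (c5 (U t)))\<^sup>2 + \<rho>1 * (nrm L (c6 (U t)))\<^sup>2 + a t t)
      has_real_derivative 2 * (ip L (q1 T) (c4 (U T)) + ip L (q2 T) (c5 (U T)) + ip L (q3 T) (c6 (U T)))) (at T within {0..})"
    by (rule wave_energy_identity[OF u c(4,5,6) q vel Ns sym T])
  have C: "((\<lambda>t. \<rho>1 * ip L (c4 (U t)) (c1 (U t)) + \<rho>2 * ip L (c5 (U t)) (c2 (U t)) + \<rho>1 * ip L (c6 (U t)) (c3 (U t)))
      has_real_derivative \<rho>1 * (nrm L (c4 (U T)))\<^sup>2 + \<rho>2 * (nrm L (c5 (U T)))\<^sup>2 + \<rho>1 * (nrm L (c6 (U T)))\<^sup>2 - a T T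
      + (ip L (q1 T) (c1 (U T)) + ip L (q2 T) (c2 (U T)) + ip L (q3 T) (c3 (U T)))) (at T within {0..})"
    by (rule wave_cross_derivative[OF u c(4,5,6) q vel Ns sym T])
  have att: "a t t = stiffness l (U t)" for t
    by (simp only: a_def stiffness_def nrm_square)
  note uT = l2_curve_l2[OF u(1) T] l2_curve_l2[OF u(2) T] l2_curve_l2[OF u(3) T]
  note vT = l2_curve_l2[OF c(4) T] l2_curve_l2[OF c(5) T] l2_curve_l2[OF c(6) T]
  from C show "((\<lambda>t. cross (U t)) has_real_derivative
      kinetic (U T) - stiffness l (U T) - damping_work (U T) - source_work (U T)) (at T within {0..})"
    unfolding cross_def[abs_def] by (rule DERIV_cong)
      (simp del: One_nat_def add: att kinetic_def damping_work_def source_work_def ipq[OF T] uT)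
  have P: "((\<lambda>t. potential (U t)) has_real_derivative ip L (c4 (U T)) (src (f 1) (U T))
      + ip L (c5 (U T)) (src (f 2) (U T)) + ip L (c6 (U T)) (src (f 3) (U T))) (at T within {0..})"
    unfolding potential_def src_def
    by (rule potential_derivative[OF L0 F_derivative f_continuous f_continuous f_continuous
          f_lipschitz f_lipschitz f_lipschitz c(1,2,3) c(4,5,6) vel T]) simp_all
  have "((\<lambda>t. (\<rho>1 * (nrm L (c4 (U t)))\<^sup>2 + \<rho>2 * (nrm L (c5 (U t)))\<^sup>2 + \<rho>1 * (nrm L (c6 (U t)))\<^sup>2 + a t t) / 2 + potential (U t))
     has_real_derivative - dissipation (U T)) (at T within {0..})"
    by (rule DERIV_cong[OF DERIV_add[OF DERIV_cdivide[OF E] P]])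
       (simp del: One_nat_def add: dissipation_def ipq[OF T] vT ip_commute[of L "c4 (U T)"] ip_commute[of L "c5 (U T)"] ip_commute[of L "c6 (U T)"] field_simps)
  then show "((\<lambda>t. energy l (U t)) has_real_derivative - dissipation (U T)) (at T within {0..})"
    unfolding energy_def kinetic_def att .
qed

end

section \<open>Uniform bound for the attractors\<close>

text \<open>Six squares sum to at most 6 D^2; enlarging 6 to 9 gives an integer factor after the
  root.\<close>

lemma nH6_le:
  assumes "nrm L (dx L (c1 U)) \<le> D" "nrm L (dx L (c2 U)) \<le> D" "nrm L (dx L (c3 U)) \<le> D"
    "nrm L (c4 U) \<le> D" "nrm L (c5 U) \<le> D" "nrm L (c6 U) \<le> D"
  shows "nH6 L U \<le> 3 * D"
proof -
  have D: "0 \<le> D" using assms(1) nrm_nonneg order_trans by blast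
  note s = assms[THEN power_mono[OF _ nrm_nonneg, of _ _ _ 2]]
  have "(nrm L (dx L (c1 U)))\<^sup>2 + (nrm L (dx L (c2 U)))\<^sup>2 + (nrm L (dx L (c3 U)))\<^sup>2
      + (nrm L (c4 U))\<^sup>2 + (nrm L (c5 U))\<^sup>2 + (nrm L (c6 U))\<^sup>2 \<le> 9 * D\<^sup>2"
    using s zero_le_power2[of D] by linarith
  also have "\<dots> = (3 * D)\<^sup>2" by (simp add: power_mult_distrib)
  finally show ?thesis unfolding nH6_def using D by (intro real_le_lsqrt) auto
qed

lemma nH4_le:
  assumes "nrm L (dx L (d1 U)) \<le> D" "nrm L (dx L (d2 U)) \<le> D" "nrm L (d3 U) \<le> D" "nrm L (d4 U) \<le> D"
  shows "nH4 L U \<le> 2 * D"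
proof -
  have D: "0 \<le> D" using assms(1) nrm_nonneg order_trans by blast
  note s = assms[THEN power_mono[OF _ nrm_nonneg, of _ _ _ 2]]
  have "(nrm L (dx L (d1 U)))\<^sup>2 + (nrm L (dx L (d2 U)))\<^sup>2 + (nrm L (d3 U))\<^sup>2 + (nrm L (d4 U))\<^sup>2 \<le> 4 * D\<^sup>2"
    using s by linarith
  also have "\<dots> = (2 * D)\<^sup>2" by (simp add: power_mult_distrib)
  finally show ?thesis unfolding nH4_def using D by (intro real_le_lsqrt) auto
qed

lemma nrm_le_diff_add:
  assumes "l2 L u" "l2 L v"
  shows "nrm L u \<le> nrm L (\<lambda>x. u x - v x) + nrm L v"
  using nrm_triangle[of L "\<lambda>x. u x - v x" v] assms by (simp add: l2_diff)

lemma nH6_le_dist: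
  assumes U: "inH6 L U" and V: "inH6 L V"
  shows "nH6 L U \<le> 3 * (dist6 L U V + nH6 L V)"
proof -
  note n = nH6_ge[of L "sub6 U V", unfolded sub6_components, folded dist6_def] and nV = nH6_ge[of L V]
  have h: "nrm L (dx L u) \<le> nrm L (dx L (\<lambda>x. u x - v x)) + nrm L (dx L v)" if "h10 L u" "h10 L v" for u v
    using nrm_le_diff_add[OF dx_l2[OF that(1)] dx_l2[OF that(2)]] nrm_dx_diff[OF that] by simp
  have "nrm L (dx L (c1 U)) \<le> nrm L (dx L (\<lambda>x. c1 U x - c1 V x)) + nrm L (dx L (c1 V))"
    "nrm L (dx L (c2 U)) \<le> nrm L (dx L (\<lambda>x. c2 U x - c2 V x)) + nrm L (dx L (c2 V))"
    "nrm L (dx L (c3 U)) \<le> nrm L (dx L (\<lambda>x. c3 U x - c3 V x)) + nrm L (dx L (c3 V))"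
    "nrm L (c4 U) \<le> nrm L (\<lambda>x. c4 U x - c4 V x) + nrm L (c4 V)"
    "nrm L (c5 U) \<le> nrm L (\<lambda>x. c5 U x - c5 V x) + nrm L (c5 V)"
    "nrm L (c6 U) \<le> nrm L (\<lambda>x. c6 U x - c6 V x) + nrm L (c6 V)"
    using U V unfolding inH6_def by (simp_all add: h nrm_le_diff_add)
  with n nV show ?thesis by (intro nH6_le) linarith+
qed

text \<open>The triangle inequality is taken in each component and reassembled by
  \<open>nH4_le\<close>, which costs the factor 2; the final choice of tolerances absorbs
  it.\<close>

lemma dist4_triangle:
  assumes U: "inH4 L U" and V: "inH4 L V" and W: "inH4 L W"
  shows "dist4 L U W \<le> 2 * (dist4 L U V + dist4 L V W)"
proof -
  note n = nH4_ge[of L "sub4 U V", unfolded sub4_components, folded dist4_def]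
    and nV = nH4_ge[of L "sub4 V W", unfolded sub4_components, folded dist4_def]
  have h: "nrm L (dx L (\<lambda>x. u x - w x)) \<le> nrm L (dx L (\<lambda>x. u x - v x)) + nrm L (dx L (\<lambda>x. v x - w x))"
    if "h10 L u" "h10 L v" "h10 L w" for u v w
    using nrm_diff_triangle[OF dx_l2[OF that(1)] dx_l2[OF that(2)] dx_l2[OF that(3)]] that by (simp add: nrm_dx_diff)
  have "nrm L (dx L (\<lambda>x. d1 U x - d1 W x)) \<le> nrm L (dx L (\<lambda>x. d1 U x - d1 V x)) + nrm L (dx L (\<lambda>x. d1 V x - d1 W x))"
    "nrm L (dx L (\<lambda>x. d2 U x - d2 W x)) \<le> nrm L (dx L (\<lambda>x. d2 U x - d2 V x)) + nrm L (dx L (\<lambda>x. d2 V x - d2 W x))"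
    "nrm L (\<lambda>x. d3 U x - d3 W x) \<le> nrm L (\<lambda>x. d3 U x - d3 V x) + nrm L (\<lambda>x. d3 V x - d3 W x)"
    "nrm L (\<lambda>x. d4 U x - d4 W x) \<le> nrm L (\<lambda>x. d4 U x - d4 V x) + nrm L (\<lambda>x. d4 V x - d4 W x)"
    using U V W unfolding inH4_def by (simp_all add: h nrm_diff_triangle)
  with n nV show ?thesis unfolding dist4_def[of L U W]
    by (intro nH4_le; simp only: sub4_components; linarith)
qed

text \<open>Sequential compactness: points with norms exceeding n would have a subsequence
  converging in the attractor, and \<open>nH6_le_dist\<close> bounds the norms along it.\<close>

lemma global_attractor_bounded:
  assumes A: "global_attractor (inH6 L) (dist6 L) (nH6 L) S A"
  shows "\<exists>B. \<forall>x\<in>A. nH6 L x \<le> B"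
proof (rule ccontr)
  assume "\<not> (\<exists>B. \<forall>x\<in>A. nH6 L x \<le> B)"
  then have "\<forall>n::nat. \<exists>x\<in>A. real n < nH6 L x" by (meson not_le)
  then obtain s where s: "\<And>n. s n \<in> A" "\<And>n. real n < nH6 L (s n)" by metis
  have "\<exists>r a. strict_mono r \<and> a \<in> A \<and> ((\<lambda>n. dist6 L (s (r n)) a) \<longlongrightarrow> 0) sequentially"
    using A s(1) unfolding global_attractor_def by blast
  then obtain r a where r: "strict_mono (r :: nat \<Rightarrow> nat)" "a \<in> A" "(\<lambda>n. dist6 L (s (r n)) a) \<longlonglongrightarrow> 0" by blast
  have in6: "inH6 L x" if "x \<in> A" for x using A that unfolding global_attractor_def by blast
  have "\<forall>\<^sub>F n in sequentially. dist6 L (s (r n)) a < 1"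
    using order_tendstoD(2)[OF r(3)] by simp
  moreover have "\<forall>\<^sub>F n in sequentially. n \<ge> nat \<lceil>3 * (1 + nH6 L a)\<rceil>"
    by (rule eventually_ge_at_top)
  ultimately have "\<forall>\<^sub>F n in sequentially. False"
  proof eventually_elim
    case (elim n)
    have "3 * (1 + nH6 L a) \<le> real n" using elim(2) by linarith
    also have "\<dots> \<le> real (r n)" using seq_suble[OF r(1), of n] by simp
    also have "\<dots> < nH6 L (s (r n))" by (rule s(2))
    also have "\<dots> \<le> 3 * (dist6 L (s (r n)) a + nH6 L a)"
      by (rule nH6_le_dist[OF in6[OF s(1)] in6[OF r(2)]])
    also have "\<dots> \<le> 3 * (1 + nH6 L a)" using elim(1) by simp
    finally show False by simp
  qed
  then show False by simp
qed

section \<open>Coercivity, dissipation and decay of the Bresse energy\<close>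

context bresse_data
begin

definition displacement :: "st6 \<Rightarrow> real" where
  "displacement V = (nrm L (c1 V))\<^sup>2 + (nrm L (c2 V))\<^sup>2 + (nrm L (c3 V))\<^sup>2"

definition gradient :: "st6 \<Rightarrow> real" where
  "gradient V = (nrm L (dx L (c1 V)))\<^sup>2 + (nrm L (dx L (c2 V)))\<^sup>2 + (nrm L (dx L (c3 V)))\<^sup>2"

definition velocity :: "st6 \<Rightarrow> real" where
  "velocity V = (nrm L (c4 V))\<^sup>2 + (nrm L (c5 V))\<^sup>2 + (nrm L (c6 V))\<^sup>2"

lemma nonneg: "0 \<le> displacement V" "0 \<le> velocity V" "0 \<le> gradient V" "0 \<le> stiffness l V" "0 \<le> kinetic V"
  using pos by (simp_all add: displacement_def velocity_def gradient_def stiffness_def kinetic_def)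

lemma gradient_le_stiffness:
  assumes "l \<in> {0..l0}" "inH6 L V"
  shows "gradient V \<le> \<gamma>3 * stiffness l V"
proof -
  have "gradient V \<le> \<gamma>3 * (b * (nrm L (dx L (c2 V)))\<^sup>2 + k * (nrm L (\<lambda>x. dx L (c1 V) x + c2 V x + l * c3 V x))\<^sup>2
      + k0 * (nrm L (\<lambda>x. dx L (c3 V) x - l * c1 V x))\<^sup>2)"
    unfolding gradient_def using gamma3(3) assms unfolding inH6_def by blast
  then show ?thesis by (simp add: stiffness_def shear_def axial_def add.commute)
qed

text \<open>\<open>Poincare_sharp\<close> requires c strictly below pi/L, since its tangent must
  stay finite on [0,L]. The strict bound on \<beta> leaves room for such a c.\<close>

lemma Poincare_constant: "\<exists>c. 0 < c \<and> c * L < pi \<and> 2 * \<beta> * \<gamma>3 < c\<^sup>2"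
proof -
  have "2 * \<beta> * \<gamma>3 < (pi / L)\<^sup>2"
    using F2(3) pos(1) gamma3(2) by (simp add: field_simps power_divide)
  then have "sqrt (2 * \<beta> * \<gamma>3) < pi / L"
    using pos(1) real_sqrt_less_mono[of "2 * \<beta> * \<gamma>3" "(pi / L)\<^sup>2"] by (simp add: real_sqrt_divide)
  then obtain c where c: "sqrt (2 * \<beta> * \<gamma>3) < c" "c < pi / L" using dense by blast
  have nn: "0 \<le> 2 * \<beta> * \<gamma>3" using F2(1) gamma3(2) by simp
  then have "0 < c" using c(1) real_sqrt_ge_zero[OF nn] by linarith
  moreover have "c * L < pi" using c(2) pos(1) by (simp add: pos_less_divide_eq)
  moreover have "2 * \<beta> * \<gamma>3 < c\<^sup>2"
    using power_strict_mono[OF c(1) real_sqrt_ge_zero[OF nn], of 2] nn by simp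
  ultimately show ?thesis by blast
qed

lemma displacement_le_stiffness:
  assumes c: "0 < c" "c * L < pi" and V: "l \<in> {0..l0}" "inH6 L V"
  shows "displacement V \<le> \<gamma>3 / c\<^sup>2 * stiffness l V"
proof -
  have "c\<^sup>2 * displacement V \<le> gradient V"
    using V(2) Poincare_sharp[OF _ pos(1) c] unfolding displacement_def gradient_def inH6_def
    by (simp add: distrib_left add_mono)
  also have "\<dots> \<le> \<gamma>3 * stiffness l V" by (rule gradient_le_stiffness[OF V])
  finally show ?thesis using c by (simp add: field_simps)
qed

text \<open>Applied twice: with G the potential density for (F2) and with the integrand of
  (F4).\<close>

lemma integral_lower_bound:
  assumes V: "inH6 L V" and G: "integrable (mu L) G"
    and le: "\<And>x. - \<beta> * ((c1 V x)\<^sup>2 + (c2 V x)\<^sup>2 + (c3 V x)\<^sup>2) - mF \<le> G x"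
  shows "- \<beta> * displacement V - mF * L \<le> (LINT x|mu L. G x)"
proof -
  interpret finite_measure "mu L" by (rule finite_measure_mu)
  have u: "l2 L (c1 V)" "l2 L (c2 V)" "l2 L (c3 V)" using V h10_l2 by (auto simp: inH6_def)
  note i = l2_mult_integrable[OF u(1) u(1)] l2_mult_integrable[OF u(2) u(2)] l2_mult_integrable[OF u(3) u(3)]
  have "- \<beta> * displacement V - mF * L
      = (LINT x|mu L. - \<beta> * (c1 V x * c1 V x + c2 V x * c2 V x + c3 V x * c3 V x) - mF)"
    unfolding displacement_def nrm_square ip_eq using i measure_mu[OF L0]
    by (simp del: mult_minus_left)
  also have "\<dots> \<le> (LINT x|mu L. G x)"
    using i G le by (intro Bochner_Integration.integral_mono) (simp_all add: power2_eq_square)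
  finally show ?thesis .
qed

lemma src_l2: "i \<in> {1,2,3::nat} \<Longrightarrow> inH6 L V \<Longrightarrow> l2 L (src (f i) V)"
  unfolding src_def inH6_def by (intro compose3_h10 f_continuous L0) auto

lemma potential_integrable: "inH6 L V \<Longrightarrow> integrable (mu L) (\<lambda>x. F (c1 V x, c2 V x, c3 V x))"
  unfolding inH6_def by (intro l2_integrable compose3_h10 F_continuous L0) auto

lemma potential_lower:
  assumes "inH6 L V"
  shows "- \<beta> * displacement V - mF * L \<le> potential V"
  unfolding potential_def using F2(4) by (intro integral_lower_bound potential_integrable assms) blast

lemma source_work_lower:
  assumes V: "inH6 L V"
  shows "- \<beta> * displacement V - mF * L \<le> source_work V - potential V"
proof -
  have u: "l2 L (c1 V)" "l2 L (c2 V)" "l2 L (c3 V)" using V h10_l2 by (auto simp: inH6_def)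
  have s: "l2 L (src (f 1) V)" "l2 L (src (f 2) V)" "l2 L (src (f 3) V)"
    using V by (auto intro!: src_l2 simp del: One_nat_def)
  note i = l2_mult_integrable[OF s(1) u(1)] l2_mult_integrable[OF s(2) u(2)] l2_mult_integrable[OF s(3) u(3)]
  note p = potential_integrable[OF V]
  have "source_work V - potential V = (LINT x|mu L. src (f 1) V x * c1 V x + src (f 2) V x * c2 V x
      + src (f 3) V x * c3 V x - F (c1 V x, c2 V x, c3 V x))"
    unfolding source_work_def potential_def ip_eq using i p by (simp del: One_nat_def)
  also have "\<dots> \<ge> - \<beta> * displacement V - mF * L"
  proof (rule integral_lower_bound[OF V])
    show "integrable (mu L) (\<lambda>x. src (f 1) V x * c1 V x + src (f 2) V x * c2 V x
      + src (f 3) V x * c3 V x - F (c1 V x, c2 V x, c3 V x))" using i p by (simp del: One_nat_def)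
    fix x
    show "- \<beta> * ((c1 V x)\<^sup>2 + (c2 V x)\<^sup>2 + (c3 V x)\<^sup>2) - mF \<le> src (f 1) V x * c1 V x + src (f 2) V x * c2 V x
      + src (f 3) V x * c3 V x - F (c1 V x, c2 V x, c3 V x)"
      unfolding src_def using F4 by blast
  qed
  finally show ?thesis .
qed

lemma damping_l2:
  assumes i: "i \<in> {1,2,3::nat}" and v: "l2 L v"
  shows "l2 L (\<lambda>x. g i (v x))" "nrm L (\<lambda>x. g i (v x)) \<le> M i * nrm L v" "m i * (nrm L v)\<^sup>2 \<le> ip L (\<lambda>x. g i (v x)) v"
proof -
  have lip: "\<bar>g i s\<bar> \<le> M i * \<bar>s\<bar>" for s
    using damping(3)[OF i, of s 0] damping(2)[OF i] by simp
  have M: "0 < M i" using G3 i by blast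
  show l: "l2 L (\<lambda>x. g i (v x))"
    using measurable_compose[OF l2_measurable[OF v] borel_measurable_continuous_onI[OF damping(1)[OF i]]] lip
    by (intro l2_le[OF v, where C="M i"]) auto
  have "nrm L (\<lambda>x. g i (v x)) \<le> nrm L (\<lambda>x. M i * v x)"
    using lip M by (intro nrm_mono l l2_cmult v) (simp add: abs_mult)
  then show "nrm L (\<lambda>x. g i (v x)) \<le> M i * nrm L v" using M by (simp add: nrm_cmult)
  have "ip L (\<lambda>x. m i * v x) v \<le> ip L (\<lambda>x. g i (v x)) v"
    using damping(4)[OF i] by (intro ip_mono l l2_cmult v) (simp add: power2_eq_square mult.assoc)
  then show "m i * (nrm L v)\<^sup>2 \<le> ip L (\<lambda>x. g i (v x)) v" by (simp add: ip_cmult_left nrm_square)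
qed

lemma dissipation_lower:
  assumes V: "inH6 L V"
  shows "min (m 1) (min (m 2) (m 3)) * velocity V \<le> dissipation V" "0 \<le> dissipation V"
proof -
  have v: "l2 L (c4 V)" "l2 L (c5 V)" "l2 L (c6 V)" using V by (auto simp: inH6_def)
  define m0 where "m0 = min (m 1) (min (m 2) (m 3))"
  have m: "0 < m 1" "0 < m 2" "0 < m 3" using G3 by blast+
  have le: "m0 * (nrm L v)\<^sup>2 \<le> m i * (nrm L v)\<^sup>2" if "i \<in> {1,2,3}" for i v
    using that by (intro mult_right_mono) (auto simp: m0_def simp del: One_nat_def)
  have "m0 * velocity V = m0 * (nrm L (c4 V))\<^sup>2 + m0 * (nrm L (c5 V))\<^sup>2 + m0 * (nrm L (c6 V))\<^sup>2"
    by (simp add: velocity_def distrib_left)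
  also have "\<dots> \<le> dissipation V"
    unfolding dissipation_def
    by (intro add_mono order_trans[OF le damping_l2(3)] v; simp)
  finally show *: "m0 * velocity V \<le> dissipation V" .
  have "0 \<le> m0" using m by (simp add: m0_def)
  with nonneg(2)[of V] have "0 \<le> m0 * velocity V" by simp
  with * show "0 \<le> dissipation V" by linarith
qed

text \<open>Young's weight \<eta> stays free: the displacement term must fit into whatever share of
  the stiffness is left, while the velocity term, however large its factor, is paid for by
  dissipation.\<close>

lemma damping_work_bound:
  assumes V: "inH6 L V" and \<eta>: "0 < \<eta>"
  shows "\<bar>damping_work V\<bar> \<le> (M 1 + M 2 + M 3)\<^sup>2 / (4 * \<eta>) * velocity V + \<eta> * displacement V"
proof -
  have v: "l2 L (c4 V)" "l2 L (c5 V)" "l2 L (c6 V)" using V by (auto simp: inH6_def)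
  have u: "l2 L (c1 V)" "l2 L (c2 V)" "l2 L (c3 V)" using V h10_l2 by (auto simp: inH6_def)
  define M0 where "M0 = M 1 + M 2 + M 3"
  have M: "0 < M 1" "0 < M 2" "0 < M 3" using G3 by blast+
  have one: "\<bar>ip L (\<lambda>x. g i (w x)) h\<bar> \<le> M0\<^sup>2 / (4 * \<eta>) * (nrm L w)\<^sup>2 + \<eta> * (nrm L h)\<^sup>2"
    if i: "i \<in> {1,2,3}" and "l2 L w" "l2 L h" for i w h
  proof -
    have "M i \<le> M0" using i M by (auto simp: M0_def simp del: One_nat_def)
    have "nrm L (\<lambda>x. g i (w x)) \<le> M i * nrm L w" by (rule damping_l2(2)[OF i that(2)])
    also have "\<dots> \<le> M0 * nrm L w" using \<open>M i \<le> M0\<close> by (rule mult_right_mono) simp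
    finally have "(nrm L (\<lambda>x. g i (w x)))\<^sup>2 \<le> (M0 * nrm L w)\<^sup>2" by (rule power_mono) simp
    then have "(nrm L (\<lambda>x. g i (w x)))\<^sup>2 / (4 * \<eta>) \<le> M0\<^sup>2 / (4 * \<eta>) * (nrm L w)\<^sup>2"
      using \<eta> by (simp add: power_mult_distrib divide_right_mono)
    then show ?thesis using ip_young[OF damping_l2(1)[OF i that(2)] that(3) \<eta>] by linarith
  qed
  have "\<bar>damping_work V\<bar> \<le> (M0\<^sup>2 / (4 * \<eta>) * (nrm L (c4 V))\<^sup>2 + \<eta> * (nrm L (c1 V))\<^sup>2)
      + (M0\<^sup>2 / (4 * \<eta>) * (nrm L (c5 V))\<^sup>2 + \<eta> * (nrm L (c2 V))\<^sup>2)
      + (M0\<^sup>2 / (4 * \<eta>) * (nrm L (c6 V))\<^sup>2 + \<eta> * (nrm L (c3 V))\<^sup>2)"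
    unfolding damping_work_def by (intro abs_sum3_le one u v; simp)
  then show ?thesis by (simp add: velocity_def displacement_def M0_def distrib_left)
qed

lemma kinetic_le_velocity: "kinetic V \<le> (\<rho>1 + \<rho>2) * velocity V"
  unfolding kinetic_def velocity_def using pos
  by (simp add: distrib_left distrib_right)

text \<open>The derivative of \<open>cross\<close> supplies minus the stiffness, which dissipation
  alone does not see; a large multiple of the energy supplies enough dissipation to dominate every
  velocity term. The constant C is independent of l because \<open>displacement_le_stiffness\<close>
  holds uniformly on [0, l0].\<close>

lemma trajectory_decay:
  "\<exists>C\<ge>0. \<forall>l\<in>{0<..l0}. \<forall>U T. bresse_sol L \<rho>1 \<rho>2 b k k0 l g f U \<and> 0 \<le> T \<longrightarrow>
     T * (energy l (U T) - mF * L) \<le> (cross (U 0) + C * energy l (U 0)) - (cross (U T) + C * energy l (U T))"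
proof -
  obtain c where c: "0 < c" "c * L < pi" "2 * \<beta> * \<gamma>3 < c\<^sup>2" using Poincare_constant by blast
  define \<theta> where "\<theta> = 2 * \<beta> * \<gamma>3 / c\<^sup>2"
  \<comment> \<open>The \<beta>-defect from (F4) costs at most \<theta>/2 of the stiffness. This
    \<eta> makes the damping work cost at most (1 - \<theta>)/2 of it, leaving at least the half
    that the energy contains.\<close>
  define \<eta> where "\<eta> = (1 - \<theta>) * c\<^sup>2 / (2 * \<gamma>3)"
  define m0 where "m0 = min (m 1) (min (m 2) (m 3))"
  \<comment> \<open>\<open>kinetic\<close> occurs with coefficient 1 where minus the energy asks for
    -1/2, hence 3/2; the second summand pays for the velocity term of the damping work.\<close>
  define Cv where "Cv = 3 / 2 * (\<rho>1 + \<rho>2) + (M 1 + M 2 + M 3)\<^sup>2 / (4 * \<eta>)"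
  define C where "C = Cv / m0"
  have \<theta>: "\<theta> < 1" using c by (simp add: \<theta>_def)
  have \<eta>: "0 < \<eta>" using \<theta> c gamma3(2) by (simp add: \<eta>_def)
  have m0: "0 < m0" using G3 by (simp add: m0_def)
  have "0 \<le> Cv" using pos \<eta> by (simp add: Cv_def)
  then have C0: "0 \<le> C" using m0 by (simp add: C_def)
  have ineq: "kinetic V - stiffness l V - damping_work V - source_work V - C * dissipation V \<le> - energy l V + mF * L"
    if V: "inH6 L V" and l: "l \<in> {0..l0}" for V l
  proof -
    note d = displacement_le_stiffness[OF c(1,2) l V]
    have "\<beta> * displacement V \<le> \<beta> * (\<gamma>3 / c\<^sup>2 * stiffness l V)"
      using d F2(1) by (rule mult_left_mono)
    then have b1: "\<beta> * displacement V \<le> \<theta> / 2 * stiffness l V" by (simp add: \<theta>_def)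
    have "\<eta> * displacement V \<le> \<eta> * (\<gamma>3 / c\<^sup>2 * stiffness l V)"
      using d \<eta> by (intro mult_left_mono) auto
    also have "\<dots> = (1 - \<theta>) / 2 * stiffness l V" using c gamma3(2) by (simp add: \<eta>_def)
    finally have b2: "\<eta> * displacement V \<le> (1 - \<theta>) / 2 * stiffness l V" .
    have b3: "\<theta> / 2 * stiffness l V + (1 - \<theta>) / 2 * stiffness l V = stiffness l V / 2"
      by (simp add: field_simps)
    have "C * (m0 * velocity V) \<le> C * dissipation V"
      using dissipation_lower(1)[OF V] C0 unfolding m0_def by (intro mult_left_mono) auto
    moreover have "C * (m0 * velocity V) = Cv * velocity V" using m0 by (simp add: C_def)
    moreover have "Cv * velocity V = 3 / 2 * ((\<rho>1 + \<rho>2) * velocity V) + (M 1 + M 2 + M 3)\<^sup>2 / (4 * \<eta>) * velocity V"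
      by (simp add: Cv_def distrib_right)
    ultimately have b4: "3 / 2 * kinetic V + (M 1 + M 2 + M 3)\<^sup>2 / (4 * \<eta>) * velocity V \<le> C * dissipation V"
      using kinetic_le_velocity[of V] by linarith
    show ?thesis
      using abs_le_D2[OF damping_work_bound[OF V \<eta>]] source_work_lower[OF V] b1 b2 b3 b4
      unfolding energy_def by argo
  qed
  have "T * (energy l (U T) - mF * L) \<le> (cross (U 0) + C * energy l (U 0)) - (cross (U T) + C * energy l (U T))"
    if l: "l \<in> {0<..l0}" and U: "bresse_sol L \<rho>1 \<rho>2 b k k0 l g f U" and T: "0 \<le> T" for l U T
  proof -
    have V: "inH6 L (U t)" if "0 \<le> t" for t using U that unfolding bresse_sol_def by blast
    have l': "l \<in> {0..l0}" using l by simp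
    note d = bresse_energy_identities[OF U]
    \<comment> \<open>Monotonicity replaces the energy at time t by its final value, so the decay
      rate becomes a constant and the total decrease is linear in T.\<close>
    have mono: "energy l (U T) \<le> energy l (U t)" if "0 \<le> t" "t \<le> T" for t
      by (rule deriv_within_half_line_nonpos[where T=T, OF d(1)]) (use that dissipation_lower(2) V in auto)
    have "(cross (U T) + C * energy l (U T)) + T * (energy l (U T) - mF * L)
      \<le> (cross (U 0) + C * energy l (U 0)) + 0 * (energy l (U T) - mF * L)"
    proof (rule deriv_within_half_line_nonpos[where T=T and
          f="\<lambda>t. (cross (U t) + C * energy l (U t)) + t * (energy l (U T) - mF * L)"])
      fix t assume t: "0 \<le> t" "t \<le> T"
      show "((\<lambda>t. (cross (U t) + C * energy l (U t)) + t * (energy l (U T) - mF * L)) has_real_derivative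
         ((kinetic (U t) - stiffness l (U t) - damping_work (U t) - source_work (U t)) + C * (- dissipation (U t)))
         + 1 * (energy l (U T) - mF * L)) (at t within {0..})"
        by (intro DERIV_add DERIV_cmult DERIV_cmult_right DERIV_ident d t)
      show "((kinetic (U t) - stiffness l (U t) - damping_work (U t) - source_work (U t)) + C * (- dissipation (U t)))
         + 1 * (energy l (U T) - mF * L) \<le> 0"
        using ineq[OF V[OF t(1)] l'] mono[OF t] by simp
    qed (use T in auto)
    then show ?thesis by simp
  qed
  with C0 show ?thesis by blast
qed

text \<open>By (F2) the potential can cancel at most the fraction \<theta> < 1 of the elastic
  energy, up to a constant, so the energy controls the norm uniformly in l.\<close>

lemma energy_sublevel_bounded:
  "\<exists>R. \<forall>l\<in>{0..l0}. \<forall>V. inH6 L V \<and> energy l V \<le> mF * L \<longrightarrow> nH6 L V \<le> R"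
proof -
  obtain c where c: "0 < c" "c * L < pi" "2 * \<beta> * \<gamma>3 < c\<^sup>2" using Poincare_constant by blast
  define \<theta> where "\<theta> = 2 * \<beta> * \<gamma>3 / c\<^sup>2"
  have \<theta>: "\<theta> < 1" using c by (simp add: \<theta>_def)
  define \<rho> where "\<rho> = min \<rho>1 \<rho>2"
  have \<rho>: "0 < \<rho>" "\<rho> \<le> \<rho>1" "\<rho> \<le> \<rho>2" using pos by (auto simp: \<rho>_def)
  define R where "R = \<gamma>3 * (4 * (mF * L) / (1 - \<theta>)) + 4 * (mF * L) / \<rho>"
  have "nH6 L V \<le> sqrt R" if l: "l \<in> {0..l0}" and V: "inH6 L V" and E: "energy l V \<le> mF * L" for l V
  proof -
    have "\<beta> * displacement V \<le> \<beta> * (\<gamma>3 / c\<^sup>2 * stiffness l V)"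
      using displacement_le_stiffness[OF c(1,2) l V] F2(1) by (rule mult_left_mono)
    then have "\<beta> * displacement V \<le> \<theta> / 2 * stiffness l V" by (simp add: \<theta>_def)
    \<comment> \<open>One \<open>mF * L\<close> comes from the energy level and one from the lower
      bound on the potential; undoing the factor 1/2 in the energy makes it four.\<close>
    with potential_lower[OF V] E have *: "kinetic V + (stiffness l V - \<theta> * stiffness l V) \<le> 4 * (mF * L)"
      unfolding energy_def by argo
    have s0: "0 \<le> stiffness l V - \<theta> * stiffness l V"
      using \<theta> nonneg(4)[of l V] mult_right_mono[of \<theta> 1 "stiffness l V"] by simp
    have "(1 - \<theta>) * stiffness l V \<le> 4 * (mF * L)"
      using * nonneg(5)[of V] by (simp add: left_diff_distrib)
    then have "stiffness l V \<le> 4 * (mF * L) / (1 - \<theta>)"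
      using \<theta> by (simp add: pos_le_divide_eq mult.commute)
    then have g: "gradient V \<le> \<gamma>3 * (4 * (mF * L) / (1 - \<theta>))"
      using gradient_le_stiffness[OF l V] mult_left_mono[of "stiffness l V" "4 * (mF * L) / (1 - \<theta>)" \<gamma>3] gamma3(2)
      by linarith
    have "\<rho> * velocity V \<le> kinetic V"
      unfolding velocity_def kinetic_def distrib_left using \<rho> by (intro add_mono mult_right_mono) auto
    then have "velocity V \<le> 4 * (mF * L) / \<rho>"
      using * s0 \<rho>(1) by (simp add: pos_le_divide_eq mult.commute)
    with g have "gradient V + velocity V \<le> R" by (simp add: R_def)
    then show ?thesis
      unfolding nH6_def gradient_def velocity_def by (intro real_sqrt_le_mono) simp
  qed
  then show ?thesis by blast
qed

text \<open>Here l is fixed and K may depend on it. The bound only has to be finite, as it is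
  compared with an elapsed time that can be taken arbitrarily long.\<close>

lemma energy_bounded_on_bounded:
  "\<exists>K. \<forall>V. inH6 L V \<and> nH6 L V \<le> B \<longrightarrow> \<bar>cross V\<bar> \<le> K \<and> \<bar>energy l V\<bar> \<le> K"
proof -
  obtain P where P0: "0 \<le> P" and P: "\<And>a1 a2 a3. \<bar>a1\<bar> \<le> sqrt L * B \<Longrightarrow> \<bar>a2\<bar> \<le> sqrt L * B \<Longrightarrow> \<bar>a3\<bar> \<le> sqrt L * B \<Longrightarrow> \<bar>F (a1, a2, a3)\<bar> \<le> P"
    using bounded_on_box[OF F_continuous, of "sqrt L * B"] by blast
  define K1 where "K1 = \<rho>1 * (B * (L * B)) + \<rho>2 * (B * (L * B)) + \<rho>1 * (B * (L * B))"
  define K2 where "K2 = (\<rho>1 * B\<^sup>2 + \<rho>2 * B\<^sup>2 + \<rho>1 * B\<^sup>2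
    + (k * (B + L * B + \<bar>l\<bar> * (L * B))\<^sup>2 + b * B\<^sup>2 + k0 * (B + \<bar>l\<bar> * (L * B))\<^sup>2)) / 2 + P * L"
  have "\<bar>cross V\<bar> \<le> K1 \<and> \<bar>energy l V\<bar> \<le> K2" if V: "inH6 L V" and B: "nH6 L V \<le> B" for V
  proof
    have h: "h10 L (c1 V)" "h10 L (c2 V)" "h10 L (c3 V)" and v: "l2 L (c4 V)" "l2 L (c5 V)" "l2 L (c6 V)"
      using V by (auto simp: inH6_def)
    note u = h[THEN h10_l2] and d = h[THEN dx_l2]
    note n = nH6_ge[THEN order_trans, OF B]
    have un: "nrm L (c1 V) \<le> L * B" "nrm L (c2 V) \<le> L * B" "nrm L (c3 V) \<le> L * B"
      using nrm_h10_bound[OF L0 h(1)] nrm_h10_bound[OF L0 h(2)] nrm_h10_bound[OF L0 h(3)]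
        mult_left_mono[OF n(1) L0] mult_left_mono[OF n(2) L0] mult_left_mono[OF n(3) L0] by linarith+
    have B0: "0 \<le> B" using n(4) nrm_nonneg[of L "c4 V"] by linarith
    have prod: "\<bar>r * ip L p q\<bar> \<le> r * (B * (L * B))" if "l2 L p" "l2 L q" "nrm L p \<le> B" "nrm L q \<le> L * B" "0 < r" for r p q
    proof -
      have "\<bar>ip L p q\<bar> \<le> nrm L p * nrm L q" using that by (intro Cauchy_Schwarz_ip)
      also have "\<dots> \<le> B * (L * B)" using that B0 by (intro mult_mono) auto
      finally show ?thesis using that(5) by (simp add: abs_mult)
    qed
    show "\<bar>cross V\<bar> \<le> K1"
      unfolding cross_def K1_def by (intro abs_sum3_le prod u v n un pos)
    have sq: "r * (nrm L p)\<^sup>2 \<le> r * D\<^sup>2" if "nrm L p \<le> D" "0 < r" for r p D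
      using that power_mono[OF that(1) nrm_nonneg, of 2] by simp
    have "nrm L (shear L l V) \<le> nrm L (\<lambda>x. dx L (c1 V) x + c2 V x) + nrm L (\<lambda>x. l * c3 V x)"
      unfolding shear_def by (intro nrm_triangle l2_add l2_cmult d u)
    also have "\<dots> \<le> (nrm L (dx L (c1 V)) + nrm L (c2 V)) + \<bar>l\<bar> * nrm L (c3 V)"
      unfolding nrm_cmult by (intro add_right_mono nrm_triangle d u)
    also have "\<dots> \<le> B + L * B + \<bar>l\<bar> * (L * B)"
      by (intro add_mono mult_left_mono n un) simp
    finally have X: "nrm L (shear L l V) \<le> B + L * B + \<bar>l\<bar> * (L * B)" .
    have "nrm L (axial L l V) \<le> nrm L (dx L (c3 V)) + nrm L (\<lambda>x. l * c1 V x)"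
      unfolding axial_def by (intro nrm_triangle_diff l2_cmult d u)
    also have "\<dots> \<le> B + \<bar>l\<bar> * (L * B)"
      unfolding nrm_cmult by (intro add_mono mult_left_mono n un) simp
    finally have Y: "nrm L (axial L l V) \<le> B + \<bar>l\<bar> * (L * B)" .
    have kin: "kinetic V \<le> \<rho>1 * B\<^sup>2 + \<rho>2 * B\<^sup>2 + \<rho>1 * B\<^sup>2"
      unfolding kinetic_def by (intro add_mono sq n pos)
    have st: "stiffness l V \<le> k * (B + L * B + \<bar>l\<bar> * (L * B))\<^sup>2 + b * B\<^sup>2 + k0 * (B + \<bar>l\<bar> * (L * B))\<^sup>2"
      unfolding stiffness_def by (intro add_mono sq n X Y pos)
    have "\<bar>potential V\<bar> \<le> P * L"
    proof -
      interpret finite_measure "mu L" by (rule finite_measure_mu)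
      have bx: "\<bar>w x\<bar> \<le> sqrt L * B" if "h10 L w" "nrm L (dx L w) \<le> B" "x \<in> {0..L}" for w x
        using h10_bound[OF L0 that(1,3)] mult_left_mono[OF that(2), of "sqrt L"] L0 by simp
      have "norm (potential V) \<le> (LINT x|mu L. P)"
        unfolding potential_def
      proof (rule Bochner_Integration.integral_norm_bound_integral[OF potential_integrable[OF V]])
        fix x assume "x \<in> space (mu L)"
        then show "norm (F (c1 V x, c2 V x, c3 V x)) \<le> P"
          using P[OF bx[OF h(1) n(1)] bx[OF h(2) n(2)] bx[OF h(3) n(3)]] by simp
      qed simp
      then show ?thesis using measure_mu[OF L0] by (simp add: mult.commute)
    qed
    moreover have "\<bar>e + w\<bar> \<le> E + W" if "\<bar>w\<bar> \<le> W" "0 \<le> e" "e \<le> E" for e w E W :: real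
      using that by linarith
    moreover have "0 \<le> (kinetic V + stiffness l V) / 2"
      using nonneg(4)[of l V] nonneg(5)[of V] by simp
    ultimately show "\<bar>energy l V\<bar> \<le> K2"
      unfolding energy_def K2_def using kin st by (meson add_mono divide_right_mono zero_le_numeral)
  qed
  then show ?thesis
    by (intro exI[of _ "max K1 K2"]) (auto simp: le_max_iff_disj)
qed

text \<open>A point of the attractor is reached after an arbitrarily long time from another point of the
  (bounded) attractor, so dividing the decay estimate by the elapsed time leaves \<open>energy \<le> mF L\<close>.\<close>

lemma attractors_uniformly_bounded:
  assumes bresse: "\<forall>l\<in>{0<..l0}. \<forall>U0. inH6 L U0 \<longrightarrow>
                   S l 0 U0 = U0 \<and> bresse_sol L \<rho>1 \<rho>2 b k k0 l g f (\<lambda>t. S l t U0)"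
    and attr: "\<forall>l\<in>{0<..l0}. global_attractor (inH6 L) (dist6 L) (nH6 L) (S l) (A l)"
  shows "\<exists>R. \<forall>l\<in>{0<..l0}. \<forall>x\<in>A l. nH6 L x \<le> R"
proof -
  obtain C where C: "0 \<le> C" and decay: "\<And>l U T. l \<in> {0<..l0} \<Longrightarrow> bresse_sol L \<rho>1 \<rho>2 b k k0 l g f U \<Longrightarrow> 0 \<le> T \<Longrightarrow>
     T * (energy l (U T) - mF * L) \<le> (cross (U 0) + C * energy l (U 0)) - (cross (U T) + C * energy l (U T))"
    using trajectory_decay by blast
  obtain R where R: "\<And>l V. l \<in> {0..l0} \<Longrightarrow> inH6 L V \<Longrightarrow> energy l V \<le> mF * L \<Longrightarrow> nH6 L V \<le> R"
    using energy_sublevel_bounded by blast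
  have "nH6 L x \<le> R" if l: "l \<in> {0<..l0}" and x: "x \<in> A l" for l x
  proof -
    have ga: "global_attractor (inH6 L) (dist6 L) (nH6 L) (S l) (A l)" using attr l by blast
    have in6: "inH6 L y" if "y \<in> A l" for y using ga that unfolding global_attractor_def by blast
    obtain B where B: "\<And>y. y \<in> A l \<Longrightarrow> nH6 L y \<le> B" using global_attractor_bounded[OF ga] by blast
    \<comment> \<open>B and K depend on l, but they disappear from the final estimate; R was chosen
      before l.\<close>
    obtain K where K: "\<And>V. inH6 L V \<Longrightarrow> nH6 L V \<le> B \<Longrightarrow> \<bar>cross V\<bar> \<le> K \<and> \<bar>energy l V\<bar> \<le> K"
      using energy_bounded_on_bounded[of B l] by blast
    have Z: "\<bar>cross y + C * energy l y\<bar> \<le> K + C * K" if "y \<in> A l" for y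
    proof -
      note k = K[OF in6[OF that] B[OF that]]
      have "\<bar>C * energy l y\<bar> \<le> C * K" unfolding abs_mult using k C by (simp add: mult_left_mono)
      then show ?thesis using k by linarith
    qed
    have "energy l x \<le> mF * L"
    proof (rule ccontr)
      assume "\<not> energy l x \<le> mF * L"
      then have pe: "0 < energy l x - mF * L" by simp
      \<comment> \<open>Along a trajectory in the attractor the decaying functional can drop by at
        most \<open>2 * (K + C * K)\<close>; this time would force a drop larger by 1.\<close>
      define T where "T = (2 * (K + C * K) + 1) / (energy l x - mF * L)"
      have "0 \<le> K + C * K" using Z[OF x] by linarith
      then have T: "0 \<le> T" using pe by (simp add: T_def)
      have "S l T ` A l = A l" using ga T unfolding global_attractor_def by blast
      then obtain y where y: "y \<in> A l" "x = S l T y" using x by blast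
      have y0: "S l 0 y = y" and sol: "bresse_sol L \<rho>1 \<rho>2 b k k0 l g f (\<lambda>t. S l t y)"
        using bresse l in6[OF y(1)] by blast+
      have two: "p - q \<le> 2 * r" if "p \<le> r" "- q \<le> r" for p q r :: real using that by linarith
      have "2 * (K + C * K) + 1 = T * (energy l x - mF * L)" using pe by (simp add: T_def)
      also have "\<dots> \<le> (cross y + C * energy l y) - (cross x + C * energy l x)"
        using decay[OF l sol T] unfolding y0 y(2)[symmetric] .
      also have "\<dots> \<le> 2 * (K + C * K)" by (rule two[OF abs_le_D1[OF Z[OF y(1)]] abs_le_D2[OF Z[OF x]]])
      finally show False by simp
    qed
    then show ?thesis using R[of l x] l in6[OF x] by simp
  qed
  then show ?thesis by blast
qed

end

section \<open>Comparison with the Timoshenko system\<close>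

lemma ip_dx_diff_right:
  assumes "h10 L u" "h10 L v" "l2 L w"
  shows "ip L w (dx L (\<lambda>x. u x - v x)) = ip L w (\<lambda>x. dx L u x - dx L v x)"
  using h10_diff[OF assms(1,2)] assms by (intro ip_cong_AE) (auto intro: dx_l2)

lemma h1_curve_zero: "h1_curve L (\<lambda>t x. 0)"
  unfolding h1_curve_def by (simp add: h10_zero l2_curve_const dx_l2)

lemma h1_curve_diff:
  assumes "h1_curve L u" "h1_curve L v"
  shows "h1_curve L (\<lambda>t x. u t x - v t x)"
proof (rule h1_curveI_dist)
  fix t :: real assume t: "0 \<le> t"
  show "h10 L (\<lambda>x. u t x - v t x)" using assms t by (intro h10_diff(1) h1_curve_h10)
  have "l2_curve L (\<lambda>t x. dx L (u t) x - dx L (v t) x)"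
    by (intro l2_curve_diff h1_curve_dx assms)
  from l2_curve_tendsto[OF this t]
  show "((\<lambda>s. nrm L (\<lambda>x. (dx L (u s) x - dx L (v s) x) - (dx L (u t) x - dx L (v t) x))) \<longlongrightarrow> 0) (at t within {0..})" .
next
  fix s t :: real assume st: "0 \<le> s" "0 \<le> t"
  note h = h1_curve_h10[OF assms(1) st(1)] h1_curve_h10[OF assms(2) st(1)]
    h1_curve_h10[OF assms(1) st(2)] h1_curve_h10[OF assms(2) st(2)]
  have "nrm L (dx L (\<lambda>x. (u s x - v s x) - (u t x - v t x)))
      = nrm L (\<lambda>x. dx L (\<lambda>x. u s x - v s x) x - dx L (\<lambda>x. u t x - v t x) x)"
    using h by (intro nrm_dx_diff h10_diff(1))
  also have "\<dots> = nrm L (\<lambda>x. (dx L (u s) x - dx L (v s) x) - (dx L (u t) x - dx L (v t) x))"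
  proof (rule nrm_cong_AE)
    show "AE x in mu L. dx L (\<lambda>x. u s x - v s x) x - dx L (\<lambda>x. u t x - v t x) x
        = (dx L (u s) x - dx L (v s) x) - (dx L (u t) x - dx L (v t) x)"
      using h10_diff(2)[OF h(1,2)] h10_diff(2)[OF h(3,4)] by eventually_elim simp
  qed (intro l2_diff dx_l2 h10_diff(1) h)+
  finally show "nrm L (dx L (\<lambda>x. (u s x - v s x) - (u t x - v t x)))
      \<le> nrm L (\<lambda>x. (dx L (u s) x - dx L (v s) x) - (dx L (u t) x - dx L (v t) x))" by simp
qed

definition tshear :: "real \<Rightarrow> st4 \<Rightarrow> rfun" where
  "tshear L V = (\<lambda>x. dx L (d1 V) x + d2 V x)"

definition tsrc :: "(real \<times> real \<times> real \<Rightarrow> real) \<Rightarrow> st4 \<Rightarrow> rfun" where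
  "tsrc f V = (\<lambda>x. f (d1 V x, d2 V x, 0))"

lemma proj_components:
  "d1 (proj U) = c1 U" "d2 (proj U) = c2 U" "d3 (proj U) = c4 U" "d4 (proj U) = c5 U"
  by (simp_all add: proj_def d1_def d2_def d3_def d4_def)

lemma Gronwall_quadratic:
  fixes D D' :: "real \<Rightarrow> real"
  assumes d: "\<And>t. 0 \<le> t \<Longrightarrow> t \<le> T \<Longrightarrow> (D has_real_derivative D' t) (at t within {0..})"
    and le: "\<And>t. 0 \<le> t \<Longrightarrow> t \<le> T \<Longrightarrow> D' t \<le> A + G * D t"
    and D0: "D 0 = 0" and nn: "0 \<le> A" "0 \<le> G" "0 \<le> T"
  shows "D T \<le> A * T * exp (G * T)"
proof -
  have "D T * exp (- (G * T)) - A * T \<le> D 0 * exp (- (G * 0)) - A * 0"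
  proof (rule deriv_within_half_line_nonpos[where f="\<lambda>t. D t * exp (- (G * t)) - A * t" and T=T
        and f'="\<lambda>t. (D' t * exp (- (G * t)) + (exp (- (G * t)) * - G) * D t) - A"])
    fix t assume t: "0 \<le> t" "t \<le> T"
    have "((\<lambda>t. exp (- (G * t))) has_real_derivative exp (- (G * t)) * - G) (at t within {0..})"
      by (auto intro!: derivative_eq_intros)
    from DERIV_diff[OF DERIV_mult[OF d[OF t] this] DERIV_cmult_Id[of A]]
    show "((\<lambda>t. D t * exp (- (G * t)) - A * t) has_real_derivative
        (D' t * exp (- (G * t)) + (exp (- (G * t)) * - G) * D t) - A) (at t within {0..})" .
    have e: "0 < exp (- (G * t))" "exp (- (G * t)) \<le> 1" using t nn by simp_all
    have "(D' t - G * D t) * exp (- (G * t)) \<le> A * exp (- (G * t))"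
      using le[OF t] e by (intro mult_right_mono) auto
    also have "\<dots> \<le> A * 1" using e nn by (intro mult_left_mono) auto
    finally show "(D' t * exp (- (G * t)) + (exp (- (G * t)) * - G) * D t) - A \<le> 0"
      by (simp add: algebra_simps)
  qed (use nn in auto)
  then have "D T * exp (- (G * T)) \<le> A * T" using D0 by simp
  then have "D T * exp (- (G * T)) * exp (G * T) \<le> A * T * exp (G * T)" by (intro mult_right_mono) auto
  then show ?thesis by (simp add: mult.assoc flip: exp_add)
qed

text \<open>The Gronwall bound is only available while \<open>D \<le> 1\<close>, which a continuity argument then extends
  to all times.\<close>

lemma bootstrap:
  fixes D :: "real \<Rightarrow> real"
  assumes c: "continuous_on {0..T} D" and T: "0 \<le> T" and D0: "D 0 < 1" and B: "B < 1"
    and step: "\<And>\<tau>. 0 \<le> \<tau> \<Longrightarrow> \<tau> \<le> T \<Longrightarrow> (\<And>t. 0 \<le> t \<Longrightarrow> t \<le> \<tau> \<Longrightarrow> D t \<le> 1) \<Longrightarrow> D \<tau> \<le> B"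
  shows "D T \<le> B"
proof -
  have lt: "D t < 1" if t: "0 \<le> t" "t \<le> T" for t
  proof (rule ccontr)
    assume n: "\<not> D t < 1"
    \<comment> \<open>Its infimum is the first time at which D reaches 1, attained because D is
      continuous.\<close>
    define S where "S = {s \<in> {0..T}. 1 \<le> D s}"
    have tS: "t \<in> S" using n t by (simp add: S_def)
    have "S = {0..T} \<inter> D -` {1..}" by (auto simp: S_def)
    then have "closed S" using continuous_closed_preimage[OF c closed_atLeastAtMost closed_atLeast] by simp
    moreover have "bdd_below S" unfolding S_def by (intro bdd_belowI[of _ 0]) auto
    ultimately have "Inf S \<in> S" using tS by (intro closed_contains_Inf) auto
    then have I: "0 \<le> Inf S" "Inf S \<le> T" "1 \<le> D (Inf S)" by (auto simp: S_def)
    have below: "D s < 1" if "0 \<le> s" "s < Inf S" for s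
    proof (rule ccontr)
      assume "\<not> D s < 1"
      then have "s \<in> S" using that I by (simp add: S_def)
      then have "Inf S \<le> s" using \<open>bdd_below S\<close> by (rule cInf_lower)
      then show False using that by simp
    qed
    \<comment> \<open>If D exceeded 1 there, the intermediate value theorem would give an earlier
      time with value 1. The step hypothesis then applies up to and including the first
      time.\<close>
    have "D (Inf S) \<le> 1"
    proof (rule ccontr)
      assume gt: "\<not> D (Inf S) \<le> 1"
      have "continuous_on {0..Inf S} D" using I by (intro continuous_on_subset[OF c]) auto
      then obtain s where s: "0 \<le> s" "s \<le> Inf S" "D s = 1"
        using IVT'[of D 0 1 "Inf S"] D0 gt I by auto
      then show False using below[of s] gt by (cases "s = Inf S") auto
    qed
    then have "D (Inf S) \<le> B"
      using below I by (intro step) (auto simp: le_less)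
    then show False using I B by simp
  qed
  show ?thesis by (rule step[OF T order_refl]) (use lt in \<open>auto intro: less_imp_le\<close>)
qed

section \<open>Energy estimate for the difference of the two flows\<close>

context bresse_data
begin

lemma timo_momentum:
  assumes V: "timo_sol L \<rho>1 \<rho>2 b k g f V" and h: "h10 L h" and t: "0 \<le> t"
  shows "((\<lambda>t. \<rho>1 * ip L (d3 (V t)) h) has_real_derivative
      - k * ip L (tshear L (V t)) (dx L h) - ip L (\<lambda>x. g 1 (d3 (V t) x)) h - ip L (tsrc (f 1) (V t)) h) (at t within {0..})"
    "((\<lambda>t. \<rho>2 * ip L (d4 (V t)) h) has_real_derivative
      - b * ip L (dx L (d2 (V t))) (dx L h) - k * ip L (tshear L (V t)) h
      - ip L (\<lambda>x. g 2 (d4 (V t) x)) h - ip L (tsrc (f 2) (V t)) h) (at t within {0..})"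
    and "l2_curve L (\<lambda>t. tshear L (V t))"
    "l2_curve L (\<lambda>t. tsrc (f 1) (V t))" "l2_curve L (\<lambda>t. tsrc (f 2) (V t))"
proof -
  note c = timo_curves[OF V]
  note d = h1_curve_dx[OF c(1)] h1_curve_dx[OF c(2)]
  note u = h1_curve_l2_curve[OF L0 c(1)] h1_curve_l2_curve[OF L0 c(2)]
  show X: "l2_curve L (\<lambda>t. tshear L (V t))"
    unfolding tshear_def by (intro l2_curve_add d u)
  show f: "l2_curve L (\<lambda>t. tsrc (f 1) (V t))" "l2_curve L (\<lambda>t. tsrc (f 2) (V t))"
    unfolding tsrc_def by (intro source_curve c h1_curve_zero; simp)+
  have gc: "l2_curve L (\<lambda>t x. g 1 (d3 (V t) x))" "l2_curve L (\<lambda>t x. g 2 (d4 (V t) x))"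
    by (intro damping_curve c; simp)+
  have h': "l2 L h" "l2 L (dx L h)" using h h10_l2 dx_l2 by auto
  note ci = ip_continuous_const
  have eq: "\<rho>1 * ip L (d3 (V t)) h - \<rho>1 * ip L (d3 (V 0)) h = integral {0..t} (\<lambda>s.
      - k * ip L (tshear L (V s)) (dx L h) - ip L (\<lambda>x. g 1 (d3 (V s) x)) h - ip L (tsrc (f 1) (V s)) h) \<and>
    \<rho>2 * ip L (d4 (V t)) h - \<rho>2 * ip L (d4 (V 0)) h = integral {0..t} (\<lambda>s.
      - b * ip L (dx L (d2 (V s))) (dx L h) - k * ip L (tshear L (V s)) h
      - ip L (\<lambda>x. g 2 (d4 (V s) x)) h - ip L (tsrc (f 2) (V s)) h)" if "0 \<le> t" for t
    using V h that unfolding timo_sol_def tshear_def tsrc_def by blast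
  show "((\<lambda>t. \<rho>1 * ip L (d3 (V t)) h) has_real_derivative
      - k * ip L (tshear L (V t)) (dx L h) - ip L (\<lambda>x. g 1 (d3 (V t) x)) h - ip L (tsrc (f 1) (V t)) h) (at t within {0..})"
    by (rule FTC_within_half_line[OF _ conjunct1[OF eq] t])
       (intro continuous_on_add continuous_on_diff continuous_on_mult continuous_on_const ci X f gc d h')
  show "((\<lambda>t. \<rho>2 * ip L (d4 (V t)) h) has_real_derivative
      - b * ip L (dx L (d2 (V t))) (dx L h) - k * ip L (tshear L (V t)) h
      - ip L (\<lambda>x. g 2 (d4 (V t) x)) h - ip L (tsrc (f 2) (V t)) h) (at t within {0..})"
    by (rule FTC_within_half_line[OF _ conjunct2[OF eq] t])
       (intro continuous_on_add continuous_on_diff continuous_on_mult continuous_on_const ci X f gc d h')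
qed

text \<open>Twice the potential-free Timoshenko energy of \<open>proj U - V\<close>. It subtracts
  the chosen derivatives instead of applying \<open>dx\<close> to the difference, so the shear
  strains split pointwise and not just almost everywhere.\<close>

definition gap_energy :: "st6 \<Rightarrow> st4 \<Rightarrow> real" where
  "gap_energy U V = \<rho>1 * (nrm L (\<lambda>x. c4 U x - d3 V x))\<^sup>2 + \<rho>2 * (nrm L (\<lambda>x. c5 U x - d4 V x))\<^sup>2
    + k * (nrm L (\<lambda>x. (dx L (c1 U) x - dx L (d1 V) x) + (c2 U x - d2 V x)))\<^sup>2
    + b * (nrm L (\<lambda>x. dx L (c2 U) x - dx L (d2 V) x))\<^sup>2"

text \<open>Integrating \<open>\<langle>w, h'\<rangle>\<close> by parts turns all \<open>l\<close>-dependent terms of the first two Bresse equations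
  into \<open>L\<^sup>2\<close> perturbations of the Timoshenko system.\<close>

definition gap_force1 :: "real \<Rightarrow> st6 \<Rightarrow> st4 \<Rightarrow> rfun" where
  "gap_force1 l U V = (\<lambda>x. l * (k * dx L (c3 U) x + k0 * axial L l U x)
    - (g 1 (c4 U x) - g 1 (d3 V x)) - (src (f 1) U x - tsrc (f 1) V x))"

definition gap_force2 :: "real \<Rightarrow> st6 \<Rightarrow> st4 \<Rightarrow> rfun" where
  "gap_force2 l U V = (\<lambda>x. l * (- k * c3 U x)
    - (g 2 (c5 U x) - g 2 (d4 V x)) - (src (f 2) U x - tsrc (f 2) V x))"

text \<open>The two weak systems are subtracted. The Timoshenko elastic form of the difference is
  the symmetric part of the energy identity, and everything else is a force in L^2.\<close>

lemma gap_energy_derivative: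
  assumes U: "bresse_sol L \<rho>1 \<rho>2 b k k0 l g f U" and V: "timo_sol L \<rho>1 \<rho>2 b k g f V" and T: "0 \<le> T"
  shows "((\<lambda>t. gap_energy (U t) (V t)) has_real_derivative
    2 * (ip L (gap_force1 l (U T) (V T)) (\<lambda>x. c4 (U T) x - d3 (V T) x)
       + ip L (gap_force2 l (U T) (V T)) (\<lambda>x. c5 (U T) x - d4 (V T) x))) (at T within {0..})"
proof -
  note c = bresse_curves[OF U] and e = timo_curves[OF V]
  note dc = h1_curve_dx[OF c(1)] h1_curve_dx[OF c(2)] h1_curve_dx[OF c(3)]
  note de = h1_curve_dx[OF e(1)] h1_curve_dx[OF e(2)]
  note uc = h1_curve_l2_curve[OF L0 c(1)] h1_curve_l2_curve[OF L0 c(2)] h1_curve_l2_curve[OF L0 c(3)]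
  note ue = h1_curve_l2_curve[OF L0 e(1)] h1_curve_l2_curve[OF L0 e(2)]
  note mU = bresse_momentum[OF U] and mV = timo_momentum[OF V]
  have h0: "h10 L (\<lambda>x. 0)" by (rule h10_zero)
  note X = mU(4)[OF h0 order_refl] and Y = mU(5)[OF h0 order_refl] and fU = mU(6)[OF h0 order_refl] mU(7)[OF h0 order_refl]
  note XV = mV(3)[OF h0 order_refl] and fV = mV(4)[OF h0 order_refl] mV(5)[OF h0 order_refl]
  have gU: "l2_curve L (\<lambda>t x. g 1 (c4 (U t) x))" "l2_curve L (\<lambda>t x. g 2 (c5 (U t) x))"
    by (intro damping_curve c; simp)+
  have gV: "l2_curve L (\<lambda>t x. g 1 (d3 (V t) x))" "l2_curve L (\<lambda>t x. g 2 (d4 (V t) x))"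
    by (intro damping_curve e; simp)+
  define z1 where "z1 = (\<lambda>t x. c1 (U t) x - d1 (V t) x)"
  define z2 where "z2 = (\<lambda>t x. c2 (U t) x - d2 (V t) x)"
  define y1 where "y1 = (\<lambda>t x. c4 (U t) x - d3 (V t) x)"
  define y2 where "y2 = (\<lambda>t x. c5 (U t) x - d4 (V t) x)"
  define q1 where "q1 = (\<lambda>t. gap_force1 l (U t) (V t))"
  define q2 where "q2 = (\<lambda>t. gap_force2 l (U t) (V t))"
  define Z where "Z = (\<lambda>t x. (dx L (c1 (U t)) x - dx L (d1 (V t)) x) + (c2 (U t) x - d2 (V t) x))"
  define B where "B = (\<lambda>t x. dx L (c2 (U t)) x - dx L (d2 (V t)) x)"
  have z: "h1_curve L z1" "h1_curve L z2"
    unfolding z1_def z2_def by (intro h1_curve_diff c e)+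
  have zl: "l2_curve L z1" "l2_curve L z2" using z h1_curve_l2_curve[OF L0] by auto
  have y: "l2_curve L y1" "l2_curve L y2"
    unfolding y1_def y2_def by (intro l2_curve_diff c e)+
  have ZB: "l2_curve L Z" "l2_curve L B"
    unfolding Z_def B_def by (intro l2_curve_add l2_curve_diff dc de uc ue)+
  have w: "l2_curve L (\<lambda>t x. k * dx L (c3 (U t)) x + k0 * axial L l (U t) x)"
    by (intro l2_curve_add l2_curve_cmult dc Y)
  have q: "l2_curve L q1" "l2_curve L q2"
    unfolding q1_def q2_def gap_force1_def gap_force2_def
    by (intro l2_curve_diff l2_curve_cmult w uc gU gV fU fV)+
  have zero: "l2_curve L (\<lambda>t x. 0)" by (intro l2_curve_const) simp
  have vel: "((\<lambda>t. ip L (z1 t) h) has_real_derivative ip L (y1 t) h) (at t within {0..})"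
    "((\<lambda>t. ip L (z2 t) h) has_real_derivative ip L (y2 t) h) (at t within {0..})"
    if h: "l2 L h" and t: "0 \<le> t" for h t
  proof -
    note vU = bresse_velocity[OF U h t] and vV = timo_velocity[OF V h t]
    have "((\<lambda>t. ip L (c1 (U t)) h - ip L (d1 (V t)) h) has_real_derivative ip L (y1 t) h) (at t within {0..})"
      by (rule DERIV_cong[OF DERIV_diff[OF vU(1) vV(1)]])
         (simp add: y1_def ip_diff_left l2_curve_l2[OF c(4) t] l2_curve_l2[OF e(3) t] h)
    then show "((\<lambda>t. ip L (z1 t) h) has_real_derivative ip L (y1 t) h) (at t within {0..})"
      by (rule has_field_derivative_transform_within[OF _ zero_less_one])
         (use t in \<open>simp_all add: z1_def ip_diff_left l2_curve_l2[OF uc(1)] l2_curve_l2[OF ue(1)] h\<close>)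
    have "((\<lambda>t. ip L (c2 (U t)) h - ip L (d2 (V t)) h) has_real_derivative ip L (y2 t) h) (at t within {0..})"
      by (rule DERIV_cong[OF DERIV_diff[OF vU(2) vV(2)]])
         (simp add: y2_def ip_diff_left l2_curve_l2[OF c(5) t] l2_curve_l2[OF e(4) t] h)
    then show "((\<lambda>t. ip L (z2 t) h) has_real_derivative ip L (y2 t) h) (at t within {0..})"
      by (rule has_field_derivative_transform_within[OF _ zero_less_one])
         (use t in \<open>simp_all add: z2_def ip_diff_left l2_curve_l2[OF uc(2)] l2_curve_l2[OF ue(2)] h\<close>)
  qed
  \<comment> \<open>The Bresse shear is the Timoshenko shear plus the shear of the difference plus l
    w; only the last term is foreign to the Timoshenko system.\<close>
  have ipZ: "ip L (shear L l (U t)) h = ip L (tshear L (V t)) h + ip L (Z t) h + l * ip L (c3 (U t)) h"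
    if h: "l2 L h" and t: "0 \<le> t" for h t
  proof -
    have "shear L l (U t) = (\<lambda>x. tshear L (V t) x + (Z t x + l * c3 (U t) x))"
      by (auto simp: shear_def tshear_def Z_def)
    moreover note l2_curve_l2[OF XV t] l2_curve_l2[OF ZB(1) t] l2_curve_l2[OF uc(3) t]
    ultimately show ?thesis using h by (simp add: ip_add_left ip_cmult_left l2_add l2_cmult)
  qed
  have ipB: "ip L (dx L (c2 (U t))) h = ip L (dx L (d2 (V t))) h + ip L (B t) h"
    if h: "l2 L h" and t: "0 \<le> t" for h t
    using h by (simp add: B_def ip_diff_left l2_curve_l2[OF dc(2) t] l2_curve_l2[OF de(2) t])
  have ipq: "ip L (q1 t) h = l * (k * ip L (dx L (c3 (U t))) h + k0 * ip L (axial L l (U t)) h)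
      - (ip L (\<lambda>x. g 1 (c4 (U t) x)) h - ip L (\<lambda>x. g 1 (d3 (V t) x)) h)
      - (ip L (src (f 1) (U t)) h - ip L (tsrc (f 1) (V t)) h)"
    "ip L (q2 t) h = l * (- k * ip L (c3 (U t)) h)
      - (ip L (\<lambda>x. g 2 (c5 (U t) x)) h - ip L (\<lambda>x. g 2 (d4 (V t) x)) h)
      - (ip L (src (f 2) (U t)) h - ip L (tsrc (f 2) (V t)) h)"
    if h: "l2 L h" and t: "0 \<le> t" for h t
  proof -
    note l = l2_curve_l2[OF dc(3) t] l2_curve_l2[OF Y t] l2_curve_l2[OF gU(1) t] l2_curve_l2[OF gU(2) t]
      l2_curve_l2[OF gV(1) t] l2_curve_l2[OF gV(2) t] l2_curve_l2[OF fU(1) t] l2_curve_l2[OF fU(2) t]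
      l2_curve_l2[OF fV(1) t] l2_curve_l2[OF fV(2) t] l2_curve_l2[OF uc(3) t] l2_curve_l2[OF w t]
    show "ip L (q1 t) h = l * (k * ip L (dx L (c3 (U t))) h + k0 * ip L (axial L l (U t)) h)
      - (ip L (\<lambda>x. g 1 (c4 (U t) x)) h - ip L (\<lambda>x. g 1 (d3 (V t) x)) h)
      - (ip L (src (f 1) (U t)) h - ip L (tsrc (f 1) (V t)) h)"
      unfolding q1_def gap_force1_def using l h
      by (simp only: ip_diff_left ip_cmult_left ip_add_left l2_diff l2_cmult l2_add)
    show "ip L (q2 t) h = l * (- k * ip L (c3 (U t)) h)
      - (ip L (\<lambda>x. g 2 (c5 (U t) x)) h - ip L (\<lambda>x. g 2 (d4 (V t) x)) h)
      - (ip L (src (f 2) (U t)) h - ip L (tsrc (f 2) (V t)) h)"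
      unfolding q2_def gap_force2_def using l h
      by (simp only: ip_diff_left ip_cmult_left ip_add_left l2_diff l2_cmult l2_add)
  qed
  define a where "a = (\<lambda>s r. k * ip L (Z s) (Z r) + b * ip L (B s) (B r))"
  have sym: "a s r = a r s" for s r
    unfolding a_def by (simp only: ip_commute[of L "Z s"] ip_commute[of L "B s"])
  have Ns: "((\<lambda>s. \<rho>1 * ip L (y1 s) (z1 r) + \<rho>2 * ip L (y2 s) (z2 r) + 0 * ip L (\<lambda>x. 0) (\<lambda>x. 0))
      has_real_derivative - a s r + (ip L (q1 s) (z1 r) + ip L (q2 s) (z2 r) + ip L (\<lambda>x. 0) (\<lambda>x. 0))) (at s within {0..})"
    if s: "0 \<le> s" and r: "0 \<le> r" for s r
  proof -
    note h = h1_curve_h10[OF z(1) r] h1_curve_h10[OF z(2) r]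
    note hl = h10_l2[OF h(1)] h10_l2[OF h(2)] and hd = dx_l2[OF h(1)] dx_l2[OF h(2)]
    note Zs = l2_curve_l2[OF ZB(1) s] and Bs = l2_curve_l2[OF ZB(2) s]
    note cr = h1_curve_h10[OF c(1) r] h1_curve_h10[OF c(2) r] h1_curve_h10[OF e(1) r] h1_curve_h10[OF e(2) r]
    have e1: "ip L (Z s) (Z r) = ip L (Z s) (dx L (z1 r)) + ip L (Z s) (z2 r)"
    proof -
      have "ip L (Z s) (Z r) = ip L (Z s) (\<lambda>x. dx L (c1 (U r)) x - dx L (d1 (V r)) x) + ip L (Z s) (z2 r)"
        unfolding Z_def z2_def
        using Zs hl(2) dx_l2[OF cr(1)] dx_l2[OF cr(3)] by (simp add: ip_add_right l2_diff Z_def z2_def)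
      then show ?thesis unfolding z1_def using ip_dx_diff_right[OF cr(1,3) Zs] by simp
    qed
    have e2: "ip L (B s) (B r) = ip L (B s) (dx L (z2 r))"
      unfolding z2_def using ip_dx_diff_right[OF cr(2,4) Bs] by (simp add: B_def)
    \<comment> \<open>In the first equation l w is paired with the derivative of the test function.
      Moving that derivative onto w, possible since w is in H^1_0, yields an L^2 force.\<close>
    have parts: "ip L (c3 (U s)) (dx L (z1 r)) = - ip L (dx L (c3 (U s))) (z1 r)"
      using ip_dx_parts[OF h1_curve_h10[OF c(3) s] h(1) L0] by simp
    have split: "\<rho>1 * ip L (y1 s) (z1 r) + \<rho>2 * ip L (y2 s) (z2 r) =
       (\<rho>1 * ip L (c4 (U s)) (z1 r) - \<rho>1 * ip L (d3 (V s)) (z1 r)) + (\<rho>2 * ip L (c5 (U s)) (z2 r) - \<rho>2 * ip L (d4 (V s)) (z2 r))"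
      if "0 \<le> s" for s
      unfolding y1_def y2_def using that hl
      by (simp add: ip_diff_left l2_curve_l2[OF c(4)] l2_curve_l2[OF c(5)] l2_curve_l2[OF e(3)] l2_curve_l2[OF e(4)] right_diff_distrib)
    have "((\<lambda>s. (\<rho>1 * ip L (c4 (U s)) (z1 r) - \<rho>1 * ip L (d3 (V s)) (z1 r)) + (\<rho>2 * ip L (c5 (U s)) (z2 r) - \<rho>2 * ip L (d4 (V s)) (z2 r)))
      has_real_derivative - a s r + (ip L (q1 s) (z1 r) + ip L (q2 s) (z2 r))) (at s within {0..})"
      by (rule DERIV_cong[OF DERIV_add[OF DERIV_diff[OF mU(1)[OF h(1) s] mV(1)[OF h(1) s]] DERIV_diff[OF mU(2)[OF h(2) s] mV(2)[OF h(2) s]]]])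
         (simp del: One_nat_def add: a_def e1 e2 ipq[OF hl(1) s] ipq[OF hl(2) s] ipZ[OF hd(1) s] ipZ[OF hl(2) s] ipB[OF hd(2) s] parts algebra_simps)
    then have "((\<lambda>s. \<rho>1 * ip L (y1 s) (z1 r) + \<rho>2 * ip L (y2 s) (z2 r))
      has_real_derivative - a s r + (ip L (q1 s) (z1 r) + ip L (q2 s) (z2 r))) (at s within {0..})"
      by (rule has_field_derivative_transform_within[OF _ zero_less_one]) (use s split in auto)
    moreover have "ip L (\<lambda>x. 0) (\<lambda>x. 0) = 0" by (simp add: ip_eq)
    ultimately show ?thesis by simp
  qed
  have vel0: "((\<lambda>t. ip L (\<lambda>x. 0) h) has_real_derivative ip L (\<lambda>x. 0) h) (at t within {0..})" for h t
    by (simp add: ip_eq)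
  \<comment> \<open>The third component of the general identity is filled with zero
    functions.\<close>
  have "((\<lambda>t. \<rho>1 * (nrm L (y1 t))\<^sup>2 + \<rho>2 * (nrm L (y2 t))\<^sup>2 + 0 * (nrm L (\<lambda>x. 0))\<^sup>2 + a t t)
      has_real_derivative 2 * (ip L (q1 T) (y1 T) + ip L (q2 T) (y2 T) + ip L (\<lambda>x. 0) (\<lambda>x. 0))) (at T within {0..})"
    by (rule wave_energy_identity[where ?u3.0="\<lambda>t x. 0" and ?v3.0="\<lambda>t x. 0" and ?q3.0="\<lambda>t x. 0",
          OF zl zero y zero q zero vel vel0 Ns sym T])
  moreover have "\<rho>1 * (nrm L (y1 t))\<^sup>2 + \<rho>2 * (nrm L (y2 t))\<^sup>2 + 0 * (nrm L (\<lambda>x. 0))\<^sup>2 + a t t = gap_energy (U t) (V t)" for t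
    by (simp add: gap_energy_def a_def y1_def y2_def Z_def B_def nrm_square)
  moreover have "ip L (\<lambda>x. 0) (\<lambda>x. 0) = 0" by (simp add: ip_eq)
  ultimately show ?thesis by (simp add: q1_def q2_def y1_def y2_def)
qed

text \<open>The \<gamma>3-inequality at l = 0, applied to the displacement difference with third
  component zero, is coercivity of the Timoshenko elastic form. Summing the three constants in
  \<kappa> gives one factor for all four norms.\<close>

lemma gap_coercive:
  assumes U: "inH6 L U" and V: "inH4 L V" and \<kappa>: "\<kappa> = \<gamma>3 + 1 / \<rho>1 + 1 / \<rho>2"
  shows "0 \<le> gap_energy U V"
    and "(nrm L (\<lambda>x. dx L (c1 U) x - dx L (d1 V) x))\<^sup>2 \<le> \<kappa> * gap_energy U V"
    and "(nrm L (\<lambda>x. dx L (c2 U) x - dx L (d2 V) x))\<^sup>2 \<le> \<kappa> * gap_energy U V"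
    and "(nrm L (\<lambda>x. c4 U x - d3 V x))\<^sup>2 \<le> \<kappa> * gap_energy U V"
    and "(nrm L (\<lambda>x. c5 U x - d4 V x))\<^sup>2 \<le> \<kappa> * gap_energy U V"
proof -
  let ?z1 = "\<lambda>x. c1 U x - d1 V x" and ?z2 = "\<lambda>x. c2 U x - d2 V x"
  let ?D1 = "\<lambda>x. dx L (c1 U) x - dx L (d1 V) x" and ?D2 = "\<lambda>x. dx L (c2 U) x - dx L (d2 V) x"
  let ?Z = "\<lambda>x. ?D1 x + ?z2 x"
  have h: "h10 L (c1 U)" "h10 L (c2 U)" "h10 L (d1 V)" "h10 L (d2 V)" using U V by (auto simp: inH6_def inH4_def)
  have hz: "h10 L ?z1" "h10 L ?z2" using h h10_diff(1) by auto
  have nz: "nrm L (dx L (\<lambda>x. 0)) = 0"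
    using nrm_cong_AE[OF dx_zero_AE dx_l2[OF h10_zero]] by simp
  have nZ: "nrm L (\<lambda>x. dx L ?z1 x + ?z2 x) = nrm L ?Z"
  proof (rule nrm_cong_AE)
    show "AE x in mu L. dx L ?z1 x + ?z2 x = ?Z x"
      using h10_diff(2)[OF h(1,3)] by eventually_elim simp
  qed (intro l2_add l2_diff dx_l2 h10_l2 hz h)+
  have "(nrm L (dx L ?z1))\<^sup>2 + (nrm L (dx L ?z2))\<^sup>2 + (nrm L (dx L (\<lambda>x. 0)))\<^sup>2
     \<le> \<gamma>3 * (b * (nrm L (dx L ?z2))\<^sup>2 + k * (nrm L (\<lambda>x. dx L ?z1 x + ?z2 x + 0 * 0))\<^sup>2
        + k0 * (nrm L (\<lambda>x. dx L (\<lambda>x. 0) x - 0 * ?z1 x))\<^sup>2)"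
    by (rule gamma3(3)[rule_format, of 0 ?z1 ?z2 "\<lambda>x. 0"]) (use gamma3(1) hz h10_zero in auto)
  then have g: "(nrm L ?D1)\<^sup>2 + (nrm L ?D2)\<^sup>2 \<le> \<gamma>3 * (b * (nrm L ?D2)\<^sup>2 + k * (nrm L ?Z)\<^sup>2)"
    by (simp add: nz nZ nrm_dx_diff h)
  define a where "a = b * (nrm L ?D2)\<^sup>2 + k * (nrm L ?Z)\<^sup>2"
  define p1 where "p1 = \<rho>1 * (nrm L (\<lambda>x. c4 U x - d3 V x))\<^sup>2"
  define p2 where "p2 = \<rho>2 * (nrm L (\<lambda>x. c5 U x - d4 V x))\<^sup>2"
  have nn: "0 \<le> a" "0 \<le> p1" "0 \<le> p2" using pos by (simp_all add: a_def p1_def p2_def)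
  have E: "gap_energy U V = p1 + p2 + a" by (simp add: gap_energy_def a_def p1_def p2_def)
  show E0: "0 \<le> gap_energy U V" using nn E by simp
  have le: "x \<le> \<kappa> * gap_energy U V" if "x \<le> c * y" "y \<le> gap_energy U V" "0 \<le> c" "c \<le> \<kappa>" for x y c
  proof -
    have "c * y \<le> c * gap_energy U V" using that by (intro mult_left_mono)
    also have "\<dots> \<le> \<kappa> * gap_energy U V" using that E0 by (intro mult_right_mono)
    finally show ?thesis using that(1) by simp
  qed
  have \<kappa>le: "0 \<le> \<gamma>3" "\<gamma>3 \<le> \<kappa>" "0 \<le> 1 / \<rho>1" "1 / \<rho>1 \<le> \<kappa>" "0 \<le> 1 / \<rho>2" "1 / \<rho>2 \<le> \<kappa>"
    using pos gamma3(2) by (simp_all add: \<kappa>)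
  have "(nrm L ?D1)\<^sup>2 \<le> \<gamma>3 * a" "(nrm L ?D2)\<^sup>2 \<le> \<gamma>3 * a"
    using g zero_le_power2[of "nrm L ?D1"] zero_le_power2[of "nrm L ?D2"] unfolding a_def by linarith+
  moreover have "a \<le> gap_energy U V" using nn E by simp
  ultimately show "(nrm L ?D1)\<^sup>2 \<le> \<kappa> * gap_energy U V" "(nrm L ?D2)\<^sup>2 \<le> \<kappa> * gap_energy U V"
    using le \<kappa>le(1,2) by blast+
  show "(nrm L (\<lambda>x. c4 U x - d3 V x))\<^sup>2 \<le> \<kappa> * gap_energy U V"
    using nn E \<kappa>le pos by (intro le[of _ "1 / \<rho>1" p1]) (simp_all add: p1_def)
  show "(nrm L (\<lambda>x. c5 U x - d4 V x))\<^sup>2 \<le> \<kappa> * gap_energy U V"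
    using nn E \<kappa>le pos by (intro le[of _ "1 / \<rho>2" p2]) (simp_all add: p2_def)
qed

lemma dist4_le_gap:
  assumes U: "inH6 L U" and V: "inH4 L V" and \<kappa>: "\<kappa> = \<gamma>3 + 1 / \<rho>1 + 1 / \<rho>2"
  shows "dist4 L (proj U) V \<le> 2 * sqrt (\<kappa> * gap_energy U V)"
proof -
  have h: "h10 L (c1 U)" "h10 L (c2 U)" "h10 L (d1 V)" "h10 L (d2 V)" using U V by (auto simp: inH6_def inH4_def)
  note c = gap_coercive(2-5)[OF U V \<kappa>, THEN real_le_rsqrt]
  show ?thesis
    unfolding dist4_def using c
    by (intro nH4_le) (simp_all add: sub4_components proj_components nrm_dx_diff h)
qed

text \<open>\<gamma> stands for the damping difference, whose work has the favourable sign and is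
  discarded. The other two terms are split by Young's inequality with weight 1/2.\<close>

lemma forced_work_bound:
  assumes "l2 L w" "l2 L \<gamma>" "l2 L \<delta>" "l2 L y" "0 \<le> ip L \<gamma> y"
  shows "2 * ip L (\<lambda>x. l * w x - \<gamma> x - \<delta> x) y \<le> l\<^sup>2 * (nrm L w)\<^sup>2 + (nrm L \<delta>)\<^sup>2 + 2 * (nrm L y)\<^sup>2"
proof -
  have "ip L (\<lambda>x. l * w x - \<gamma> x - \<delta> x) y = ip L (\<lambda>x. l * w x) y - ip L \<gamma> y - ip L \<delta> y"
    using assms by (simp add: ip_diff_left l2_diff l2_cmult)
  moreover have "\<bar>ip L (\<lambda>x. l * w x) y\<bar> \<le> (nrm L (\<lambda>x. l * w x))\<^sup>2 / (4 * (1 / 2)) + 1 / 2 * (nrm L y)\<^sup>2"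
    using assms by (intro ip_young l2_cmult) auto
  moreover have "\<bar>ip L \<delta> y\<bar> \<le> (nrm L \<delta>)\<^sup>2 / (4 * (1 / 2)) + 1 / 2 * (nrm L y)\<^sup>2"
    using assms by (intro ip_young) auto
  moreover have "(nrm L (\<lambda>x. l * w x))\<^sup>2 = l\<^sup>2 * (nrm L w)\<^sup>2"
    by (simp add: nrm_cmult power_mult_distrib)
  ultimately show ?thesis using assms(5) by (simp add: abs_le_iff)
qed

lemma damping_monotone:
  assumes i: "i \<in> {1,2,3::nat}" and "l2 L u" "l2 L v"
  shows "0 \<le> ip L (\<lambda>x. g i (u x) - g i (v x)) (\<lambda>x. u x - v x)"
  unfolding ip_eq using damping(5)[OF i] by (intro integral_nonneg_AE) auto

text \<open>Only U is assumed bounded; a gap energy of at most 1 places V in a slightly larger box,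
  so the Lipschitz constants of the sources do not depend on the trajectories.\<close>

lemma gap_force_bound:
  assumes indep: "\<forall>u v w w'. f 1 (u, v, w) = f 1 (u, v, w') \<and> f 2 (u, v, w) = f 2 (u, v, w')"
    and R: "0 \<le> R"
  shows "\<exists>A\<ge>0. \<exists>G\<ge>0. \<forall>l\<in>{0<..l0}. \<forall>U V. inH6 L U \<and> inH4 L V \<and> nH6 L U \<le> R \<and> gap_energy U V \<le> 1 \<longrightarrow>
    2 * (ip L (gap_force1 l U V) (\<lambda>x. c4 U x - d3 V x) + ip L (gap_force2 l U V) (\<lambda>x. c5 U x - d4 V x))
    \<le> A * l\<^sup>2 + G * gap_energy U V"
proof -
  define \<kappa> where "\<kappa> = \<gamma>3 + 1 / \<rho>1 + 1 / \<rho>2"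
  have \<kappa>0: "0 \<le> \<kappa>" using pos gamma3(2) by (simp add: \<kappa>_def)
  \<comment> \<open>\<open>sqrt L * R\<close> bounds the components of U pointwise, and
    \<open>sqrt L * sqrt \<kappa>\<close> bounds the displacement difference when the gap energy is
    at most 1.\<close>
  define R' where "R' = sqrt L * R + sqrt L * sqrt \<kappa>"
  obtain K1 where K1: "box_lipschitz (f 1) R' K1" using f_lipschitz[of 1 R'] by auto
  obtain K2 where K2: "box_lipschitz (f 2) R' K2" using f_lipschitz[of 2 R'] by auto
  define W1 where "W1 = k * R + k0 * (R + l0 * (L * R))"
  define W2 where "W2 = k * (L * R)"
  define A where "A = W1\<^sup>2 + W2\<^sup>2"
  \<comment> \<open>Each velocity difference contributes 2 \<kappa>. In the source terms the two
    displacement differences are each at most L times the root of \<kappa> times the gap energy,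
    hence the factors 2 K1 L and 2 K2 L.\<close>
  define G where "G = 4 * \<kappa> + (2 * K1 * L)\<^sup>2 * \<kappa> + (2 * K2 * L)\<^sup>2 * \<kappa>"
  have A0: "0 \<le> A" and G0: "0 \<le> G" using \<kappa>0 by (auto simp: A_def G_def)
  have "2 * (ip L (gap_force1 l U V) (\<lambda>x. c4 U x - d3 V x) + ip L (gap_force2 l U V) (\<lambda>x. c5 U x - d4 V x))
    \<le> A * l\<^sup>2 + G * gap_energy U V"
    if l: "l \<in> {0<..l0}" and U: "inH6 L U" and V: "inH4 L V" and UR: "nH6 L U \<le> R" and gap: "gap_energy U V \<le> 1" for l U V
  proof -
    have h: "h10 L (c1 U)" "h10 L (c2 U)" "h10 L (c3 U)" "h10 L (d1 V)" "h10 L (d2 V)"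
      and v: "l2 L (c4 U)" "l2 L (c5 U)" "l2 L (d3 V)" "l2 L (d4 V)"
      using U V by (auto simp: inH6_def inH4_def)
    note n = nH6_ge[THEN order_trans, OF UR]
    note co = gap_coercive[OF U V \<kappa>_def]
    have e: "\<kappa> * gap_energy U V \<le> \<kappa>" using mult_left_mono[OF gap \<kappa>0] by simp
    let ?e = "sqrt (\<kappa> * gap_energy U V)"
    have D: "nrm L (\<lambda>x. dx L (c1 U) x - dx L (d1 V) x) \<le> ?e" "nrm L (\<lambda>x. dx L (c2 U) x - dx L (d2 V) x) \<le> ?e"
      using co(2,3) by (auto intro: real_le_rsqrt)
    have e': "?e \<le> sqrt \<kappa>" using e by simp
    have zb: "\<bar>u x - w x\<bar> \<le> sqrt L * sqrt \<kappa>"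
      if "h10 L u" "h10 L w" "nrm L (\<lambda>x. dx L u x - dx L w x) \<le> ?e" "x \<in> {0..L}" for u w x
    proof -
      have "sqrt L * nrm L (\<lambda>x. dx L u x - dx L w x) \<le> sqrt L * sqrt \<kappa>"
        using order_trans[OF that(3) e'] L0 by (intro mult_left_mono) simp_all
      then show ?thesis using h10_diff_bound[OF L0 that(1,2,4)] by simp
    qed
    have ub: "\<bar>u x\<bar> \<le> sqrt L * R" if "h10 L u" "nrm L (dx L u) \<le> R" "x \<in> {0..L}" for u x
      using h10_bound[OF L0 that(1,3)] mult_left_mono[OF that(2), of "sqrt L"] L0 by simp
    have sk: "0 \<le> sqrt L * sqrt \<kappa>" "0 \<le> R'" using L0 \<kappa>0 R by (simp_all add: R'_def)
    have bU: "\<bar>c1 U x\<bar> \<le> R' \<and> \<bar>c2 U x\<bar> \<le> R' \<and> \<bar>0::real\<bar> \<le> R'" if "x \<in> {0..L}" for x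
      using ub[OF h(1) n(1) that] ub[OF h(2) n(2) that] sk unfolding R'_def by simp
    have bV: "\<bar>d1 V x\<bar> \<le> R' \<and> \<bar>d2 V x\<bar> \<le> R' \<and> \<bar>0::real\<bar> \<le> R'" if "x \<in> {0..L}" for x
      using ub[OF h(1) n(1) that] ub[OF h(2) n(2) that] zb[OF h(1) h(4) D(1) that] zb[OF h(2) h(5) D(2) that] sk
      unfolding R'_def by auto
    have zn: "nrm L (\<lambda>x. c1 U x - d1 V x) \<le> L * ?e" "nrm L (\<lambda>x. c2 U x - d2 V x) \<le> L * ?e"
      using nrm_h10_bound[OF L0 h10_diff(1)[OF h(1) h(4)]] nrm_h10_bound[OF L0 h10_diff(1)[OF h(2) h(5)]]
        mult_left_mono[OF D(1) L0] mult_left_mono[OF D(2) L0] by (simp_all add: nrm_dx_diff h)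
    \<comment> \<open>Independence of w lets the third argument be 0 in both systems, so the
      Lipschitz bound does not contain w, which need not be small.\<close>
    have src_eq: "src (f 1) U = (\<lambda>x. f 1 (c1 U x, c2 U x, 0))" "src (f 2) U = (\<lambda>x. f 2 (c1 U x, c2 U x, 0))"
      unfolding src_def using indep by blast+
    have src_diff: "l2 L (\<lambda>x. src (f i) U x - tsrc (f i) V x)"
      "(nrm L (\<lambda>x. src (f i) U x - tsrc (f i) V x))\<^sup>2 \<le> (2 * K * L)\<^sup>2 * \<kappa> * gap_energy U V"
      if i: "i \<in> {1,2,3}" and eq: "src (f i) U = (\<lambda>x. f i (c1 U x, c2 U x, 0))" and K: "box_lipschitz (f i) R' K" for i K
    proof -
      show "l2 L (\<lambda>x. src (f i) U x - tsrc (f i) V x)"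
        unfolding eq tsrc_def by (intro l2_diff compose3_h10 f_continuous i L0 h h10_zero)
      have K0: "0 \<le> K" using K by (simp add: box_lipschitz_def)
      have "nrm L (\<lambda>x. src (f i) U x - tsrc (f i) V x)
          \<le> K * (nrm L (\<lambda>x. c1 U x - d1 V x) + nrm L (\<lambda>x. c2 U x - d2 V x) + nrm L (\<lambda>x. 0 - 0))"
        unfolding eq tsrc_def
        by (rule nrm_compose3_diff[OF f_continuous[OF i] K L0 h(1,2) h10_zero h(4,5) h10_zero bU bV])
      also have "\<dots> \<le> K * (L * ?e + L * ?e)"
        using zn K0 by (intro mult_left_mono) auto
      also have "\<dots> = (2 * K * L) * ?e" by simp
      finally have "(nrm L (\<lambda>x. src (f i) U x - tsrc (f i) V x))\<^sup>2 \<le> ((2 * K * L) * ?e)\<^sup>2"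
        by (intro power_mono) simp_all
      also have "\<dots> = (2 * K * L)\<^sup>2 * \<kappa> * gap_energy U V"
        using \<kappa>0 co(1) by (simp add: power_mult_distrib)
      finally show "(nrm L (\<lambda>x. src (f i) U x - tsrc (f i) V x))\<^sup>2 \<le> (2 * K * L)\<^sup>2 * \<kappa> * gap_energy U V" .
    qed
    have s1: "l2 L (\<lambda>x. src (f 1) U x - tsrc (f 1) V x)"
      "(nrm L (\<lambda>x. src (f 1) U x - tsrc (f 1) V x))\<^sup>2 \<le> (2 * K1 * L)\<^sup>2 * \<kappa> * gap_energy U V"
      using src_diff[OF _ src_eq(1) K1] by simp_all
    have s2: "l2 L (\<lambda>x. src (f 2) U x - tsrc (f 2) V x)"
      "(nrm L (\<lambda>x. src (f 2) U x - tsrc (f 2) V x))\<^sup>2 \<le> (2 * K2 * L)\<^sup>2 * \<kappa> * gap_energy U V"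
      using src_diff[OF _ src_eq(2) K2] by simp_all
    have un: "nrm L (c1 U) \<le> L * R" "nrm L (c3 U) \<le> L * R"
      using nrm_h10_bound[OF L0 h(1)] nrm_h10_bound[OF L0 h(3)] mult_left_mono[OF n(1) L0] mult_left_mono[OF n(3) L0]
      by linarith+
    have axl: "l2 L (axial L l U)" unfolding axial_def by (intro l2_diff l2_cmult dx_l2 h10_l2 h)
    have "nrm L (axial L l U) \<le> nrm L (dx L (c3 U)) + nrm L (\<lambda>x. l * c1 U x)"
      unfolding axial_def by (intro nrm_triangle_diff l2_cmult dx_l2 h10_l2 h)
    also have "\<dots> \<le> R + l0 * (L * R)"
      unfolding nrm_cmult using l L0 R by (intro add_mono mult_mono n un) auto
    finally have ax: "nrm L (axial L l U) \<le> R + l0 * (L * R)" .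
    have w1l: "l2 L (\<lambda>x. k * dx L (c3 U) x + k0 * axial L l U x)"
      by (intro l2_add l2_cmult dx_l2 h axl)
    have "nrm L (\<lambda>x. k * dx L (c3 U) x + k0 * axial L l U x)
        \<le> nrm L (\<lambda>x. k * dx L (c3 U) x) + nrm L (\<lambda>x. k0 * axial L l U x)"
      by (intro nrm_triangle l2_cmult dx_l2 h axl)
    also have "\<dots> \<le> W1"
      unfolding nrm_cmult W1_def using pos n(3) ax by (intro add_mono mult_mono) auto
    finally have "(nrm L (\<lambda>x. k * dx L (c3 U) x + k0 * axial L l U x))\<^sup>2 \<le> W1\<^sup>2"
      by (intro power_mono) simp_all
    then have w1: "l\<^sup>2 * (nrm L (\<lambda>x. k * dx L (c3 U) x + k0 * axial L l U x))\<^sup>2 \<le> l\<^sup>2 * W1\<^sup>2"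
      by (intro mult_left_mono) auto
    have w2l: "l2 L (\<lambda>x. - k * c3 U x)" by (intro l2_cmult h10_l2 h)
    have "nrm L (\<lambda>x. - k * c3 U x) \<le> W2"
      unfolding nrm_cmult W2_def using pos un(2) by (intro mult_mono) auto
    then have "(nrm L (\<lambda>x. - k * c3 U x))\<^sup>2 \<le> W2\<^sup>2" by (intro power_mono) simp_all
    then have w2: "l\<^sup>2 * (nrm L (\<lambda>x. - k * c3 U x))\<^sup>2 \<le> l\<^sup>2 * W2\<^sup>2" by (intro mult_left_mono) auto
    have gl: "l2 L (\<lambda>x. g 1 (c4 U x) - g 1 (d3 V x))" "l2 L (\<lambda>x. g 2 (c5 U x) - g 2 (d4 V x))"
      by (intro l2_diff damping_l2(1) v; simp)+
    have yl: "l2 L (\<lambda>x. c4 U x - d3 V x)" "l2 L (\<lambda>x. c5 U x - d4 V x)" using v by auto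
    have "0 \<le> ip L (\<lambda>x. g 1 (c4 U x) - g 1 (d3 V x)) (\<lambda>x. c4 U x - d3 V x)"
      "0 \<le> ip L (\<lambda>x. g 2 (c5 U x) - g 2 (d4 V x)) (\<lambda>x. c5 U x - d4 V x)"
      by (rule damping_monotone; simp add: v)+
    note fw = forced_work_bound[OF w1l gl(1) s1(1) yl(1) this(1), of l] forced_work_bound[OF w2l gl(2) s2(1) yl(2) this(2), of l]
    have b1: "2 * ip L (gap_force1 l U V) (\<lambda>x. c4 U x - d3 V x)
        \<le> l\<^sup>2 * W1\<^sup>2 + (2 * K1 * L)\<^sup>2 * \<kappa> * gap_energy U V + 2 * (\<kappa> * gap_energy U V)"
      unfolding gap_force1_def using fw(1) w1 s1(2) co(4) by linarith
    have b2: "2 * ip L (gap_force2 l U V) (\<lambda>x. c5 U x - d4 V x)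
        \<le> l\<^sup>2 * W2\<^sup>2 + (2 * K2 * L)\<^sup>2 * \<kappa> * gap_energy U V + 2 * (\<kappa> * gap_energy U V)"
      unfolding gap_force2_def using fw(2) w2 s2(2) co(5) by linarith
    have eq: "A * l\<^sup>2 + G * gap_energy U V = (l\<^sup>2 * W1\<^sup>2 + (2 * K1 * L)\<^sup>2 * \<kappa> * gap_energy U V + 2 * (\<kappa> * gap_energy U V))
      + (l\<^sup>2 * W2\<^sup>2 + (2 * K2 * L)\<^sup>2 * \<kappa> * gap_energy U V + 2 * (\<kappa> * gap_energy U V))"
      by (simp add: A_def G_def algebra_simps)
    show ?thesis
      unfolding eq using add_mono[OF b1 b2] by (simp only: distrib_left[of 2 "ip L _ _"])
  qed
  with A0 G0 show ?thesis by blast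
qed

text \<open>Both solutions start from the same projected data, so the gap energy starts at 0 and
  grows only through forces of size l. The premise \<open>C * l < 1\<close> keeps it below the
  threshold 1 on all of [0,T].\<close>

lemma gap_at_most_linear:
  assumes indep: "\<forall>u v w w'. f 1 (u, v, w) = f 1 (u, v, w') \<and> f 2 (u, v, w) = f 2 (u, v, w')"
    and R: "0 \<le> R" and T: "0 \<le> T"
  shows "\<exists>C\<ge>0. \<forall>l\<in>{0<..l0}. \<forall>U V. bresse_sol L \<rho>1 \<rho>2 b k k0 l g f U \<and> timo_sol L \<rho>1 \<rho>2 b k g f V \<and>
    V 0 = proj (U 0) \<and> (\<forall>t\<ge>0. nH6 L (U t) \<le> R) \<and> C * l < 1 \<longrightarrow> dist4 L (proj (U T)) (V T) \<le> C * l"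
proof -
  define \<kappa> where "\<kappa> = \<gamma>3 + 1 / \<rho>1 + 1 / \<rho>2"
  have \<kappa>0: "0 \<le> \<kappa>" using pos gamma3(2) by (simp add: \<kappa>_def)
  obtain A G where A0: "0 \<le> A" and G0: "0 \<le> G" and force: "\<And>l U V. l \<in> {0<..l0} \<Longrightarrow> inH6 L U \<Longrightarrow> inH4 L V \<Longrightarrow>
    nH6 L U \<le> R \<Longrightarrow> gap_energy U V \<le> 1 \<Longrightarrow>
    2 * (ip L (gap_force1 l U V) (\<lambda>x. c4 U x - d3 V x) + ip L (gap_force2 l U V) (\<lambda>x. c5 U x - d4 V x))
    \<le> A * l\<^sup>2 + G * gap_energy U V"
    using gap_force_bound[OF indep R] by blast
  define B where "B = A * T * exp (G * T)"
  have B0: "0 \<le> B" using A0 T by (simp add: B_def)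
  \<comment> \<open>The first summand makes \<open>C * l < 1\<close> imply
    \<open>B * l\<^sup>2 < 1\<close>, as the bootstrap requires; the second converts gap energy into
    distance.\<close>
  define C where "C = sqrt B + 2 * sqrt (\<kappa> * B)"
  have C0: "0 \<le> C" using B0 \<kappa>0 by (simp add: C_def)
  have "dist4 L (proj (U T)) (V T) \<le> C * l"
    if l: "l \<in> {0<..l0}" and U: "bresse_sol L \<rho>1 \<rho>2 b k k0 l g f U" and V: "timo_sol L \<rho>1 \<rho>2 b k g f V"
      and init: "V 0 = proj (U 0)" and UR: "\<forall>t\<ge>0. nH6 L (U t) \<le> R" and small: "C * l < 1" for l U V
  proof -
    have iU: "inH6 L (U t)" if "0 \<le> t" for t using U that unfolding bresse_sol_def by blast
    have iV: "inH4 L (V t)" if "0 \<le> t" for t using V that unfolding timo_sol_def by blast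
    define D where "D = (\<lambda>t. gap_energy (U t) (V t))"
    define D' where "D' = (\<lambda>t. 2 * (ip L (gap_force1 l (U t) (V t)) (\<lambda>x. c4 (U t) x - d3 (V t) x)
       + ip L (gap_force2 l (U t) (V t)) (\<lambda>x. c5 (U t) x - d4 (V t) x)))"
    have dD: "(D has_real_derivative D' t) (at t within {0..})" if "0 \<le> t" for t
      unfolding D_def D'_def by (rule gap_energy_derivative[OF U V that])
    have cD: "continuous_on {0..T} D"
      unfolding continuous_on_eq_continuous_within
    proof
      fix t assume "t \<in> {0..T}"
      then have "continuous (at t within {0..}) D" by (intro DERIV_continuous[OF dD]) auto
      then show "continuous (at t within {0..T}) D" by (rule continuous_within_subset) auto
    qed
    have D0: "D 0 = 0" by (simp add: D_def gap_energy_def init proj_components)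
    have l0: "0 < l" using l by simp
    have sB: "sqrt B * l \<le> C * l" using l0 \<kappa>0 B0 by (intro mult_right_mono) (auto simp: C_def)
    have "0 \<le> sqrt B * l" using B0 l0 by simp
    with sB small have "\<bar>sqrt B * l\<bar> < 1" by linarith
    then have "(sqrt B * l)\<^sup>2 < 1" by (simp only: abs_square_less_1)
    then have Bl: "B * l\<^sup>2 < 1" using B0 by (simp add: power_mult_distrib)
    have "D T \<le> B * l\<^sup>2"
    proof (rule bootstrap[OF cD T])
      fix \<tau> assume \<tau>: "0 \<le> \<tau>" "\<tau> \<le> T" and D1: "\<And>t. 0 \<le> t \<Longrightarrow> t \<le> \<tau> \<Longrightarrow> D t \<le> 1"
      have "D \<tau> \<le> (A * l\<^sup>2) * \<tau> * exp (G * \<tau>)"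
      proof (rule Gronwall_quadratic[where D'=D'])
        fix t assume t: "0 \<le> t" "t \<le> \<tau>"
        show "(D has_real_derivative D' t) (at t within {0..})" by (rule dD[OF t(1)])
        show "D' t \<le> A * l\<^sup>2 + G * D t"
          unfolding D_def D'_def using UR t D1[OF t] by (intro force l iU iV) (auto simp: D_def)
      qed (use D0 A0 G0 \<tau> in auto)
      also have "\<dots> \<le> (A * l\<^sup>2) * T * exp (G * T)"
        using \<tau> A0 G0 by (intro mult_mono) (auto intro: mult_left_mono)
      also have "\<dots> = B * l\<^sup>2" by (simp add: B_def)
      finally show "D \<tau> \<le> B * l\<^sup>2" .
    qed (use D0 Bl in auto)
    then have "\<kappa> * D T \<le> (\<kappa> * B) * l\<^sup>2" using \<kappa>0 by (simp add: mult_left_mono mult.assoc)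
    then have "sqrt (\<kappa> * D T) \<le> sqrt ((\<kappa> * B) * l\<^sup>2)" by (rule real_sqrt_le_mono)
    also have "\<dots> = sqrt (\<kappa> * B) * l" using l0 by (simp add: real_sqrt_mult)
    finally have "2 * sqrt (\<kappa> * D T) \<le> 2 * sqrt (\<kappa> * B) * l" by simp
    also have "\<dots> \<le> C * l" using l0 B0 by (intro mult_right_mono) (auto simp: C_def)
    finally show ?thesis
      using dist4_le_gap[OF iU[OF T] iV[OF T] \<kappa>_def] unfolding D_def by linarith
  qed
  with C0 show ?thesis by blast
qed

end

section \<open>Convergence of the projected attractors\<close>

lemma nH4_proj_le: "nH4 L (proj U) \<le> nH6 L U"
  unfolding nH4_def nH6_def proj_components by (intro real_sqrt_le_mono) simp

theorem theorem6p1: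
  fixes L \<rho>1 \<rho>2 b k k0 \<beta> mF p Cf \<gamma>3 l0 :: real
    and F :: "real \<times> real \<times> real \<Rightarrow> real"
    and f :: "nat \<Rightarrow> real \<times> real \<times> real \<Rightarrow> real"
    and Df :: "nat \<Rightarrow> nat \<Rightarrow> real \<times> real \<times> real \<Rightarrow> real"
    and g dg :: "nat \<Rightarrow> real \<Rightarrow> real"
    and m M :: "nat \<Rightarrow> real"
    and S :: "real \<Rightarrow> real \<Rightarrow> st6 \<Rightarrow> st6" and A :: "real \<Rightarrow> st6 set"
    and S0 :: "real \<Rightarrow> st4 \<Rightarrow> st4" and A0 :: "st4 set"
  assumes pos: "L > 0" "\<rho>1 > 0" "\<rho>2 > 0" "b > 0" "k > 0" "k0 > 0"
    and gamma3: "0 < l0" "l0 < pi / (2 * L)" "\<gamma>3 > 0"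
      "\<forall>l\<in>{0..l0}. \<forall>\<phi> \<psi> w. h10 L \<phi> \<and> h10 L \<psi> \<and> h10 L w \<longrightarrow>
         (nrm L (dx L \<phi>))\<^sup>2 + (nrm L (dx L \<psi>))\<^sup>2 + (nrm L (dx L w))\<^sup>2
         \<le> \<gamma>3 * (b * (nrm L (dx L \<psi>))\<^sup>2
                  + k * (nrm L (\<lambda>x. dx L \<phi> x + \<psi> x + l * w x))\<^sup>2
                  + k0 * (nrm L (\<lambda>x. dx L w x - l * \<phi> x))\<^sup>2)"
    and F1: "\<forall>z. (F has_derivative (\<lambda>h. f 1 z * fst h + f 2 z * fst (snd h) + f 3 z * snd (snd h))) (at z)"
      "\<forall>i\<in>{1,2,3}. \<forall>z. (f i has_derivative
          (\<lambda>h. Df i 1 z * fst h + Df i 2 z * fst (snd h) + Df i 3 z * snd (snd h))) (at z)"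
      "\<forall>i\<in>{1,2,3}. \<forall>j\<in>{1,2,3}. continuous_on UNIV (Df i j)"
    and F2: "\<beta> \<ge> 0" "mF \<ge> 0" "\<beta> < pi\<^sup>2 / (2 * \<gamma>3 * L\<^sup>2)"
      "\<forall>u v w. F (u, v, w) \<ge> - \<beta> * (u\<^sup>2 + v\<^sup>2 + w\<^sup>2) - mF"
    and F3: "p \<ge> 1" "Cf > 0"
      "\<forall>i\<in>{1,2,3}. \<forall>u v w.
         sqrt ((Df i 1 (u, v, w))\<^sup>2 + (Df i 2 (u, v, w))\<^sup>2 + (Df i 3 (u, v, w))\<^sup>2)
         \<le> Cf * (1 + rpw \<bar>u\<bar> (p - 1) + rpw \<bar>v\<bar> (p - 1) + rpw \<bar>w\<bar> (p - 1))"
    and F4: "\<forall>u v w. f 1 (u, v, w) * u + f 2 (u, v, w) * v + f 3 (u, v, w) * w - F (u, v, w)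
               \<ge> - \<beta> * (u\<^sup>2 + v\<^sup>2 + w\<^sup>2) - mF"
    and G1: "\<forall>i\<in>{1,2,3}. mono (g i) \<and> g i 0 = 0 \<and>
               (\<forall>s. (g i has_real_derivative dg i s) (at s)) \<and> continuous_on UNIV (dg i)"
    and G3: "\<forall>i\<in>{1,2,3}. m i > 0 \<and> M i > 0 \<and> (\<forall>s. m i \<le> dg i s \<and> dg i s \<le> M i)"
    and indep: "\<forall>u v w w'. f 1 (u, v, w) = f 1 (u, v, w') \<and> f 2 (u, v, w) = f 2 (u, v, w')"
    and bresse: "\<forall>l\<in>{0<..l0}. \<forall>U0. inH6 L U0 \<longrightarrow>
                   S l 0 U0 = U0 \<and> bresse_sol L \<rho>1 \<rho>2 b k k0 l g f (\<lambda>t. S l t U0)"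
    and attr: "\<forall>l\<in>{0<..l0}. global_attractor (inH6 L) (dist6 L) (nH6 L) (S l) (A l)"
    and timo: "\<forall>U0. inH4 L U0 \<longrightarrow> S0 0 U0 = U0 \<and> timo_sol L \<rho>1 \<rho>2 b k g f (\<lambda>t. S0 t U0)"
    and attr0: "global_attractor (inH4 L) (dist4 L) (nH4 L) S0 A0"
  shows "\<forall>e>0. eventually (\<lambda>l. hsemi (dist4 L) (proj ` A l) A0 < ereal e) (at_right 0)"
proof (intro allI impI)
  interpret bresse_data L \<rho>1 \<rho>2 b k k0 \<beta> mF \<gamma>3 l0 F f Df g dg m M
    by (rule bresse_data.intro) (fact pos gamma3 F1 F2 F4 G1 G3)+
  obtain R where R: "\<And>l x. l \<in> {0<..l0} \<Longrightarrow> x \<in> A l \<Longrightarrow> nH6 L x \<le> R"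
    using attractors_uniformly_bounded[OF bresse attr] by blast
  define R0 where "R0 = max R 0"
  \<comment> \<open>One ball containing the projections of all attractors with 0 < l \<le> l0, so
    the attraction time T found below is independent of l.\<close>
  define B where "B = {V. inH4 L V \<and> nH4 L V \<le> R0}"
  fix e :: real assume e: "0 < e"
  have "B \<subseteq> Collect (inH4 L) \<and> (\<exists>R. \<forall>x\<in>B. nH4 L x \<le> R)" by (auto simp: B_def)
  then have "\<forall>e>0. eventually (\<lambda>t. hsemi (dist4 L) (S0 t ` B) A0 < ereal e) at_top"
    using attr0 unfolding global_attractor_def by blast
  \<comment> \<open>Attraction and comparison each contribute at most e/8, and the weak triangle
    inequality doubles their sum to e/2. This keeps the supremum strictly below e.\<close>
  then have "eventually (\<lambda>t. hsemi (dist4 L) (S0 t ` B) A0 < ereal (e / 8)) at_top"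
    using e by simp
  then obtain T0 where "\<And>t. T0 \<le> t \<Longrightarrow> hsemi (dist4 L) (S0 t ` B) A0 < ereal (e / 8)"
    unfolding eventually_at_top_linorder by blast
  then obtain T where T: "0 \<le> T" and att: "hsemi (dist4 L) (S0 T ` B) A0 < ereal (e / 8)"
    by (metis max.cobounded1 max.cobounded2)
  have "0 \<le> R0" by (simp add: R0_def)
  from gap_at_most_linear[OF indep this T]
  obtain C where C: "0 \<le> C" and gap: "\<And>l U V. l \<in> {0<..l0} \<Longrightarrow> bresse_sol L \<rho>1 \<rho>2 b k k0 l g f U \<Longrightarrow>
      timo_sol L \<rho>1 \<rho>2 b k g f V \<Longrightarrow> V 0 = proj (U 0) \<Longrightarrow> (\<And>t. 0 \<le> t \<Longrightarrow> nH6 L (U t) \<le> R0) \<Longrightarrow> C * l < 1 \<Longrightarrow>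
      dist4 L (proj (U T)) (V T) \<le> C * l" by blast
  \<comment> \<open>Makes C l smaller than both 1, for the comparison, and e/8, for the tolerance;
    the denominator C + 1 also covers C = 0.\<close>
  define d where "d = min l0 (min 1 (e / 8) / (C + 1))"
  have d: "0 < d" using gamma3(1) e C by (simp add: d_def)
  show "eventually (\<lambda>l. hsemi (dist4 L) (proj ` A l) A0 < ereal e) (at_right 0)"
  proof (rule eventually_at_rightI[OF _ d])
    fix l assume "l \<in> {0<..<d}"
    then have l: "l \<in> {0<..l0}" and ld: "0 < l" "l < min 1 (e / 8) / (C + 1)" by (auto simp: d_def)
    have "C * l \<le> (C + 1) * l" using ld by simp
    also have "\<dots> < min 1 (e / 8)" using ld C by (simp add: pos_less_divide_eq mult.commute)
    finally have Cl: "C * l < 1" "C * l < e / 8" by auto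
    have ga: "global_attractor (inH6 L) (dist6 L) (nH6 L) (S l) (A l)" using attr l by blast
    have in6: "inH6 L y" if "y \<in> A l" for y using ga that unfolding global_attractor_def by blast
    have inv: "S l t ` A l = A l" if "0 \<le> t" for t using ga that unfolding global_attractor_def by blast
    have "hsemi (dist4 L) (proj ` A l) A0 \<le> ereal (e / 2)"
      unfolding hsemi_def
    proof (rule SUP_least)
      fix z assume "z \<in> proj ` A l"
      then obtain x where x: "x \<in> A l" "z = proj x" by blast
      then obtain y where y: "y \<in> A l" "x = S l T y" using inv[OF T] by blast
      have y0: "S l 0 y = y" and sol: "bresse_sol L \<rho>1 \<rho>2 b k k0 l g f (\<lambda>t. S l t y)"
        using bresse l in6[OF y(1)] by blast+
      have py: "inH4 L (proj y)"
        using in6[OF y(1)] by (simp add: inH4_def inH6_def proj_components)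
      then have p0: "S0 0 (proj y) = proj y" and tsol: "timo_sol L \<rho>1 \<rho>2 b k g f (\<lambda>t. S0 t (proj y))"
        using timo by blast+
      \<comment> \<open>Invariance keeps the whole forward trajectory of y in \<open>A l\<close>, so
        the uniform bound holds at all times.\<close>
      have bnd: "nH6 L (S l t y) \<le> R0" if "0 \<le> t" for t
      proof -
        have "S l t y \<in> A l" using inv[OF that] y(1) by blast
        then show ?thesis using R[OF l] by (simp add: R0_def le_max_iff_disj)
      qed
      have g: "dist4 L z (S0 T (proj y)) \<le> C * l"
        using gap[OF l sol tsol] bnd Cl(1) unfolding y0 p0 x(2) y(2) by blast
      have "nH4 L (proj y) \<le> R0"
        using nH4_proj_le[of L y] bnd[of 0] y0 by simp
      then have "S0 T (proj y) \<in> S0 T ` B" using py by (auto simp: B_def)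
      then have "(INF a\<in>A0. ereal (dist4 L (S0 T (proj y)) a)) \<le> hsemi (dist4 L) (S0 T ` B) A0"
        unfolding hsemi_def by (rule SUP_upper)
      then have "(INF a\<in>A0. ereal (dist4 L (S0 T (proj y)) a)) < ereal (e / 8)" using att by simp
      then obtain a where a: "a \<in> A0" "dist4 L (S0 T (proj y)) a < e / 8"
        unfolding INF_less_iff by auto
      have "inH4 L z" using in6[OF x(1)] by (simp add: x(2) inH4_def inH6_def proj_components)
      moreover have "inH4 L (S0 T (proj y))" using tsol T unfolding timo_sol_def by blast
      moreover have "inH4 L a" using attr0 a(1) unfolding global_attractor_def by blast
      ultimately have "dist4 L z a \<le> 2 * (dist4 L z (S0 T (proj y)) + dist4 L (S0 T (proj y)) a)"
        by (rule dist4_triangle)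
      also have "\<dots> \<le> e / 2" using g a(2) Cl(2) by simp
      finally show "(INF a\<in>A0. ereal (dist4 L z a)) \<le> ereal (e / 2)"
        using a(1) by (intro INF_lower2[of a]) simp_all
    qed
    also have "\<dots> < ereal e" using e by simp
    finally show "hsemi (dist4 L) (proj ` A l) A0 < ereal e" .
  qed
qed

end
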